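(* Let $\mathcal{M}$ be a connected Riemannian manifold, $R:T\mathcal{M}\to\mathcal{M}$ a retraction, $F:\mathcal{M}\to\mathbb{R}$ a $C^1$ function, $K$ a compact subset of $\mathcal{M}$, and $A>0$ a constant such that $\nabla F$ is $R$-Lipschitz on $K$ up to radius $A$. Let $\Omega=\{1,2,\dots,N\}$ with the uniform probability measure $\mu(\{l\})=\frac1N$. For $1\le b\le N$ let $\mathcal{P}_b(\Omega)$ be the set of subsets of $\Omega$ with exactly $b$ elements, equipped with the uniform probability measure $\mu_b(\{Y\})=1/\binom{N}{b}$ for $Y\in\mathcal{P}_b(\Omega)$. Let $H:\mathcal{M}\times\Omega\to T\mathcal{M}$ be a function such that: (a) for every $l\in\Omega$, $H(\bullet,l)$ is a tangent vector field on $\mathcal{M}$; (b) $\frac1N\sum_{l=1}^NH(x,l)=\nabla F(x)$ for every $x\in\mathcal{M}$; (c) $\|H(x,l)\|_x\le A$ for all $x\in K$ and $l\in\Omega$. Let $\{b_t\}_{t=0}^\infty$ be a sequence of integers with $1\le b_t\le N$ for all $t\ge0$, and let $\{Y_t\}_{t=0}^\infty$ be a sequence of independent random variables such that $Y_t$ takes values in $\mathcal{P}_{b_t}(\Omega)$ with probability distribution $\mu_{b_t}$. 1. Let $\{\gamma_t\}_{t=0}^\infty$ be a sequence of positive numbers with $\sum_{t=0}^\infty\gamma_t^2<\infty$, $\sum_{t=0}^\infty\gamma_t=\infty$ and $\gamma_t\le1$ for all $t\ge0$. Let $x_0$ be a fixed point in $K$ and let $\{x_t\}_{t=0}^\infty\subset\mathcal{M}$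 be generated by $$x_{t+1}=R_{x_t}\left(-\frac{\gamma_t}{b_t}\sum_{y\in Y_t}H(x_t,y)\right)\quad\text{for } t\ge0.$$ If $\{x_t\}_{t=0}^\infty\subset K$, then $F(x_t)$ converges almost surely and $\|\nabla F(x_t)\|_{x_t}\to0$ both almost surely and in mean square. 2. Let $x_0$ be a fixed point in $K$ and let $\alpha,\beta,\varepsilon$ be fixed positive numbers with $0<\varepsilon\le\frac12$ and $0<\alpha\le\beta^{\frac12+\varepsilon}$. Let $\{x_t\}_{t=0}^\infty\subset\mathcal{M}$ and $\{\eta_t\}_{t=0}^\infty$ be generated by $$x_{t+1}=R_{x_t}\left(-\frac{\eta_t}{b_t}\sum_{y\in Y_t}H(x_t,y)\right),\qquad\eta_t=\frac{\alpha}{\left(\beta+\sum_{k=0}^{t-1}\left\|\frac1{b_k}\sum_{y\in Y_k}H(x_k,y)\right\|_{x_k}^2\right)^{\frac12+\varepsilon}}\quad\text{for } t\ge0.$$ If $\{x_t\}_{t=0}^\infty\subset K$, then $F(x_t)$ converges almost surely and $\|\nabla F(x_t)\|_{x_t}\to0$ almost surely.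
   Context: Retraction: a $C^2$ map $R:T\mathcal{M}\to\mathcal{M}$ such that for every $x\in\mathcal{M}$ the restriction $R_x=R|_{T_x\mathcal{M}}$ satisfies $R_x(\mathbf{0}_x)=x$ and $dR_x(\mathbf{0}_x)=\mathrm{id}_{T_x\mathcal{M}}$ (under the standard identification $T_{\mathbf{0}_x}T_x\mathcal{M}\cong T_x\mathcal{M}$). $\langle\cdot,\cdot\rangle_x$ and $\|\cdot\|_x$ are the Riemannian inner product and norm on $T_x\mathcal{M}$; $\nabla F$ is the Riemannian gradient. For $x\in\mathcal{M}$, $\mathbf{u}\in T_x\mathcal{M}$, identify $T_{\mathbf{u}}(T_x\mathcal{M})$ with $T_x\mathcal{M}$, so that $dR_x|_{\mathbf{u}}:T_x\mathcal{M}\to T_{R_x(\mathbf{u})}\mathcal{M}$ is linear, and let $\mathrm{adj}(dR_x|_{\mathbf{u}}):T_{R_x(\mathbf{u})}\mathcal{M}\to T_x\mathcal{M}$ be its adjoint: $\langle\mathbf{v},\mathrm{adj}(dR_x|_{\mathbf{u}})(\mathbf{w})\rangle_x=\langle dR_x|_{\mathbf{u}}(\mathbf{v}),\mathbf{w}\rangle_{R_x(\mathbf{u})}$ for all $\mathbf{v},\mathbf{w}$. $R$-Lipschitz: for a subset $K\subset\mathcal{M}$ and $r>0$, a vector field $\mathbf{v}$ on $\mathcal{M}$ is $R$-Lipschitz on $K$ up to radius $r$ if there is a constant $C>0$ (depending on $K$ and $r$) such that $\|\mathrm{adj}(dR_x|_{\mathbf{u}})(\mathbf{v}(R_x(\mathbf{u})))-\mathbf{v}(x)\|_x\le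 C\|\mathbf{u}\|_x$ for all $x\in K$ and $\mathbf{u}\in T_x\mathcal{M}$ with $\|\mathbf{u}\|_x\le r$. An empty sum is $0$. "$\|\nabla F(x_t)\|_{x_t}\to0$ in mean square" means $\mathbb{E}(\|\nabla F(x_t)\|_{x_t}^2)\to0$. *)

theory Defs
  imports
    "HOL-Analysis.Analysis"
    "HOL-Probability.Probability"
    "HOL-Library.Function_Algebras"
begin

text \<open>
  Pointwise real vector space structure on functions. Tangent vectors are encoded below as
  functions (families of coordinate vectors), and their linear structure is the pointwise one.
\<close>

instantiation "fun" :: (type, real_vector) real_vector
begin

definition scaleR_fun_def: "a *\<^sub>R f = (\<lambda>x. a *\<^sub>R f x)"

instance
  by standard (simp_all add: scaleR_fun_def fun_eq_iff scaleR_add_right scaleR_add_left)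

end

text \<open>
  For open \<open>S\<close> in a finite-dimensional space this is the usual notion of a \<open>C\<^sup>k\<close> map:
  continuity of \<open>x \<mapsto> f' x v\<close> for each fixed \<open>v\<close> is then equivalent to continuity of the
  operator-valued derivative.
\<close>

primrec Ck_on :: "nat \<Rightarrow> ('a::real_normed_vector \<Rightarrow> 'b::real_normed_vector) \<Rightarrow> 'a set \<Rightarrow> bool" where
  "Ck_on 0 f S \<longleftrightarrow> continuous_on S f"
| "Ck_on (Suc k) f S \<longleftrightarrow>
     (\<exists>f'. (\<forall>x\<in>S. (f has_derivative f' x) (at x)) \<and> (\<forall>v. Ck_on k (\<lambda>x. f' x v) S))"

definition smooth_on :: "('a::real_normed_vector \<Rightarrow> 'b::real_normed_vector) \<Rightarrow> 'a set \<Rightarrow> bool" where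
  "smooth_on f S \<longleftrightarrow> (\<forall>k. Ck_on k f S)"

text \<open>
  The underlying set of the manifold is a whole type \<open>'m\<close>, Hausdorff and second countable by
  its sort. The model space \<open>'e\<close> is a real normed space, required to be finite-dimensional in
  \<open>smooth_atlas\<close>; unlike the class \<open>euclidean_space\<close> this does not exclude dimension 0.
  A chart is a pair of a domain and a coordinate map, whose values off the domain are irrelevant.
\<close>

type_synonym ('m, 'e) chart = "'m set \<times> ('m \<Rightarrow> 'e)"

definition chart_inv :: "('m, 'e) chart \<Rightarrow> 'e \<Rightarrow> 'm" where
  "chart_inv c = inv_into (fst c) (snd c)"

definition transition :: "('m, 'e) chart \<Rightarrow> ('m, 'e) chart \<Rightarrow> 'e \<Rightarrow> 'e" where
  "transition c d = snd d \<circ> chart_inv c"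

definition smooth_atlas ::
  "('m::{t2_space, second_countable_topology}, 'e::real_normed_vector) chart set \<Rightarrow> bool" where
  "smooth_atlas \<A> \<longleftrightarrow>
     (\<exists>B::'e set. finite B \<and> span B = UNIV) \<and>
     (\<Union>c\<in>\<A>. fst c) = UNIV \<and>
     (\<forall>c\<in>\<A>. open (fst c) \<and> open (snd c ` fst c) \<and>
        homeomorphism (fst c) (snd c ` fst c) (snd c) (chart_inv c)) \<and>
     (\<forall>c\<in>\<A>. \<forall>d\<in>\<A>. smooth_on (transition c d) (snd c ` (fst c \<inter> fst d)))"

definition Ck_function ::
  "('m, 'e::real_normed_vector) chart set \<Rightarrow> nat \<Rightarrow> ('m \<Rightarrow> real) \<Rightarrow> bool" where
  "Ck_function \<A> k F \<longleftrightarrow> (\<forall>c\<in>\<A>. Ck_on k (F \<circ> chart_inv c) (snd c ` fst c))"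

text \<open>
  A tangent vector at \<open>x\<close> is the family of its coordinate vectors in all charts around \<open>x\<close>,
  related by the derivatives of the transition maps. Components at all other indices are fixed
  to be 0, so that equality of tangent vectors is equality of functions.
\<close>

type_synonym ('m, 'e) tvec = "('m, 'e) chart \<Rightarrow> 'e"

definition tangent_space ::
  "('m, 'e::real_normed_vector) chart set \<Rightarrow> 'm \<Rightarrow> ('m, 'e) tvec set" where
  "tangent_space \<A> x = {v.
     (\<forall>c\<in>\<A>. \<forall>d\<in>\<A>. x \<in> fst c \<inter> fst d \<longrightarrow>
        v d = frechet_derivative (transition c d) (at (snd c x)) (v c)) \<and>
     (\<forall>c. \<not> (c \<in> \<A> \<and> x \<in> fst c) \<longrightarrow> v c = 0)}"

text \<open>The tangent vector at \<open>x\<close> whose coordinate vector in the chart \<open>c\<close> is \<open>e\<close>.\<close>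

definition tangent_of ::
  "('m, 'e::real_normed_vector) chart set \<Rightarrow> ('m, 'e) chart \<Rightarrow> 'm \<Rightarrow> 'e \<Rightarrow> ('m, 'e) tvec" where
  "tangent_of \<A> c x e = (\<lambda>d. if d \<in> \<A> \<and> x \<in> fst d
     then frechet_derivative (transition c d) (at (snd c x)) e else 0)"

definition vector_field ::
  "('m, 'e::real_normed_vector) chart set \<Rightarrow> ('m \<Rightarrow> ('m, 'e) tvec) \<Rightarrow> bool" where
  "vector_field \<A> X \<longleftrightarrow> (\<forall>x. X x \<in> tangent_space \<A> x)"

type_synonym ('m, 'e) metric = "'m \<Rightarrow> ('m, 'e) tvec \<Rightarrow> ('m, 'e) tvec \<Rightarrow> real"

definition riemannian_metric ::
  "('m, 'e::real_normed_vector) chart set \<Rightarrow> ('m, 'e) metric \<Rightarrow> bool" where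
  "riemannian_metric \<A> g \<longleftrightarrow>
     (\<forall>x. \<forall>u\<in>tangent_space \<A> x. \<forall>v\<in>tangent_space \<A> x.
        g x u v = g x v u \<and>
        (\<forall>w\<in>tangent_space \<A> x. g x (u + v) w = g x u w + g x v w) \<and>
        (\<forall>a. g x (a *\<^sub>R u) v = a * g x u v) \<and>
        (u \<noteq> 0 \<longrightarrow> g x u u > 0)) \<and>
     (\<forall>c\<in>\<A>. \<forall>e1 e2. smooth_on
        (\<lambda>z. g (chart_inv c z)
               (tangent_of \<A> c (chart_inv c z) e1) (tangent_of \<A> c (chart_inv c z) e2))
        (snd c ` fst c))"

definition riemannian_manifold ::
  "('m::{t2_space, second_countable_topology}, 'e::real_normed_vector) chart set \<Rightarrow>
   ('m, 'e) metric \<Rightarrow> bool" where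
  "riemannian_manifold \<A> g \<longleftrightarrow> smooth_atlas \<A> \<and> riemannian_metric \<A> g"

definition riem_norm :: "('m, 'e) metric \<Rightarrow> 'm \<Rightarrow> ('m, 'e) tvec \<Rightarrow> real" where
  "riem_norm g x u = sqrt (g x u u)"

text \<open>
  The differential of a real-valued function, computed in an arbitrary chart around \<open>x\<close>; on
  tangent vectors the result does not depend on the choice.
\<close>

definition dfun ::
  "('m, 'e::real_normed_vector) chart set \<Rightarrow> ('m \<Rightarrow> real) \<Rightarrow> 'm \<Rightarrow> ('m, 'e) tvec \<Rightarrow> real" where
  "dfun \<A> F x v = (let c = (SOME c. c \<in> \<A> \<and> x \<in> fst c)
     in frechet_derivative (F \<circ> chart_inv c) (at (snd c x)) (v c))"

definition gradient ::
  "('m, 'e::real_normed_vector) chart set \<Rightarrow> ('m, 'e) metric \<Rightarrow> ('m \<Rightarrow> real) \<Rightarrow>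
   'm \<Rightarrow> ('m, 'e) tvec" where
  "gradient \<A> g F x = (THE w. w \<in> tangent_space \<A> x \<and>
     (\<forall>v\<in>tangent_space \<A> x. g x w v = dfun \<A> F x v))"

text \<open>
  A map \<open>R\<close> from the tangent bundle is curried: \<open>R x u\<close> is the value at the vector \<open>u\<close> of the
  tangent space at \<open>x\<close>. A chart \<open>c\<close> of the manifold parametrises the part of the tangent bundle
  over its domain by pairs \<open>(z, e)\<close> of a point and a vector in coordinates, so that \<open>R\<close> becomes
  the following map. These parametrisations define the topology and the smooth structure of the
  tangent bundle.
\<close>

definition bundle_rep ::
  "('m, 'e::real_normed_vector) chart set \<Rightarrow> ('m, 'e) chart \<Rightarrow> ('m \<Rightarrow> ('m, 'e) tvec \<Rightarrow> 'm) \<Rightarrow>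
   'e \<times> 'e \<Rightarrow> 'm" where
  "bundle_rep \<A> c R = (\<lambda>(z, e). R (chart_inv c z) (tangent_of \<A> c (chart_inv c z) e))"

definition Ck_bundle_map ::
  "('m::topological_space, 'e::real_normed_vector) chart set \<Rightarrow> nat \<Rightarrow>
   ('m \<Rightarrow> ('m, 'e) tvec \<Rightarrow> 'm) \<Rightarrow> bool" where
  "Ck_bundle_map \<A> k R \<longleftrightarrow>
     (\<forall>c\<in>\<A>. continuous_on (snd c ` fst c \<times> UNIV) (bundle_rep \<A> c R) \<and>
        (\<forall>d\<in>\<A>. Ck_on k (snd d \<circ> bundle_rep \<A> c R)
           {p \<in> snd c ` fst c \<times> UNIV. bundle_rep \<A> c R p \<in> fst d}))"

text \<open>
  The differential at \<open>u\<close> of the restriction \<open>R x\<close> to the tangent space at \<open>x\<close>, applied to \<open>v\<close>.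
  Under the identification of the tangent space at \<open>u\<close> of that vector space with the space
  itself, \<open>v\<close> is the velocity at \<open>s = 0\<close> of the line \<open>s \<mapsto> u + s *\<^sub>R v\<close>, and the differential
  sends it to the velocity of the image curve.
\<close>

definition dretr ::
  "('m, 'e::real_normed_vector) chart set \<Rightarrow> ('m \<Rightarrow> ('m, 'e) tvec \<Rightarrow> 'm) \<Rightarrow>
   'm \<Rightarrow> ('m, 'e) tvec \<Rightarrow> ('m, 'e) tvec \<Rightarrow> ('m, 'e) tvec" where
  "dretr \<A> R x u v = (\<lambda>d. if d \<in> \<A> \<and> R x u \<in> fst d
     then vector_derivative (\<lambda>s. snd d (R x (u + s *\<^sub>R v))) (at 0) else 0)"

definition manifold_retraction ::
  "('m::topological_space, 'e::real_normed_vector) chart set \<Rightarrow>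
   ('m \<Rightarrow> ('m, 'e) tvec \<Rightarrow> 'm) \<Rightarrow> bool" where
  "manifold_retraction \<A> R \<longleftrightarrow> Ck_bundle_map \<A> 2 R \<and>
     (\<forall>x. R x 0 = x \<and> (\<forall>v\<in>tangent_space \<A> x. dretr \<A> R x 0 v = v))"

definition adj_dretr ::
  "('m, 'e::real_normed_vector) chart set \<Rightarrow> ('m, 'e) metric \<Rightarrow>
   ('m \<Rightarrow> ('m, 'e) tvec \<Rightarrow> 'm) \<Rightarrow> 'm \<Rightarrow> ('m, 'e) tvec \<Rightarrow> ('m, 'e) tvec \<Rightarrow> ('m, 'e) tvec" where
  "adj_dretr \<A> g R x u w = (THE z. z \<in> tangent_space \<A> x \<and>
     (\<forall>v\<in>tangent_space \<A> x. g x v z = g (R x u) (dretr \<A> R x u v) w))"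

definition R_lipschitz ::
  "('m, 'e::real_normed_vector) chart set \<Rightarrow> ('m, 'e) metric \<Rightarrow>
   ('m \<Rightarrow> ('m, 'e) tvec \<Rightarrow> 'm) \<Rightarrow> 'm set \<Rightarrow> real \<Rightarrow> ('m \<Rightarrow> ('m, 'e) tvec) \<Rightarrow> bool" where
  "R_lipschitz \<A> g R K r X \<longleftrightarrow>
     (\<exists>C>0. \<forall>x\<in>K. \<forall>u\<in>tangent_space \<A> x. riem_norm g x u \<le> r \<longrightarrow>
        riem_norm g x (adj_dretr \<A> g R x u (X (R x u)) - X x) \<le> C * riem_norm g x u)"

definition minibatches :: "nat \<Rightarrow> nat \<Rightarrow> nat set set" where
  "minibatches N b = {Y. Y \<subseteq> {1..N} \<and> card Y = b}"

end

theory Submission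
  imports Defs
begin

text \<open>
  The proof is the classical argument for stochastic approximation, carried out in local charts.

  Geometrically, two facts about the retraction are needed. The first order expansion
  \<open>F (R x u) = F x + g x (gradient F x) u + O(norm u ^ 2)\<close> holds uniformly for \<open>x\<close> in \<open>K\<close> and \<open>u\<close> in the ball
  of radius \<open>A\<close>: the derivative of \<open>F\<close> along the curve \<open>s \<mapsto> R x (s *\<^sub>R u)\<close> is the inner product of \<open>u\<close>
  with the pulled back gradient, which by the Lipschitz condition differs from the gradient at \<open>x\<close> by
  \<open>O(norm u)\<close> (\<open>retraction_first_order_bound\<close>). And a short step moves a point by at most a multiple of
  the length of the step, as seen in a chart (\<open>retraction_escape_function\<close>). Both rest on orthonormal
  frames that vary continuously in a chart (\<open>continuous_Gram_Schmidt\<close>).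

  Probabilistically, the minibatch mean is an unbiased estimate of the gradient given the past.
  Writing \<open>p t\<close> for the squared gradient norm at \<open>x t\<close>, the values \<open>F (x t)\<close> decrease by
  \<open>\<eta> t * p t\<close> in each step, up to a martingale difference and an error of the order of the squared step
  length. The squared step lengths have a bounded sum: in the first part because the squared step sizes
  do and the directions are bounded, in the second by comparison with an integral (\<open>adaptive_step_squares_bounded\<close>). Hence the error series
  converges, and the martingale is bounded in mean square and converges almost surely
  (\<open>martingale_convergence\<close>). As \<open>F\<close> is bounded on \<open>K\<close>, the series of the \<open>\<eta> t * p t\<close> converges
  almost surely, and therefore so does \<open>F (x t)\<close>.

  Since the step sizes have infinite sum, \<open>p t\<close> cannot stay away from zero. It cannot oscillate
  either: between a point with \<open>p t \<ge> \<epsilon>\<close> and a later one with \<open>p t \<le> \<epsilon> / 2\<close> the iterates cover a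
  definite distance, which uses up a definite amount of total step size and so of the convergent series
  (\<open>slow_sequence_tendsto_zero\<close>). This argument needs step lengths tending to zero but not
  step sizes tending to zero, which is why it also covers the adaptive rule on paths where the step
  size stays bounded away from zero. Convergence in mean square follows by dominated convergence.
\<close>

section \<open>Continuously varying inner products on a finite-dimensional space\<close>

definition inner_form :: "('e::real_vector \<Rightarrow> 'e \<Rightarrow> real) \<Rightarrow> bool" where
  "inner_form q \<longleftrightarrow> (\<forall>u v. q u v = q v u) \<and> (\<forall>u. linear (q u)) \<and> (\<forall>u. u \<noteq> 0 \<longrightarrow> q u u > 0)"

lemma inner_form_sym: "inner_form q \<Longrightarrow> q u v = q v u"
  by (simp add: inner_form_def)

lemma inner_form_linear_right: "inner_form q \<Longrightarrow> linear (q u)"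
  by (simp add: inner_form_def)

lemma inner_form_linear_left:
  assumes "inner_form q"
  shows "linear (\<lambda>u. q u v)"
proof -
  have "(\<lambda>u. q u v) = q v" using assms by (auto simp: inner_form_def)
  then show ?thesis using assms by (simp add: inner_form_def)
qed

lemmas inner_form_simps =
  linear_add[OF inner_form_linear_left] linear_add[OF inner_form_linear_right]
  linear_diff[OF inner_form_linear_left] linear_diff[OF inner_form_linear_right]
  linear_scale[OF inner_form_linear_left] linear_scale[OF inner_form_linear_right]
  linear_sum[OF inner_form_linear_left] linear_sum[OF inner_form_linear_right]
  linear_0[OF inner_form_linear_left] linear_0[OF inner_form_linear_right]

definition orthonormal_family :: "('e::real_vector \<Rightarrow> 'e \<Rightarrow> real) \<Rightarrow> 'i set \<Rightarrow> ('i \<Rightarrow> 'e) \<Rightarrow> bool" where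
  "orthonormal_family q I E \<longleftrightarrow> (\<forall>i\<in>I. \<forall>j\<in>I. q (E i) (E j) = (if i = j then 1 else 0))"

lemma orthonormal_coefficient:
  assumes "inner_form q" "orthonormal_family q I E" "finite I" "j \<in> I"
  shows "q (\<Sum>i\<in>I. a i *\<^sub>R E i) (E j) = a j"
proof -
  have "q (\<Sum>i\<in>I. a i *\<^sub>R E i) (E j) = (\<Sum>i\<in>I. a i * q (E i) (E j))"
    by (simp add: inner_form_simps[OF assms(1)])
  also have "\<dots> = (\<Sum>i\<in>I. if i = j then a i else 0)"
    by (rule sum.cong) (use assms in \<open>auto simp: orthonormal_family_def\<close>)
  finally show ?thesis using assms by simp
qed

lemma orthonormal_expansion:
  assumes q: "inner_form q" and E: "orthonormal_family q I E" "finite I"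
    and e: "e \<in> span (E ` I)"
  shows "e = (\<Sum>i\<in>I. q e (E i) *\<^sub>R E i)"
proof -
  from e obtain a where "e = (\<Sum>v\<in>E ` I. a v *\<^sub>R v)"
    by (auto simp: span_finite[OF finite_imageI[OF E(2)]])
  moreover have "inj_on E I"
  proof (rule inj_onI, rule ccontr)
    fix i j assume "i \<in> I" "j \<in> I" "E i = E j" "i \<noteq> j"
    then show False using E(1) unfolding orthonormal_family_def by (metis zero_neq_one)
  qed
  ultimately have e: "e = (\<Sum>i\<in>I. a (E i) *\<^sub>R E i)"
    by (simp add: sum.reindex)
  then have "q e (E j) = a (E j)" if "j \<in> I" for j
    using orthonormal_coefficient[OF q E that, of "\<lambda>i. a (E i)"] by simp
  then show ?thesis by (subst e) (rule sum.cong, auto)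
qed

lemma orthonormal_Parseval:
  assumes q: "inner_form q" and E: "orthonormal_family q I E" "finite I"
    and e: "e \<in> span (E ` I)"
  shows "q e e = (\<Sum>i\<in>I. (q e (E i))\<^sup>2)"
proof -
  have "q e e = q e (\<Sum>i\<in>I. q e (E i) *\<^sub>R E i)"
    using orthonormal_expansion[OF assms] by simp
  then show ?thesis by (simp add: inner_form_simps[OF q] power2_eq_square)
qed

text \<open>Continuity of \<open>f\<close> expressed by real coefficients in a fixed finite spanning set. Everything
  linear or bilinear that is continuous on fixed arguments is then continuous along \<open>f\<close> by
  expanding a finite sum.\<close>

definition continuous_comb ::
  "'e::real_vector set \<Rightarrow> 'z::topological_space set \<Rightarrow> ('z \<Rightarrow> 'e) \<Rightarrow> bool" where
  "continuous_comb B S f \<longleftrightarrow>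
     (\<exists>c. (\<forall>b\<in>B. continuous_on S (c b)) \<and> (\<forall>z\<in>S. f z = (\<Sum>b\<in>B. c b z *\<^sub>R b)))"

lemma continuous_comb_const:
  assumes "finite B" "span B = UNIV"
  shows "continuous_comb B S (\<lambda>_. e)"
proof -
  have "e \<in> span B" using assms by simp
  then obtain a where "e = (\<Sum>v\<in>B. a v *\<^sub>R v)" by (auto simp: span_finite[OF assms(1)])
  then show ?thesis unfolding continuous_comb_def by (intro exI[of _ "\<lambda>b _. a b"]) auto
qed

lemma continuous_comb_diff:
  assumes "continuous_comb B S f" "continuous_comb B S h"
  shows "continuous_comb B S (\<lambda>z. f z - h z)"
proof -
  from assms obtain c d where "\<forall>b\<in>B. continuous_on S (c b)" "\<forall>z\<in>S. f z = (\<Sum>b\<in>B. c b z *\<^sub>R b)"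
    "\<forall>b\<in>B. continuous_on S (d b)" "\<forall>z\<in>S. h z = (\<Sum>b\<in>B. d b z *\<^sub>R b)"
    unfolding continuous_comb_def by blast
  then show ?thesis unfolding continuous_comb_def
    by (intro exI[of _ "\<lambda>b z. c b z - d b z"])
       (auto simp: scaleR_diff_left sum_subtractf intro!: continuous_intros)
qed

lemma continuous_comb_scale:
  assumes "continuous_on S a" "continuous_comb B S f"
  shows "continuous_comb B S (\<lambda>z. a z *\<^sub>R f z)"
proof -
  from assms obtain c where "\<forall>b\<in>B. continuous_on S (c b)" "\<forall>z\<in>S. f z = (\<Sum>b\<in>B. c b z *\<^sub>R b)"
    unfolding continuous_comb_def by blast
  then show ?thesis unfolding continuous_comb_def using assms(1)
    by (intro exI[of _ "\<lambda>b z. a z * c b z"])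
       (auto simp: scaleR_sum_right intro!: continuous_intros)
qed

lemma continuous_comb_sum:
  assumes "\<And>i. i \<in> I \<Longrightarrow> continuous_comb B S (f i)"
  shows "continuous_comb B S (\<lambda>z. \<Sum>i\<in>I. f i z)"
proof -
  from assms obtain c where "\<And>i. i \<in> I \<Longrightarrow> \<forall>b\<in>B. continuous_on S (c i b)"
    "\<And>i. i \<in> I \<Longrightarrow> \<forall>z\<in>S. f i z = (\<Sum>b\<in>B. c i b z *\<^sub>R b)"
    unfolding continuous_comb_def by metis
  then show ?thesis unfolding continuous_comb_def
    by (intro exI[of _ "\<lambda>b z. \<Sum>i\<in>I. c i b z"])
       (auto simp: scaleR_sum_left sum.swap[of _ I B] intro!: continuous_intros)
qed

lemma continuous_comb_compose:
  assumes "continuous_comb B S f" "continuous_on T \<phi>" "\<phi> ` T \<subseteq> S"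
  shows "continuous_comb B T (\<lambda>z. f (\<phi> z))"
proof -
  from assms obtain c where "\<forall>b\<in>B. continuous_on S (c b)" "\<forall>z\<in>S. f z = (\<Sum>b\<in>B. c b z *\<^sub>R b)"
    unfolding continuous_comb_def by blast
  with assms(2,3) show ?thesis unfolding continuous_comb_def
    by (intro exI[of _ "\<lambda>b z. c b (\<phi> z)"]) (auto intro!: continuous_on_compose2[OF _ assms(2)])
qed

lemma continuous_comb_linear:
  fixes l :: "'z::topological_space \<Rightarrow> 'e::real_vector \<Rightarrow> 'f::real_normed_vector"
  assumes f: "continuous_comb B S f"
    and lin: "\<And>z. z \<in> S \<Longrightarrow> linear (l z)"
    and cont: "\<And>e. continuous_on S (\<lambda>z. l z e)"
  shows "continuous_on S (\<lambda>z. l z (f z))"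
proof -
  from f obtain c where c: "\<forall>b\<in>B. continuous_on S (c b)" "\<forall>z\<in>S. f z = (\<Sum>b\<in>B. c b z *\<^sub>R b)"
    unfolding continuous_comb_def by blast
  have "continuous_on S (\<lambda>z. \<Sum>b\<in>B. c b z *\<^sub>R l z b)"
    using c(1) cont by (auto intro!: continuous_intros)
  moreover have "l z (f z) = (\<Sum>b\<in>B. c b z *\<^sub>R l z b)" if "z \<in> S" for z
    using c(2) that by (simp add: linear_sum[OF lin] linear_scale[OF lin])
  ultimately show ?thesis by (simp cong: continuous_on_cong)
qed

lemma continuous_comb_continuous:
  fixes f :: "'z::topological_space \<Rightarrow> 'e::real_normed_vector"
  assumes "continuous_comb B S f"
  shows "continuous_on S f"
  using continuous_comb_linear[OF assms, of "\<lambda>_ e. e"] by (simp add: linear_id[unfolded id_def])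

lemma continuous_comb_form:
  fixes q :: "'z::topological_space \<Rightarrow> 'e::real_vector \<Rightarrow> 'e \<Rightarrow> real"
  assumes f: "continuous_comb B S f" and h: "continuous_comb B S h"
    and q: "\<And>z. z \<in> S \<Longrightarrow> inner_form (q z)"
    and cont: "\<And>u v. continuous_on S (\<lambda>z. q z u v)"
  shows "continuous_on S (\<lambda>z. q z (f z) (h z))"
proof (rule continuous_comb_linear[OF f])
  show "linear (\<lambda>e. q z e (h z))" if "z \<in> S" for z
    using inner_form_linear_left[OF q[OF that]] .
  show "continuous_on S (\<lambda>z. q z e (h z))" for e
    by (rule continuous_comb_linear[OF h]) (use q cont in \<open>auto intro: inner_form_linear_right\<close>)
qed

text \<open>The Gram--Schmidt process applied pointwise to a fixed basis only uses sums, products,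
  quotients and square roots of positive quantities, so the orthonormal basis it produces depends
  continuously on the parameter. Such a moving frame is used three times below: for
  the Riesz representation, for the continuity of the squared gradient norm, and for
  the local comparison of the Riemannian norm with the norm of the model space.\<close>

lemma continuous_Gram_Schmidt:
  fixes q :: "'z::topological_space \<Rightarrow> 'e::real_vector \<Rightarrow> 'e \<Rightarrow> real"
  assumes B: "finite B" "independent B" "span B = UNIV"
    and q: "\<And>z. z \<in> S \<Longrightarrow> inner_form (q z)"
    and cont: "\<And>u v. continuous_on S (\<lambda>z. q z u v)"
  obtains E where
    "\<And>i. i \<in> B \<Longrightarrow> continuous_comb B S (E i)"
    "\<And>z. z \<in> S \<Longrightarrow> orthonormal_family (q z) B (\<lambda>i. E i z)"
    "\<And>z. z \<in> S \<Longrightarrow> span ((\<lambda>i. E i z) ` B) = UNIV"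
proof -
  have "\<exists>E. (\<forall>i\<in>B'. continuous_comb B S (E i)) \<and>
      (\<forall>z\<in>S. orthonormal_family (q z) B' (\<lambda>i. E i z) \<and> (\<forall>i\<in>B'. E i z \<in> span B') \<and>
         B' \<subseteq> span ((\<lambda>i. E i z) ` B'))" if "finite B'" "B' \<subseteq> B" for B'
    using that
  proof (induction B')
    case empty
    show ?case by (auto simp: orthonormal_family_def)
  next
    case (insert v B')
    then obtain E where E: "\<And>i. i \<in> B' \<Longrightarrow> continuous_comb B S (E i)"
      and on: "\<And>z. z \<in> S \<Longrightarrow> orthonormal_family (q z) B' (\<lambda>i. E i z)"
      and sp: "\<And>z i. z \<in> S \<Longrightarrow> i \<in> B' \<Longrightarrow> E i z \<in> span B'"
      and sp': "\<And>z. z \<in> S \<Longrightarrow> B' \<subseteq> span ((\<lambda>i. E i z) ` B')"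
      by blast
    define w where "w z = v - (\<Sum>i\<in>B'. q z v (E i z) *\<^sub>R E i z)" for z
    define n where "n z = sqrt (q z (w z) (w z))" for z
    define E' where "E' = E(v := (\<lambda>z. (1 / n z) *\<^sub>R w z))"
    have E'_old: "E' i = E i" if "i \<in> B'" for i using that insert.hyps by (auto simp: E'_def)
    have E'_v: "E' v z = (1 / n z) *\<^sub>R w z" for z by (simp add: E'_def)
    have v_notin: "v \<notin> span B'"
    proof -
      have "independent (insert v B')" using B(2) insert.prems independent_mono by blast
      then show ?thesis using insert.hyps by (simp add: independent_insert)
    qed
    have w_nz: "w z \<noteq> 0" if "z \<in> S" for z
    proof
      assume "w z = 0"
      then have "v = (\<Sum>i\<in>B'. q z v (E i z) *\<^sub>R E i z)" by (simp add: w_def)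
      also have "\<dots> \<in> span B'" by (intro span_sum span_scale sp that)
      finally have "v \<in> span B'" .
      then show False using v_notin by simp
    qed
    have n_pos: "n z > 0" if "z \<in> S" for z
      using w_nz[OF that] q[OF that] by (simp add: n_def inner_form_def)
    note cv = continuous_comb_const[OF B(1,3), of S v]
    have summand: "continuous_comb B S (\<lambda>z. q z v (E i z) *\<^sub>R E i z)" if "i \<in> B'" for i
    proof -
      have "continuous_on S (\<lambda>z. q z v (E i z))"
        by (rule continuous_comb_form[where q = q and f = "\<lambda>_. v" and h = "E i", OF cv E[OF that] q cont])
      then show ?thesis by (rule continuous_comb_scale[OF _ E[OF that]])
    qed
    have "continuous_comb B S (\<lambda>z. \<Sum>i\<in>B'. q z v (E i z) *\<^sub>R E i z)"
      by (rule continuous_comb_sum[where f = "\<lambda>i z. q z v (E i z) *\<^sub>R E i z", OF summand])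
    then have cw: "continuous_comb B S w"
      unfolding w_def by (rule continuous_comb_diff[OF cv])
    have cn: "continuous_on S n"
      unfolding n_def
      by (rule continuous_on_real_sqrt, rule continuous_comb_form[where q = q, OF cw cw q cont])
    have "continuous_comb B S (\<lambda>z. (1 / n z) *\<^sub>R w z)"
    proof (rule continuous_comb_scale[OF _ cw])
      show "continuous_on S (\<lambda>z. 1 / n z)"
        using n_pos by (intro continuous_on_divide continuous_on_const cn) (metis less_irrefl)
    qed
    then have 1: "\<forall>i\<in>insert v B'. continuous_comb B S (E' i)"
      using E by (auto simp: E'_def)
    have 2: "orthonormal_family (q z) (insert v B') (\<lambda>i. E' i z)" if z: "z \<in> S" for z
    proof -
      note Q = q[OF z]
      have ww: "q z (w z) (w z) = (n z)\<^sup>2"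
        using n_pos[OF z] unfolding n_def by simp
      have vv: "q z (E' v z) (E' v z) = 1"
        using n_pos[OF z] by (simp add: E'_v inner_form_simps[OF Q] ww power2_eq_square)
      have wj: "q z (w z) (E j z) = 0" if "j \<in> B'" for j
        using orthonormal_coefficient[OF Q on[OF z] insert.hyps(1) that, of "\<lambda>i. q z v (E i z)"]
        by (simp add: w_def inner_form_simps(3)[OF Q])
      have vj: "q z (E' v z) (E' j z) = 0" "q z (E' j z) (E' v z) = 0" if "j \<in> B'" for j
        using wj[OF that] inner_form_sym[OF Q, of "w z"]
        by (simp_all add: E'_v E'_old[OF that] inner_form_simps[OF Q])
      show ?thesis
        using on[OF z] vv vj insert.hyps by (auto simp: orthonormal_family_def E'_old)
    qed
    have 3: "E' i z \<in> span (insert v B')" if z: "z \<in> S" and i: "i \<in> insert v B'" for i z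
    proof -
      have old: "E j z \<in> span (insert v B')" if "j \<in> B'" for j
        using sp[OF z that] span_mono[of B' "insert v B'"] by blast
      then have "w z \<in> span (insert v B')"
        unfolding w_def by (intro span_diff span_sum span_scale) (auto intro: span_base)
      then show ?thesis using i old by (auto simp: E'_v E'_old intro: span_scale)
    qed
    have 4: "insert v B' \<subseteq> span ((\<lambda>i. E' i z) ` insert v B')" if z: "z \<in> S" for z
    proof -
      let ?V = "span ((\<lambda>i. E' i z) ` insert v B')"
      have mem: "E' i z \<in> ?V" if "i \<in> insert v B'" for i using that by (intro span_base) blast
      have "v = n z *\<^sub>R E' v z + (\<Sum>i\<in>B'. q z v (E i z) *\<^sub>R E' i z)"
        using n_pos[OF z] by (simp add: E'_v E'_old w_def)
      also have "\<dots> \<in> ?V" by (intro span_add span_scale span_sum mem) auto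
      finally have "v \<in> ?V" .
      moreover have "(\<lambda>i. E i z) ` B' \<subseteq> (\<lambda>i. E' i z) ` insert v B'" using E'_old by force
      then have "B' \<subseteq> ?V" using sp'[OF z] span_mono by blast
      ultimately show ?thesis by simp
    qed
    show ?case using 1 2 3 4 by (intro exI[of _ E']) blast
  qed
  from this[OF B(1) subset_refl] obtain E where E: "\<forall>i\<in>B. continuous_comb B S (E i)"
    "\<forall>z\<in>S. orthonormal_family (q z) B (\<lambda>i. E i z) \<and> (\<forall>i\<in>B. E i z \<in> span B) \<and>
         B \<subseteq> span ((\<lambda>i. E i z) ` B)" by blast
  have "span ((\<lambda>i. E i z) ` B) = UNIV" if "z \<in> S" for z
    using E(2) that span_minimal[of B "span ((\<lambda>i. E i z) ` B)"] B(3) by auto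
  then show ?thesis using E that by blast
qed

section \<open>Charts and tangent vectors\<close>

lemma Ck_on_Suc_has_derivative:
  assumes "Ck_on (Suc k) f S" "x \<in> S"
  shows "(f has_derivative frechet_derivative f (at x)) (at x)"
  using assms by (auto simp: differentiable_def frechet_derivative_works[symmetric])

lemma Ck_on_imp_continuous_on:
  assumes "Ck_on k f S"
  shows "continuous_on S f"
proof (cases k)
  case (Suc n)
  then have "f differentiable (at x)" if "x \<in> S" for x
    using assms that by (auto simp: differentiable_def)
  then show ?thesis
    by (intro continuous_at_imp_continuous_on ballI differentiable_imp_continuous_within)
qed (use assms in simp)

lemma Ck_on_Suc_continuous_derivative:
  assumes "Ck_on (Suc k) f S"
  shows "continuous_on S (\<lambda>x. frechet_derivative f (at x) v)"
proof -
  from assms obtain f' where f': "\<forall>x\<in>S. (f has_derivative f' x) (at x)"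
    "\<forall>v. Ck_on k (\<lambda>x. f' x v) S" by auto
  have "continuous_on S (\<lambda>x. f' x v)" using f'(2) Ck_on_imp_continuous_on by blast
  moreover have "frechet_derivative f (at x) v = f' x v" if "x \<in> S" for x
    using f'(1) that frechet_derivative_at by metis
  ultimately show ?thesis by (simp cong: continuous_on_cong)
qed

lemma has_derivative_nhds_cong:
  assumes "(f has_derivative f') (at p)" "eventually (\<lambda>x. f x = h x) (nhds p)"
  shows "(h has_derivative f') (at p)"
  by (rule has_derivative_transform_eventually[OF assms(1)])
     (use assms(2) eventually_nhds_x_imp_x in \<open>auto simp: eventually_at_filter elim: eventually_mono\<close>)

locale riemannian_atlas =
  fixes \<A> :: "('m::{t2_space, second_countable_topology}, 'e::real_normed_vector) chart set"
    and g :: "('m, 'e) metric"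
  assumes atlas: "smooth_atlas \<A>" and metric: "riemannian_metric \<A> g"
begin

lemma chart_at: obtains c where "c \<in> \<A>" "x \<in> fst c"
  using atlas unfolding smooth_atlas_def by blast

lemma open_chart: "c \<in> \<A> \<Longrightarrow> open (fst c)"
  using atlas unfolding smooth_atlas_def by blast

lemma chart_homeomorphism:
  "c \<in> \<A> \<Longrightarrow> homeomorphism (fst c) (snd c ` fst c) (snd c) (chart_inv c)"
  using atlas unfolding smooth_atlas_def by blast

lemma continuous_chart: "c \<in> \<A> \<Longrightarrow> continuous_on (fst c) (snd c)"
  using chart_homeomorphism homeomorphism_cont1 by blast

lemma chart_inv_left: "c \<in> \<A> \<Longrightarrow> x \<in> fst c \<Longrightarrow> chart_inv c (snd c x) = x"
  using chart_homeomorphism homeomorphism_apply1 by blast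

lemma open_chart_image:
  assumes "c \<in> \<A>" "open U"
  shows "open (snd c ` (fst c \<inter> U))"
proof -
  have "openin (top_of_set (fst c)) (fst c \<inter> U)" using assms(2) by (simp add: openin_open_Int)
  then have "openin (top_of_set (snd c ` fst c)) (snd c ` (fst c \<inter> U))"
    using homeomorphism_imp_open_map[OF chart_homeomorphism[OF assms(1)]] by blast
  moreover have "open (snd c ` fst c)" using atlas assms(1) unfolding smooth_atlas_def by blast
  ultimately show ?thesis using openin_open_eq by blast
qed

lemma eventually_chart_inv_in:
  assumes "c \<in> \<A>" "x \<in> fst c" "open U" "x \<in> U"
  shows "eventually (\<lambda>z. chart_inv c z \<in> U) (nhds (snd c x))"
  unfolding eventually_nhds
  using open_chart_image[OF assms(1,3)] assms chart_inv_left
  by (intro exI[of _ "snd c ` (fst c \<inter> U)"]) auto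

lemma transition_has_derivative:
  assumes "c \<in> \<A>" "d \<in> \<A>" "x \<in> fst c" "x \<in> fst d"
  shows "(transition c d has_derivative frechet_derivative (transition c d) (at (snd c x)))
    (at (snd c x))"
proof -
  have "smooth_on (transition c d) (snd c ` (fst c \<inter> fst d))"
    using atlas assms unfolding smooth_atlas_def by blast
  then have "Ck_on (Suc 0) (transition c d) (snd c ` (fst c \<inter> fst d))"
    unfolding smooth_on_def by blast
  then show ?thesis by (rule Ck_on_Suc_has_derivative) (use assms in blast)
qed

text \<open>The chain rule through a chart. A map \<open>f\<close> into the manifold has a derivative only after
  composition with a chart; here \<open>f\<close> will be the inverse of another chart, or the retraction along
  a line in a tangent space.\<close>

lemma has_derivative_via_chart:
  fixes f :: "'p::real_normed_vector \<Rightarrow> 'm" and h :: "'m \<Rightarrow> 'q::real_normed_vector"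
  assumes "d \<in> \<A>" "((\<lambda>p. snd d (f p)) has_derivative f') (at p)"
    and "f p \<in> fst d" "eventually (\<lambda>p. f p \<in> fst d) (nhds p)"
    and "((h \<circ> chart_inv d) has_derivative h') (at (snd d (f p)))"
  shows "((\<lambda>p. h (f p)) has_derivative (\<lambda>v. h' (f' v))) (at p)"
proof -
  have "((\<lambda>p. (h \<circ> chart_inv d) (snd d (f p))) has_derivative (\<lambda>v. h' (f' v))) (at p)"
    by (rule has_derivative_compose[OF assms(2,5)])
  moreover have "eventually (\<lambda>p. (h \<circ> chart_inv d) (snd d (f p)) = h (f p)) (nhds p)"
    using assms(4) by eventually_elim (simp add: chart_inv_left[OF assms(1)])
  ultimately show ?thesis
    by (rule has_derivative_nhds_cong)
qed

lemma has_derivative_change_chart: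
  fixes f :: "'p::real_normed_vector \<Rightarrow> 'm"
  assumes "d \<in> \<A>" "d' \<in> \<A>" "((\<lambda>p. snd d (f p)) has_derivative f') (at p)"
    and "f p \<in> fst d" "f p \<in> fst d'" "eventually (\<lambda>p. f p \<in> fst d) (nhds p)"
  shows "((\<lambda>p. snd d' (f p)) has_derivative
    (\<lambda>v. frechet_derivative (transition d d') (at (snd d (f p))) (f' v))) (at p)"
  by (rule has_derivative_via_chart[OF assms(1,3,4,6)])
     (use transition_has_derivative[OF assms(1,2,4,5)] in \<open>simp add: transition_def o_def\<close>)

lemma transition_derivative_self:
  assumes "c \<in> \<A>" "x \<in> fst c"
  shows "frechet_derivative (transition c c) (at (snd c x)) = (\<lambda>e. e)"
proof -
  have "eventually (\<lambda>z. z \<in> snd c ` (fst c \<inter> UNIV)) (nhds (snd c x))"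
    using open_chart_image[OF assms(1) open_UNIV] assms(2) by (intro eventually_nhds_in_open) auto
  then have "eventually (\<lambda>z. z = transition c c z) (nhds (snd c x))"
    by eventually_elim (auto simp: transition_def chart_inv_left[OF assms(1)])
  moreover have "((\<lambda>z. z) has_derivative (\<lambda>e. e)) (at (snd c x))" by (rule has_derivative_ident)
  ultimately have "(transition c c has_derivative (\<lambda>e. e)) (at (snd c x))"
    by (intro has_derivative_nhds_cong[of "\<lambda>z. z" _ _ "transition c c"])
  then show ?thesis using frechet_derivative_at by metis
qed

text \<open>This makes the coordinate vectors listed by \<open>tangent_of\<close> compatible with each other, so that a
  chart around \<open>x\<close> identifies the model space with the tangent space at \<open>x\<close>.\<close>

lemma transition_derivative_cocycle:
  assumes "c \<in> \<A>" "d \<in> \<A>" "d' \<in> \<A>" "x \<in> fst c" "x \<in> fst d" "x \<in> fst d'"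
  shows "frechet_derivative (transition c d') (at (snd c x)) e =
    frechet_derivative (transition d d') (at (snd d x))
      (frechet_derivative (transition c d) (at (snd c x)) e)"
proof -
  have inv: "chart_inv c (snd c x) = x" using chart_inv_left assms by blast
  have "((\<lambda>z. snd d (chart_inv c z)) has_derivative
      frechet_derivative (transition c d) (at (snd c x))) (at (snd c x))"
    using transition_has_derivative[OF assms(1,2,4,5)] by (simp add: transition_def o_def)
  then have "((\<lambda>z. snd d' (chart_inv c z)) has_derivative
      (\<lambda>v. frechet_derivative (transition d d') (at (snd d (chart_inv c (snd c x))))
        (frechet_derivative (transition c d) (at (snd c x)) v))) (at (snd c x))"
    by (rule has_derivative_change_chart[OF assms(2,3)])
       (use assms inv eventually_chart_inv_in[OF assms(1,4) open_chart] in auto)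
  then have "(transition c d' has_derivative
      (\<lambda>v. frechet_derivative (transition d d') (at (snd d x))
        (frechet_derivative (transition c d) (at (snd c x)) v))) (at (snd c x))"
    by (simp add: transition_def o_def inv)
  from frechet_derivative_at[OF this] show ?thesis by metis
qed

lemma tangent_of_in_tangent_space:
  assumes "c \<in> \<A>" "x \<in> fst c"
  shows "tangent_of \<A> c x e \<in> tangent_space \<A> x"
  unfolding tangent_space_def tangent_of_def
proof (intro CollectI conjI ballI allI impI)
  fix d d' assume "d \<in> \<A>" "d' \<in> \<A>" "x \<in> fst d \<inter> fst d'"
  then show "(if d' \<in> \<A> \<and> x \<in> fst d' then frechet_derivative (transition c d') (at (snd c x)) e else 0) =
    frechet_derivative (transition d d') (at (snd d x))
      (if d \<in> \<A> \<and> x \<in> fst d then frechet_derivative (transition c d) (at (snd c x)) e else 0)"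
    using transition_derivative_cocycle[OF assms(1) _ _ assms(2), of d d' e] by simp
qed auto

lemma tangent_of_component:
  assumes "c \<in> \<A>" "x \<in> fst c"
  shows "tangent_of \<A> c x e c = e"
  using assms transition_derivative_self by (simp add: tangent_of_def)

lemma tangent_of_eq:
  assumes "c \<in> \<A>" "x \<in> fst c" "v \<in> tangent_space \<A> x"
  shows "tangent_of \<A> c x (v c) = v"
proof
  fix d
  show "tangent_of \<A> c x (v c) d = v d"
  proof (cases "d \<in> \<A> \<and> x \<in> fst d")
    case True
    then have "v d = frechet_derivative (transition c d) (at (snd c x)) (v c)"
      using assms unfolding tangent_space_def by blast
    with True show ?thesis by (simp add: tangent_of_def)
  next
    case False
    then have "v d = 0" using assms unfolding tangent_space_def by blast
    with False show ?thesis by (auto simp: tangent_of_def)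
  qed
qed

lemma linear_tangent_of:
  assumes "c \<in> \<A>" "x \<in> fst c"
  shows "linear (tangent_of \<A> c x)"
proof -
  have lin: "linear (frechet_derivative (transition c d) (at (snd c x)))"
    if "d \<in> \<A>" "x \<in> fst d" for d
    using transition_has_derivative[OF assms(1) that(1) assms(2) that(2)]
    by (rule has_derivative_linear)
  show ?thesis
    by (rule linearI)
       (auto simp: tangent_of_def fun_eq_iff scaleR_fun_def linear_add[OF lin] linear_scale[OF lin])
qed

lemma tangent_space_eq_range:
  assumes "c \<in> \<A>" "x \<in> fst c"
  shows "tangent_space \<A> x = range (tangent_of \<A> c x)"
proof (intro equalityI subsetI)
  fix v assume "v \<in> tangent_space \<A> x"
  then have "v = tangent_of \<A> c x (v c)" by (simp add: tangent_of_eq[OF assms])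
  then show "v \<in> range (tangent_of \<A> c x)" by blast
qed (use tangent_of_in_tangent_space[OF assms] in blast)

lemma subspace_tangent_space: "subspace (tangent_space \<A> x)"
proof -
  obtain c where c: "c \<in> \<A>" "x \<in> fst c" by (rule chart_at)
  show ?thesis
    unfolding tangent_space_eq_range[OF c]
    by (rule linear_subspace_image[OF linear_tangent_of[OF c] subspace_UNIV])
qed

lemmas tangent_add = subspace_add[OF subspace_tangent_space]
  and tangent_scale = subspace_scale[OF subspace_tangent_space]
  and tangent_diff = subspace_diff[OF subspace_tangent_space]
  and tangent_0 = subspace_0[OF subspace_tangent_space]
  and tangent_sum = subspace_sum[OF subspace_tangent_space]

section \<open>The Riemannian metric in a chart\<close>

definition chart_form :: "('m, 'e) chart \<Rightarrow> 'm \<Rightarrow> 'e \<Rightarrow> 'e \<Rightarrow> real" where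
  "chart_form c x e1 e2 = g x (tangent_of \<A> c x e1) (tangent_of \<A> c x e2)"

lemma metric_sym:
  "u \<in> tangent_space \<A> x \<Longrightarrow> v \<in> tangent_space \<A> x \<Longrightarrow> g x u v = g x v u"
  using metric unfolding riemannian_metric_def by blast

lemma metric_add_left:
  "u \<in> tangent_space \<A> x \<Longrightarrow> v \<in> tangent_space \<A> x \<Longrightarrow> w \<in> tangent_space \<A> x \<Longrightarrow>
    g x (u + v) w = g x u w + g x v w"
  using metric unfolding riemannian_metric_def by blast

lemma metric_scale_left:
  "u \<in> tangent_space \<A> x \<Longrightarrow> v \<in> tangent_space \<A> x \<Longrightarrow> g x (a *\<^sub>R u) v = a * g x u v"
  using metric unfolding riemannian_metric_def by blast

lemma metric_pos: "u \<in> tangent_space \<A> x \<Longrightarrow> u \<noteq> 0 \<Longrightarrow> g x u u > 0"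
  using metric unfolding riemannian_metric_def by blast

lemma metric_add_right:
  "u \<in> tangent_space \<A> x \<Longrightarrow> v \<in> tangent_space \<A> x \<Longrightarrow> w \<in> tangent_space \<A> x \<Longrightarrow>
    g x w (u + v) = g x w u + g x w v"
  using metric_add_left metric_sym tangent_add by metis

lemma metric_scale_right:
  "u \<in> tangent_space \<A> x \<Longrightarrow> v \<in> tangent_space \<A> x \<Longrightarrow> g x v (a *\<^sub>R u) = a * g x v u"
  using metric_scale_left metric_sym tangent_scale by metis

lemma metric_sum_right:
  assumes "finite I" "w \<in> tangent_space \<A> x" "\<And>i. i \<in> I \<Longrightarrow> f i \<in> tangent_space \<A> x"
  shows "g x w (\<Sum>i\<in>I. f i) = (\<Sum>i\<in>I. g x w (f i))"
  using assms(1,3)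
proof (induction I)
  case empty
  show ?case
    using metric_scale_right[OF tangent_0 assms(2), of 0]
    by (simp only: sum.empty scaleR_zero_left mult_zero_left)
next
  case (insert i I)
  have "g x w (\<Sum>i\<in>insert i I. f i) = g x w (f i + (\<Sum>i\<in>I. f i))"
    by (simp only: sum.insert[OF insert.hyps])
  also have "\<dots> = g x w (f i) + g x w (\<Sum>i\<in>I. f i)"
    by (intro metric_add_right tangent_sum assms(2) insert.prems) auto
  also have "g x w (\<Sum>i\<in>I. f i) = (\<Sum>i\<in>I. g x w (f i))"
    by (rule insert.IH) (use insert.prems in blast)
  finally show ?case by (simp only: sum.insert[OF insert.hyps])
qed

lemma metric_nonneg: "u \<in> tangent_space \<A> x \<Longrightarrow> g x u u \<ge> 0"
  using metric_pos[of u x] metric_scale_right[OF tangent_0 tangent_0, of x 0] by (cases "u = 0") auto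

lemma riem_norm_nonneg: "u \<in> tangent_space \<A> x \<Longrightarrow> riem_norm g x u \<ge> 0"
  by (simp add: riem_norm_def metric_nonneg)

lemma riem_norm_square: "u \<in> tangent_space \<A> x \<Longrightarrow> (riem_norm g x u)\<^sup>2 = g x u u"
  by (simp add: riem_norm_def metric_nonneg)

lemma riem_norm_scale:
  "u \<in> tangent_space \<A> x \<Longrightarrow> riem_norm g x (a *\<^sub>R u) = \<bar>a\<bar> * riem_norm g x u"
  by (simp add: riem_norm_def metric_scale_left metric_scale_right tangent_scale real_sqrt_mult
      flip: mult.assoc power2_eq_square)

lemma inner_form_chart_form:
  assumes c: "c \<in> \<A>" "x \<in> fst c"
  shows "inner_form (chart_form c x)"
proof -
  note T = tangent_of_in_tangent_space[OF c] and L = linear_tangent_of[OF c]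
  have "tangent_of \<A> c x e \<noteq> 0" if "e \<noteq> 0" for e
    using tangent_of_component[OF c, of e] that by auto
  then show ?thesis
    unfolding inner_form_def chart_form_def
    by (auto intro!: linearI metric_sym metric_pos T
        simp: linear_add[OF L] linear_scale[OF L] metric_add_right metric_scale_right T)
qed

lemma continuous_chart_form:
  assumes c: "c \<in> \<A>"
  shows "continuous_on (fst c) (\<lambda>x. chart_form c x e1 e2)"
proof -
  let ?f = "\<lambda>z. g (chart_inv c z)
     (tangent_of \<A> c (chart_inv c z) e1) (tangent_of \<A> c (chart_inv c z) e2)"
  have "smooth_on ?f (snd c ` fst c)"
    using metric c unfolding riemannian_metric_def by blast
  then have "Ck_on 0 ?f (snd c ` fst c)" unfolding smooth_on_def by blast
  then have "continuous_on (fst c) (\<lambda>x. ?f (snd c x))"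
    using continuous_on_compose2[OF _ continuous_chart[OF c], of "snd c ` fst c" ?f] by simp
  then show ?thesis
    by (rule continuous_on_eq) (simp add: chart_form_def chart_inv_left[OF c])
qed

lemma orthonormal_frame:
  assumes c: "c \<in> \<A>"
  obtains B E where "finite B" "span B = UNIV"
    "\<And>i. i \<in> B \<Longrightarrow> continuous_comb B (fst c) (E i)"
    "\<And>x. x \<in> fst c \<Longrightarrow> orthonormal_family (chart_form c x) B (\<lambda>i. E i x)"
    "\<And>x. x \<in> fst c \<Longrightarrow> span ((\<lambda>i. E i x) ` B) = UNIV"
proof -
  obtain B0 :: "'e set" where B0: "finite B0" "span B0 = UNIV"
    using atlas unfolding smooth_atlas_def by blast
  obtain B where B: "B \<subseteq> B0" "independent B" "B0 \<subseteq> span B"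
    using maximal_independent_subset by blast
  have fin: "finite B" using B(1) B0(1) finite_subset by blast
  have sp: "span B = UNIV" using B0(2) B(3) span_minimal[of B0 "span B"] by auto
  obtain E where "\<And>i. i \<in> B \<Longrightarrow> continuous_comb B (fst c) (E i)"
    "\<And>x. x \<in> fst c \<Longrightarrow> orthonormal_family (chart_form c x) B (\<lambda>i. E i x)"
    "\<And>x. x \<in> fst c \<Longrightarrow> span ((\<lambda>i. E i x) ` B) = UNIV"
    using continuous_Gram_Schmidt[where q = "chart_form c" and S = "fst c", OF fin B(2) sp
        inner_form_chart_form[OF c] continuous_chart_form[OF c]] by blast
  then show ?thesis by (rule that[OF fin sp])
qed

text \<open>In an orthonormal basis the representing vector has the values of \<open>l\<close> on that basis as its
  coordinates. The unique existence is what gives meaning to the definite descriptions in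
  \<open>gradient\<close> and \<open>adj_dretr\<close>.\<close>

lemma Riesz_representation:
  assumes add: "\<And>u v. u \<in> tangent_space \<A> x \<Longrightarrow> v \<in> tangent_space \<A> x \<Longrightarrow> l (u + v) = l u + l v"
    and scale: "\<And>a u. u \<in> tangent_space \<A> x \<Longrightarrow> l (a *\<^sub>R u) = a * l u"
  shows "\<exists>!w. w \<in> tangent_space \<A> x \<and> (\<forall>v\<in>tangent_space \<A> x. g x w v = l v)"
proof -
  obtain c where c: "c \<in> \<A>" "x \<in> fst c" by (rule chart_at)
  obtain B E where "finite B" "span B = UNIV"
    "\<And>i. i \<in> B \<Longrightarrow> continuous_comb B (fst c) (E i)"
    "\<And>x. x \<in> fst c \<Longrightarrow> orthonormal_family (chart_form c x) B (\<lambda>i. E i x)"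
    "\<And>x. x \<in> fst c \<Longrightarrow> span ((\<lambda>i. E i x) ` B) = UNIV"
    using orthonormal_frame[OF c(1)] by blast
  note B = this(1) this(4)[OF c(2)] this(5)[OF c(2)]
  note T = tangent_of_in_tangent_space[OF c] and L = linear_tangent_of[OF c]
    and Q = inner_form_chart_form[OF c]
  define l' where "l' e = l (tangent_of \<A> c x e)" for e
  have l': "linear l'"
    unfolding l'_def by (rule linearI) (simp_all add: linear_add[OF L] linear_scale[OF L] add scale T)
  define e where "e = (\<Sum>i\<in>B. l' (E i x) *\<^sub>R E i x)"
  have rep: "chart_form c x e v = l' v" for v
  proof -
    have "chart_form c x e v = (\<Sum>i\<in>B. l' (E i x) * chart_form c x v (E i x))"
      unfolding e_def by (simp add: inner_form_simps[OF Q] inner_form_sym[OF Q, of v])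
    also have "\<dots> = l' (\<Sum>i\<in>B. chart_form c x v (E i x) *\<^sub>R E i x)"
      by (simp add: linear_sum[OF l'] linear_scale[OF l'] mult.commute)
    also have "\<dots> = l' v"
      using orthonormal_expansion[OF Q B(2,1), of v] B(3) by simp
    finally show ?thesis .
  qed
  show ?thesis
  proof (rule ex1I[of _ "tangent_of \<A> c x e"], intro conjI ballI)
    show "tangent_of \<A> c x e \<in> tangent_space \<A> x" by (rule T)
  next
    fix v assume v: "v \<in> tangent_space \<A> x"
    show "g x (tangent_of \<A> c x e) v = l v"
      using rep[of "v c"] tangent_of_eq[OF c v] by (simp add: chart_form_def l'_def)
  next
    fix w assume w: "w \<in> tangent_space \<A> x \<and> (\<forall>v\<in>tangent_space \<A> x. g x w v = l v)"
    have "chart_form c x (w c - e) v = 0" for v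
      using rep[of v] w T tangent_of_eq[OF c, of w]
      by (simp add: inner_form_simps[OF Q]) (simp add: chart_form_def l'_def)
    then have "w c = e" using Q unfolding inner_form_def
      by (metis eq_iff_diff_eq_0 less_irrefl)
    then show "w = tangent_of \<A> c x e" using tangent_of_eq[OF c, of w] w by simp
  qed
qed

lemma riemannian_Cauchy_Schwarz:
  assumes u: "u \<in> tangent_space \<A> x" and v: "v \<in> tangent_space \<A> x"
  shows "\<bar>g x u v\<bar> \<le> riem_norm g x u * riem_norm g x v"
proof -
  obtain c where c: "c \<in> \<A>" "x \<in> fst c" by (rule chart_at)
  have "(g x u v)\<^sup>2 \<le> g x u u * g x v v"
  proof (cases "v = 0")
    case True
    then show ?thesis using metric_scale_right[OF tangent_0 u, of 0]
        metric_scale_right[OF tangent_0 tangent_0, of x 0] by simp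
  next
    case False
    define w where "w = g x v v *\<^sub>R u + (- g x u v) *\<^sub>R v"
    have "0 \<le> g x w w" unfolding w_def
      by (intro metric_nonneg tangent_add tangent_scale u v)
    also have "g x w w = g x v v * (g x u u * g x v v - (g x u v)\<^sup>2)"
      unfolding w_def using u v metric_sym[OF u v]
      by (simp add: metric_add_left metric_add_right metric_scale_left metric_scale_right
          tangent_add tangent_scale algebra_simps power2_eq_square
          del: scaleR_minus_left add_uminus_conv_diff)
    finally show ?thesis using metric_pos[OF v False] by (simp add: zero_le_mult_iff)
  qed
  then have "sqrt ((g x u v)\<^sup>2) \<le> sqrt (g x u u * g x v v)" by (rule real_sqrt_le_mono)
  then show ?thesis by (simp add: riem_norm_def real_sqrt_mult)
qed

text \<open>The bilinear form is only positive definite on the tangent space, so this is derived by pairing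
  the average with itself and applying the Cauchy--Schwarz inequality to each summand.\<close>

lemma riem_norm_average_le:
  assumes "finite I" "I \<noteq> {}"
    and f: "\<And>i. i \<in> I \<Longrightarrow> f i \<in> tangent_space \<A> x" "\<And>i. i \<in> I \<Longrightarrow> riem_norm g x (f i) \<le> M"
  shows "riem_norm g x ((1 / real (card I)) *\<^sub>R (\<Sum>i\<in>I. f i)) \<le> M"
proof -
  define G where "G = (1 / real (card I)) *\<^sub>R (\<Sum>i\<in>I. f i)"
  have G: "G \<in> tangent_space \<A> x" unfolding G_def by (intro tangent_scale tangent_sum f)
  have M: "M \<ge> 0" using f assms(2) riem_norm_nonneg by (metis all_not_in_conv order_trans)
  have "(riem_norm g x G)\<^sup>2 = g x G G" using riem_norm_square[OF G] .
  also have "\<dots> = (1 / real (card I)) * (\<Sum>i\<in>I. g x G (f i))"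
    by (subst (2) G_def)
       (simp add: metric_scale_right metric_sum_right[OF assms(1) G] G f tangent_sum)
  also have "\<dots> \<le> (1 / real (card I)) * (\<Sum>i\<in>I. riem_norm g x G * M)"
  proof (intro mult_left_mono sum_mono)
    fix i assume i: "i \<in> I"
    have "g x G (f i) \<le> riem_norm g x G * riem_norm g x (f i)"
      using riemannian_Cauchy_Schwarz[OF G f(1)[OF i]] by simp
    also have "\<dots> \<le> riem_norm g x G * M"
      by (intro mult_left_mono f i riem_norm_nonneg G)
    finally show "g x G (f i) \<le> riem_norm g x G * M" .
  qed simp
  also have "\<dots> = riem_norm g x G * M" using assms by (simp add: card_gt_0_iff)
  finally have "riem_norm g x G * riem_norm g x G \<le> riem_norm g x G * M"
    by (simp add: power2_eq_square)
  then show ?thesis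
    using M riem_norm_nonneg[OF G] by (fold G_def) (cases "riem_norm g x G = 0", auto)
qed

end

section \<open>The gradient\<close>

lemma scaleR_fun_apply: "(a *\<^sub>R f) x = a *\<^sub>R f x"
  by (simp add: scaleR_fun_def)

context riemannian_atlas
begin

lemma C1_has_derivative:
  assumes F: "Ck_function \<A> 1 F" and c: "c \<in> \<A>" "x \<in> fst c"
  shows "((F \<circ> chart_inv c) has_derivative frechet_derivative (F \<circ> chart_inv c) (at (snd c x)))
    (at (snd c x))"
proof -
  have "Ck_on (Suc 0) (F \<circ> chart_inv c) (snd c ` fst c)"
    using F c(1) by (simp only: Ck_function_def One_nat_def)
  then show ?thesis by (rule Ck_on_Suc_has_derivative) (use c in blast)
qed

text \<open>The chain rule for the transition map to the chart chosen inside \<open>dfun\<close>.\<close>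

lemma dfun_eq:
  assumes F: "Ck_function \<A> 1 F" and c: "c \<in> \<A>" "x \<in> fst c" and v: "v \<in> tangent_space \<A> x"
  shows "dfun \<A> F x v = frechet_derivative (F \<circ> chart_inv c) (at (snd c x)) (v c)"
proof -
  define d where "d = (SOME c. c \<in> \<A> \<and> x \<in> fst c)"
  have d: "d \<in> \<A>" "x \<in> fst d"
    using someI[of "\<lambda>c. c \<in> \<A> \<and> x \<in> fst c"] c unfolding d_def by blast+
  have inv: "chart_inv c (snd c x) = x" by (rule chart_inv_left[OF c])
  have "((\<lambda>z. F (chart_inv c z)) has_derivative
      (\<lambda>e. frechet_derivative (F \<circ> chart_inv d) (at (snd d x))
        (frechet_derivative (transition c d) (at (snd c x)) e))) (at (snd c x))"
  proof (rule has_derivative_via_chart[OF d(1)])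
    show "((\<lambda>z. snd d (chart_inv c z)) has_derivative
        frechet_derivative (transition c d) (at (snd c x))) (at (snd c x))"
      using transition_has_derivative[OF c(1) d(1) c(2) d(2)] by (simp add: transition_def o_def)
    show "((F \<circ> chart_inv d) has_derivative frechet_derivative (F \<circ> chart_inv d) (at (snd d x)))
       (at (snd d (chart_inv c (snd c x))))"
      unfolding inv by (rule C1_has_derivative[OF F d])
    show "eventually (\<lambda>z. chart_inv c z \<in> fst d) (nhds (snd c x))"
      by (rule eventually_chart_inv_in[OF c open_chart[OF d(1)] d(2)])
  qed (simp add: inv d)
  then have "((F \<circ> chart_inv c) has_derivative
      (\<lambda>e. frechet_derivative (F \<circ> chart_inv d) (at (snd d x))
        (frechet_derivative (transition c d) (at (snd c x)) e))) (at (snd c x))"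
    by (simp add: o_def)
  from frechet_derivative_at[OF this]
  have "frechet_derivative (F \<circ> chart_inv c) (at (snd c x)) (v c) =
      frechet_derivative (F \<circ> chart_inv d) (at (snd d x))
        (frechet_derivative (transition c d) (at (snd c x)) (v c))" by metis
  moreover have "v d = frechet_derivative (transition c d) (at (snd c x)) (v c)"
    using v c d unfolding tangent_space_def by blast
  ultimately show ?thesis unfolding dfun_def d_def[symmetric] by (simp add: Let_def)
qed

lemma C1_continuous:
  assumes F: "Ck_function \<A> 1 F"
  shows "continuous_on UNIV F"
proof -
  have "isCont F x" for x
  proof -
    obtain c where c: "c \<in> \<A>" "x \<in> fst c" by (rule chart_at)
    have "Ck_on 1 (F \<circ> chart_inv c) (snd c ` fst c)"
      using F c(1) by (simp only: Ck_function_def)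
    then have "continuous_on (snd c ` fst c) (F \<circ> chart_inv c)" by (rule Ck_on_imp_continuous_on)
    then have "continuous_on (fst c) (\<lambda>x. (F \<circ> chart_inv c) (snd c x))"
      by (rule continuous_on_compose2[OF _ continuous_chart[OF c(1)]]) simp
    then have "continuous_on (fst c) F"
      by (rule continuous_on_eq) (simp add: chart_inv_left[OF c(1)])
    then show "isCont F x" using open_chart[OF c(1)] c(2) by (simp add: continuous_on_eq_continuous_at)
  qed
  then show ?thesis by (simp add: continuous_at_imp_continuous_on)
qed

lemma
  assumes F: "Ck_function \<A> 1 F" and v: "v \<in> tangent_space \<A> x"
  shows dfun_add: "u \<in> tangent_space \<A> x \<Longrightarrow> dfun \<A> F x (u + v) = dfun \<A> F x u + dfun \<A> F x v"
    and dfun_scale: "dfun \<A> F x (a *\<^sub>R v) = a * dfun \<A> F x v"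
proof -
  obtain c where c: "c \<in> \<A>" "x \<in> fst c" by (rule chart_at)
  have lin: "linear (frechet_derivative (F \<circ> chart_inv c) (at (snd c x)))"
    using C1_has_derivative[OF F c] by (rule has_derivative_linear)
  show "dfun \<A> F x (u + v) = dfun \<A> F x u + dfun \<A> F x v" if "u \<in> tangent_space \<A> x"
    by (simp only: dfun_eq[OF F c] that v tangent_add plus_fun_apply linear_add[OF lin])
  show "dfun \<A> F x (a *\<^sub>R v) = a * dfun \<A> F x v"
    by (simp only: dfun_eq[OF F c] v tangent_scale scaleR_fun_apply linear_scale[OF lin] real_scaleR_def)
qed

lemma
  assumes F: "Ck_function \<A> 1 F"
  shows gradient_in_tangent_space: "gradient \<A> g F x \<in> tangent_space \<A> x"
    and gradient_metric: "v \<in> tangent_space \<A> x \<Longrightarrow> g x (gradient \<A> g F x) v = dfun \<A> F x v"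
proof -
  have "\<exists>!w. w \<in> tangent_space \<A> x \<and> (\<forall>v\<in>tangent_space \<A> x. g x w v = dfun \<A> F x v)"
    by (rule Riesz_representation) (simp_all only: dfun_add[OF F] dfun_scale[OF F])
  from theI'[OF this] show "gradient \<A> g F x \<in> tangent_space \<A> x"
    "v \<in> tangent_space \<A> x \<Longrightarrow> g x (gradient \<A> g F x) v = dfun \<A> F x v"
    unfolding gradient_def by blast+
qed

text \<open>By Parseval's identity in a moving orthonormal frame \<open>E\<close>, the squared norm of the gradient is
  the sum of the squares of the derivatives of \<open>F\<close> in the directions \<open>E i\<close>, and these are
  continuous because \<open>F\<close> is continuously differentiable.\<close>

lemma continuous_gradient_square:
  assumes F: "Ck_function \<A> 1 F"
  shows "continuous_on UNIV (\<lambda>x. (riem_norm g x (gradient \<A> g F x))\<^sup>2)"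
proof -
  let ?p = "\<lambda>x. (riem_norm g x (gradient \<A> g F x))\<^sup>2"
  have "isCont ?p x0" for x0
  proof -
    obtain c where c: "c \<in> \<A>" "x0 \<in> fst c" by (rule chart_at)
    obtain B E where B: "finite B" "span B = UNIV"
      "\<And>i. i \<in> B \<Longrightarrow> continuous_comb B (fst c) (E i)"
      "\<And>x. x \<in> fst c \<Longrightarrow> orthonormal_family (chart_form c x) B (\<lambda>i. E i x)"
      "\<And>x. x \<in> fst c \<Longrightarrow> span ((\<lambda>i. E i x) ` B) = UNIV"
      using orthonormal_frame[OF c(1)] by blast
    define D where "D x = frechet_derivative (F \<circ> chart_inv c) (at (snd c x))" for x
    have D_cont: "continuous_on (fst c) (\<lambda>x. D x e)" for e
    proof -
      have "Ck_on (Suc 0) (F \<circ> chart_inv c) (snd c ` fst c)"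
        using F c(1) by (simp only: Ck_function_def One_nat_def)
      from Ck_on_Suc_continuous_derivative[OF this, of e] show ?thesis unfolding D_def
        by (rule continuous_on_compose2[OF _ continuous_chart[OF c(1)]]) simp
    qed
    have D_lin: "linear (D x)" if "x \<in> fst c" for x
      unfolding D_def using C1_has_derivative[OF F c(1) that] by (rule has_derivative_linear)
    have "continuous_on (fst c) (\<lambda>x. D x (E i x))" if "i \<in> B" for i
      using continuous_comb_linear[where l = D and f = "E i" and S = "fst c", OF B(3)[OF that] D_lin D_cont] .
    then have "continuous_on (fst c) (\<lambda>x. \<Sum>i\<in>B. (D x (E i x))\<^sup>2)"
      by (intro continuous_on_sum continuous_on_power)
    moreover have "(\<Sum>i\<in>B. (D x (E i x))\<^sup>2) = ?p x" if x: "x \<in> fst c" for x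
    proof -
      note T = gradient_in_tangent_space[OF F]
      define w where "w = gradient \<A> g F x c"
      have w: "tangent_of \<A> c x w = gradient \<A> g F x"
        unfolding w_def by (rule tangent_of_eq[OF c(1) x T])
      have wE: "chart_form c x w e = D x e" for e
        using tangent_of_in_tangent_space[OF c(1) x, of e]
        by (simp add: chart_form_def w gradient_metric[OF F] dfun_eq[OF F c(1) x] D_def
            tangent_of_component[OF c(1) x])
      have "?p x = chart_form c x w w"
        by (simp add: riem_norm_square[OF T] chart_form_def w)
      also have "\<dots> = (\<Sum>i\<in>B. (chart_form c x w (E i x))\<^sup>2)"
        by (rule orthonormal_Parseval[OF inner_form_chart_form[OF c(1) x] B(4)[OF x] B(1)])
           (simp add: B(5)[OF x])
      finally show ?thesis by (simp add: wE)
    qed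
    ultimately have "continuous_on (fst c) ?p" by (rule continuous_on_eq)
    then show "isCont ?p x0" using open_chart[OF c(1)] c(2)
      by (simp only: continuous_on_eq_continuous_at)
  qed
  then show ?thesis by (simp add: continuous_at_imp_continuous_on)
qed

end

section \<open>Retractions\<close>

locale riemannian_retraction = riemannian_atlas \<A> g
  for \<A> :: "('m::{t2_space, second_countable_topology}, 'e::real_normed_vector) chart set"
    and g :: "('m, 'e) metric" +
  fixes R :: "'m \<Rightarrow> ('m, 'e) tvec \<Rightarrow> 'm"
  assumes retraction: "manifold_retraction \<A> R"
begin

lemma retraction_zero: "R x 0 = x"
  using retraction unfolding manifold_retraction_def by blast

lemma bundle_rep_eq:
  assumes "c \<in> \<A>" "x \<in> fst c"
  shows "bundle_rep \<A> c R (snd c x, e) = R x (tangent_of \<A> c x e)"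
  by (simp add: bundle_rep_def chart_inv_left[OF assms])

lemma eventually_bundle_rep_in:
  assumes c: "c \<in> \<A>" "x \<in> fst c" and U: "open U" "bundle_rep \<A> c R (snd c x, e) \<in> U"
  shows "eventually (\<lambda>p. p \<in> snd c ` fst c \<times> UNIV \<and> bundle_rep \<A> c R p \<in> U) (nhds (snd c x, e))"
proof -
  have "open (snd c ` fst c \<times> (UNIV :: 'e set))"
    using open_chart_image[OF c(1) open_UNIV] by (auto intro: open_Times)
  moreover have "continuous_on (snd c ` fst c \<times> UNIV) (bundle_rep \<A> c R)"
    using retraction c(1) unfolding manifold_retraction_def Ck_bundle_map_def by blast
  ultimately have "open (bundle_rep \<A> c R -` U \<inter> snd c ` fst c \<times> UNIV)"
    using U(1) continuous_on_open_vimage by blast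
  moreover have "(snd c x, e) \<in> bundle_rep \<A> c R -` U \<inter> snd c ` fst c \<times> UNIV"
    using U(2) c(2) by auto
  ultimately have "eventually (\<lambda>p. p \<in> bundle_rep \<A> c R -` U \<inter> snd c ` fst c \<times> UNIV)
      (nhds (snd c x, e))" by (rule eventually_nhds_in_open)
  then show ?thesis by eventually_elim auto
qed

lemma bundle_rep_C1:
  assumes "c \<in> \<A>" "d \<in> \<A>"
  shows "Ck_on (Suc (Suc 0)) (\<lambda>p. snd d (bundle_rep \<A> c R p))
    {p \<in> snd c ` fst c \<times> UNIV. bundle_rep \<A> c R p \<in> fst d}"
  using retraction assms
  unfolding manifold_retraction_def Ck_bundle_map_def numeral_2_eq_2 o_def by blast

text \<open>
  The chart expression of \<open>dretr\<close>. It is a function of the point \<open>p\<close> of the parametrised tangent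
  bundle, because its continuity in \<open>p\<close> controls how fast the retraction moves points.
\<close>

definition fibre_derivative ::
  "('m, 'e) chart \<Rightarrow> ('m, 'e) chart \<Rightarrow> 'e \<times> 'e \<Rightarrow> 'e \<Rightarrow> 'e" where
  "fibre_derivative c d p h =
     frechet_derivative (\<lambda>p. snd d (bundle_rep \<A> c R p)) (at p) (0, h)"

lemma bundle_rep_line_derivative:
  assumes c: "c \<in> \<A>" "x \<in> fst c" and d: "d \<in> \<A>" "bundle_rep \<A> c R (snd c x, e) \<in> fst d"
  shows "((\<lambda>s. snd d (bundle_rep \<A> c R (snd c x, e + s *\<^sub>R h))) has_derivative
    (\<lambda>s. fibre_derivative c d (snd c x, e) (s *\<^sub>R h))) (at 0)"
proof -
  have "((\<lambda>p. snd d (bundle_rep \<A> c R p)) has_derivative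
      frechet_derivative (\<lambda>p. snd d (bundle_rep \<A> c R p)) (at (snd c x, e))) (at (snd c x, e))"
    by (rule Ck_on_Suc_has_derivative[OF bundle_rep_C1[OF c(1) d(1)]]) (use c d in auto)
  moreover have "((\<lambda>s::real. (snd c x, e + s *\<^sub>R h)) has_derivative (\<lambda>s. (0, s *\<^sub>R h))) (at 0)"
    by (auto intro!: derivative_eq_intros)
  ultimately show ?thesis
    using has_derivative_compose[of "\<lambda>s::real. (snd c x, e + s *\<^sub>R h)" "\<lambda>s. (0, s *\<^sub>R h)" 0 UNIV
        "\<lambda>p. snd d (bundle_rep \<A> c R p)"]
    by (simp add: fibre_derivative_def)
qed

lemma linear_fibre_derivative:
  assumes c: "c \<in> \<A>" "x \<in> fst c" and d: "d \<in> \<A>" "bundle_rep \<A> c R (snd c x, e) \<in> fst d"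
  shows "linear (fibre_derivative c d (snd c x, e))"
proof -
  have "((\<lambda>p. snd d (bundle_rep \<A> c R p)) has_derivative
      frechet_derivative (\<lambda>p. snd d (bundle_rep \<A> c R p)) (at (snd c x, e))) (at (snd c x, e))"
    by (rule Ck_on_Suc_has_derivative[OF bundle_rep_C1[OF c(1) d(1)]]) (use c d in auto)
  note L = has_derivative_linear[OF this]
  show ?thesis
    using linear_add[OF L, of "(0, _)" "(0, _)"] linear_scale[OF L, of _ "(0, _)"]
    by (auto intro!: linearI simp: fibre_derivative_def)
qed

lemma bundle_rep_line:
  assumes c: "c \<in> \<A>" "x \<in> fst c" and u: "u \<in> tangent_space \<A> x" and v: "v \<in> tangent_space \<A> x"
  shows "bundle_rep \<A> c R (snd c x, u c + s *\<^sub>R v c) = R x (u + s *\<^sub>R v)"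
  unfolding bundle_rep_eq[OF c] linear_add[OF linear_tangent_of[OF c]]
    linear_scale[OF linear_tangent_of[OF c]] tangent_of_eq[OF c u] tangent_of_eq[OF c v] ..

lemma bundle_rep_tangent:
  assumes c: "c \<in> \<A>" "x \<in> fst c" and u: "u \<in> tangent_space \<A> x"
  shows "bundle_rep \<A> c R (snd c x, u c) = R x u"
  by (simp only: bundle_rep_eq[OF c] tangent_of_eq[OF c u])

lemma
  assumes c: "c \<in> \<A>" "x \<in> fst c" and u: "u \<in> tangent_space \<A> x" and v: "v \<in> tangent_space \<A> x"
    and d: "d \<in> \<A>" "R x u \<in> fst d"
  shows retraction_line_has_derivative:
      "((\<lambda>s. snd d (R x (u + s *\<^sub>R v))) has_derivative
        (\<lambda>s. fibre_derivative c d (snd c x, u c) (s *\<^sub>R v c))) (at 0)"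
    and eventually_retraction_line_in_chart:
      "eventually (\<lambda>s. R x (u + s *\<^sub>R v) \<in> fst d) (nhds 0)"
proof -
  show "((\<lambda>s. snd d (R x (u + s *\<^sub>R v))) has_derivative
      (\<lambda>s. fibre_derivative c d (snd c x, u c) (s *\<^sub>R v c))) (at 0)"
    unfolding bundle_rep_line[OF c u v, symmetric]
    by (rule bundle_rep_line_derivative[OF c d(1)]) (simp add: bundle_rep_tangent[OF c u] d)
  have "((\<lambda>s. (snd c x, u c + s *\<^sub>R v c)) \<longlongrightarrow> (snd c x, u c + 0 *\<^sub>R v c)) (nhds (0::real))"
    by (intro tendsto_intros filterlim_ident)
  then have "((\<lambda>s. (snd c x, u c + s *\<^sub>R v c)) \<longlongrightarrow> (snd c x, u c)) (nhds (0::real))" by simp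
  moreover have "eventually (\<lambda>p. bundle_rep \<A> c R p \<in> fst d) (nhds (snd c x, u c))"
    using eventually_bundle_rep_in[OF c open_chart[OF d(1)], of "u c"] d(2)
    by (auto simp: bundle_rep_tangent[OF c u] elim: eventually_mono)
  ultimately show "eventually (\<lambda>s. R x (u + s *\<^sub>R v) \<in> fst d) (nhds 0)"
    unfolding bundle_rep_line[OF c u v, symmetric] by (rule eventually_compose_filterlim[rotated])
qed

lemma linear_fibre_derivative_tangent:
  assumes c: "c \<in> \<A>" "x \<in> fst c" and u: "u \<in> tangent_space \<A> x" and d: "d \<in> \<A>" "R x u \<in> fst d"
  shows "linear (fibre_derivative c d (snd c x, u c))"
  by (rule linear_fibre_derivative[OF c d(1)]) (simp add: bundle_rep_tangent[OF c u] d)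

text \<open>The definition of \<open>dretr\<close> lists velocities chart by chart. Changing charts shows that one chart
  \<open>d\<close> around the end point determines all of them, hence that they form a tangent vector depending
  linearly on \<open>v\<close>.\<close>

lemma dretr_eq:
  assumes c: "c \<in> \<A>" "x \<in> fst c" and u: "u \<in> tangent_space \<A> x" and v: "v \<in> tangent_space \<A> x"
    and d: "d \<in> \<A>" "R x u \<in> fst d"
  shows "dretr \<A> R x u v = tangent_of \<A> d (R x u) (fibre_derivative c d (snd c x, u c) (v c))"
proof
  fix d'
  define f where "f s = R x (u + s *\<^sub>R v)" for s
  have f0: "f 0 = R x u" by (simp only: f_def scaleR_zero_left add_0_right)
  show "dretr \<A> R x u v d' =
      tangent_of \<A> d (R x u) (fibre_derivative c d (snd c x, u c) (v c)) d'"
  proof (cases "d' \<in> \<A> \<and> R x u \<in> fst d'")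
    case True
    have "((\<lambda>s. snd d' (f s)) has_derivative
        (\<lambda>s. frechet_derivative (transition d d') (at (snd d (f 0)))
           (fibre_derivative c d (snd c x, u c) (s *\<^sub>R v c)))) (at 0)"
      using True retraction_line_has_derivative[OF c u v d]
        eventually_retraction_line_in_chart[OF c u v d]
      by (intro has_derivative_change_chart d(1)) (simp_all only: f_def[symmetric] f0 d)
    moreover have "linear (frechet_derivative (transition d d') (at (snd d (R x u))))"
      using transition_has_derivative[OF d(1) _ d(2), of d'] True by (intro has_derivative_linear) auto
    moreover note linear_fibre_derivative_tangent[OF c u d]
    ultimately have "((\<lambda>s. snd d' (f s)) has_vector_derivative
        frechet_derivative (transition d d') (at (snd d (R x u)))
           (fibre_derivative c d (snd c x, u c) (v c))) (at 0)"
      by (simp add: has_vector_derivative_def f0 linear_scale)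
    then show ?thesis using True
      by (simp add: dretr_def tangent_of_def vector_derivative_at flip: f_def)
  next
    case False
    then show ?thesis by (auto simp: dretr_def tangent_of_def)
  qed
qed

lemma dretr_in_tangent_space:
  assumes u: "u \<in> tangent_space \<A> x" and v: "v \<in> tangent_space \<A> x"
  shows "dretr \<A> R x u v \<in> tangent_space \<A> (R x u)"
proof -
  obtain c where c: "c \<in> \<A>" "x \<in> fst c" by (rule chart_at)
  obtain d where d: "d \<in> \<A>" "R x u \<in> fst d" by (rule chart_at)
  show ?thesis unfolding dretr_eq[OF c u v d] by (rule tangent_of_in_tangent_space[OF d])
qed

lemma
  assumes u: "u \<in> tangent_space \<A> x" and v: "v \<in> tangent_space \<A> x"
  shows dretr_add: "w \<in> tangent_space \<A> x \<Longrightarrow>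
      dretr \<A> R x u (v + w) = dretr \<A> R x u v + dretr \<A> R x u w"
    and dretr_scale: "dretr \<A> R x u (a *\<^sub>R v) = a *\<^sub>R dretr \<A> R x u v"
proof -
  obtain c where c: "c \<in> \<A>" "x \<in> fst c" by (rule chart_at)
  obtain d where d: "d \<in> \<A>" "R x u \<in> fst d" by (rule chart_at)
  note L = linear_fibre_derivative_tangent[OF c u d] linear_tangent_of[OF d]
  show "dretr \<A> R x u (v + w) = dretr \<A> R x u v + dretr \<A> R x u w" if "w \<in> tangent_space \<A> x"
    by (simp only: dretr_eq[OF c u _ d] v that tangent_add plus_fun_apply linear_add[OF L(1)]
        linear_add[OF L(2)])
  show "dretr \<A> R x u (a *\<^sub>R v) = a *\<^sub>R dretr \<A> R x u v"
    by (simp only: dretr_eq[OF c u _ d] v tangent_scale scaleR_fun_apply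
        linear_scale[OF L(1)] linear_scale[OF L(2)])
qed

lemma has_derivative_along_retraction:
  assumes F: "Ck_function \<A> 1 F" and u: "u \<in> tangent_space \<A> x" and v: "v \<in> tangent_space \<A> x"
  shows "((\<lambda>s. F (R x (u + s *\<^sub>R v))) has_real_derivative
    dfun \<A> F (R x u) (dretr \<A> R x u v)) (at 0)"
proof -
  obtain c where c: "c \<in> \<A>" "x \<in> fst c" by (rule chart_at)
  obtain d where d: "d \<in> \<A>" "R x u \<in> fst d" by (rule chart_at)
  have "((\<lambda>s. F (R x (u + s *\<^sub>R v))) has_derivative
      (\<lambda>s. frechet_derivative (F \<circ> chart_inv d) (at (snd d (R x u)))
         (fibre_derivative c d (snd c x, u c) (s *\<^sub>R v c)))) (at 0)"
    by (rule has_derivative_via_chart[OF d(1) retraction_line_has_derivative[OF c u v d] _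
          eventually_retraction_line_in_chart[OF c u v d]])
       (simp_all only: scaleR_zero_left add_0_right d C1_has_derivative[OF F d])
  moreover have "linear (frechet_derivative (F \<circ> chart_inv d) (at (snd d (R x u))))"
    using C1_has_derivative[OF F d] by (rule has_derivative_linear)
  moreover note linear_fibre_derivative_tangent[OF c u d]
  ultimately have "((\<lambda>s. F (R x (u + s *\<^sub>R v))) has_real_derivative
      frechet_derivative (F \<circ> chart_inv d) (at (snd d (R x u)))
         (fibre_derivative c d (snd c x, u c) (v c))) (at 0)"
    by (simp only: has_field_derivative_def linear_scale real_scaleR_def mult_commute_abs)
  moreover have "dfun \<A> F (R x u) (dretr \<A> R x u v) =
      frechet_derivative (F \<circ> chart_inv d) (at (snd d (R x u)))
        (fibre_derivative c d (snd c x, u c) (v c))"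
    by (simp only: dretr_eq[OF c u v d] dfun_eq[OF F d] tangent_of_in_tangent_space[OF d]
        tangent_of_component[OF d])
  ultimately show ?thesis by (simp only:)
qed

lemma adj_dretr_metric:
  assumes u: "u \<in> tangent_space \<A> x" and w: "w \<in> tangent_space \<A> (R x u)"
  shows adj_dretr_in_tangent_space: "adj_dretr \<A> g R x u w \<in> tangent_space \<A> x"
    and "v \<in> tangent_space \<A> x \<Longrightarrow> g x v (adj_dretr \<A> g R x u w) = g (R x u) (dretr \<A> R x u v) w"
proof -
  have "\<exists>!z. z \<in> tangent_space \<A> x \<and>
      (\<forall>v\<in>tangent_space \<A> x. g x z v = g (R x u) (dretr \<A> R x u v) w)"
    by (rule Riesz_representation)
       (simp_all only: dretr_add[OF u] dretr_scale[OF u] metric_add_left metric_scale_left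
          dretr_in_tangent_space[OF u] w)
  moreover have "(z \<in> tangent_space \<A> x \<and>
      (\<forall>v\<in>tangent_space \<A> x. g x z v = g (R x u) (dretr \<A> R x u v) w)) \<longleftrightarrow>
    (z \<in> tangent_space \<A> x \<and>
      (\<forall>v\<in>tangent_space \<A> x. g x v z = g (R x u) (dretr \<A> R x u v) w))" for z
    using metric_sym by metis
  ultimately have "\<exists>!z. z \<in> tangent_space \<A> x \<and>
      (\<forall>v\<in>tangent_space \<A> x. g x v z = g (R x u) (dretr \<A> R x u v) w)" by simp
  from theI'[OF this] show "adj_dretr \<A> g R x u w \<in> tangent_space \<A> x"
    "v \<in> tangent_space \<A> x \<Longrightarrow> g x v (adj_dretr \<A> g R x u w) = g (R x u) (dretr \<A> R x u v) w"
    unfolding adj_dretr_def by blast+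
qed

text \<open>Along the curve \<open>s \<mapsto> R x (s *\<^sub>R u)\<close> the derivative of \<open>F\<close> is the inner product of \<open>u\<close> with the
  pulled back gradient \<open>a s\<close>, the adjoint of the differential of \<open>R x\<close> at \<open>s *\<^sub>R u\<close> applied to the
  gradient at \<open>R x (s *\<^sub>R u)\<close>. The Lipschitz condition bounds the distance of \<open>a s\<close> from the
  gradient at \<open>x\<close> by a multiple of the norm of \<open>s *\<^sub>R u\<close>, so the mean value theorem gives a
  quadratic error.\<close>

lemma retraction_first_order_bound:
  assumes F: "Ck_function \<A> 1 F" and lip: "R_lipschitz \<A> g R K r (gradient \<A> g F)"
  obtains C where "C > 0"
    "\<And>x u. x \<in> K \<Longrightarrow> u \<in> tangent_space \<A> x \<Longrightarrow> riem_norm g x u \<le> r \<Longrightarrow>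
       \<bar>F (R x u) - F x - g x (gradient \<A> g F x) u\<bar> \<le> C * (riem_norm g x u)\<^sup>2"
proof -
  obtain C where C: "C > 0"
    "\<And>x u. x \<in> K \<Longrightarrow> u \<in> tangent_space \<A> x \<Longrightarrow> riem_norm g x u \<le> r \<Longrightarrow>
      riem_norm g x (adj_dretr \<A> g R x u (gradient \<A> g F (R x u)) - gradient \<A> g F x) \<le> C * riem_norm g x u"
    using lip unfolding R_lipschitz_def by blast
  have "\<bar>F (R x u) - F x - g x (gradient \<A> g F x) u\<bar> \<le> C * (riem_norm g x u)\<^sup>2"
    if x: "x \<in> K" and u: "u \<in> tangent_space \<A> x" and n: "riem_norm g x u \<le> r" for x u
  proof -
    note G = gradient_in_tangent_space[OF F]
    note su = tangent_scale[OF u]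
    define a where "a s = adj_dretr \<A> g R x (s *\<^sub>R u) (gradient \<A> g F (R x (s *\<^sub>R u)))" for s
    have a: "a s \<in> tangent_space \<A> x" for s
      unfolding a_def by (rule adj_dretr_in_tangent_space[OF su G])
    have "((\<lambda>s. F (R x (s *\<^sub>R u))) has_real_derivative g x u (a s)) (at s)" for s
    proof -
      have "((\<lambda>t. F (R x (s *\<^sub>R u + t *\<^sub>R u))) has_real_derivative
          dfun \<A> F (R x (s *\<^sub>R u)) (dretr \<A> R x (s *\<^sub>R u) u)) (at 0)"
        by (rule has_derivative_along_retraction[OF F su u])
      moreover have "dfun \<A> F (R x (s *\<^sub>R u)) (dretr \<A> R x (s *\<^sub>R u) u) = g x u (a s)"
        using adj_dretr_metric(2)[OF su[of s] G u]
          gradient_metric[OF F dretr_in_tangent_space[OF su u]]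
          metric_sym[OF dretr_in_tangent_space[OF su[of s] u] G]
        unfolding a_def by simp
      ultimately have "((\<lambda>t. F (R x ((t + s) *\<^sub>R u))) has_real_derivative g x u (a s)) (at 0)"
        by (simp only: scaleR_add_left add.commute)
      then show ?thesis using DERIV_shift[of "\<lambda>s. F (R x (s *\<^sub>R u))" _ 0 s] by simp
    qed
    then obtain s where s: "0 < s" "s < 1"
      "F (R x (1 *\<^sub>R u)) - F (R x (0 *\<^sub>R u)) = (1 - 0) * g x u (a s)"
      using MVT2[of 0 1 "\<lambda>s. F (R x (s *\<^sub>R u))" "\<lambda>s. g x u (a s)"] by auto
    \<comment> \<open>The mean value theorem supplies one parameter \<open>s\<close> at which \<open>a s\<close> is compared with the gradient at \<open>x\<close>.\<close>
    have su_n: "riem_norm g x (s *\<^sub>R u) = s * riem_norm g x u"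
      using s riem_norm_scale[OF u] by simp
    have n0: "riem_norm g x u \<ge> 0" by (rule riem_norm_nonneg[OF u])
    have "F (R x u) - F x = g x u (a s)"
      using s(3) by (simp only: scaleR_one scaleR_zero_left retraction_zero diff_zero mult_1)
    moreover have "g x (gradient \<A> g F x) u = g x u (gradient \<A> g F x)" by (rule metric_sym[OF G u])
    moreover have "g x u (a s - gradient \<A> g F x) = g x u (a s) - g x u (gradient \<A> g F x)"
    proof -
      have "g x u ((a s - gradient \<A> g F x) + gradient \<A> g F x) =
          g x u (a s - gradient \<A> g F x) + g x u (gradient \<A> g F x)"
        by (rule metric_add_right[OF tangent_diff[OF a G] G u])
      then show ?thesis by (simp only: diff_add_cancel)
    qed
    ultimately have "\<bar>F (R x u) - F x - g x (gradient \<A> g F x) u\<bar> = \<bar>g x u (a s - gradient \<A> g F x)\<bar>"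
      by simp
    also have "\<dots> \<le> riem_norm g x u * riem_norm g x (a s - gradient \<A> g F x)"
      by (rule riemannian_Cauchy_Schwarz[OF u tangent_diff[OF a G]])
    also have "riem_norm g x (a s - gradient \<A> g F x) \<le> C * riem_norm g x (s *\<^sub>R u)"
      unfolding a_def
    proof (rule C(2)[OF x su])
      show "riem_norm g x (s *\<^sub>R u) \<le> r" using su_n s n n0 mult_left_le_one_le[of "riem_norm g x u" s] by simp
    qed
    also have "\<dots> \<le> C * riem_norm g x u"
      using C(1) su_n s n0 mult_left_le_one_le[of "riem_norm g x u" s] by simp
    finally show ?thesis using n0 by (simp add: power2_eq_square mult_left_mono mult.left_commute)
  qed
  with C(1) show ?thesis using that by blast
qed

text \<open>A quantitative form of continuity of the retraction at zero vectors. The function \<open>\<psi>\<close> is a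
  rescaled coordinate distance from \<open>x0\<close>, and leaving \<open>U\<close> requires \<open>\<psi>\<close> to grow from \<open>0\<close> to \<open>1\<close>. One
  short step along \<open>u\<close> increases \<open>\<psi>\<close> by at most a multiple of the Riemannian norm of \<open>u\<close>, since in
  the chart the retraction is continuously differentiable and fixes zero vectors.\<close>

lemma retraction_escape_function:
  assumes U: "open U" "x0 \<in> U"
  obtains \<psi> :: "'m \<Rightarrow> real" and L \<theta> where
    "isCont \<psi> x0" "\<psi> x0 = 0" "\<And>x. \<psi> x < 1 \<Longrightarrow> x \<in> U" "L > 0" "\<theta> > 0"
    "\<And>x u. \<psi> x < 1 \<Longrightarrow> u \<in> tangent_space \<A> x \<Longrightarrow> riem_norm g x u \<le> \<theta> \<Longrightarrow>
       \<psi> (R x u) \<le> \<psi> x + L * riem_norm g x u"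
proof -
  obtain c where c: "c \<in> \<A>" "x0 \<in> fst c" by (rule chart_at)
  obtain B E where B: "finite B" "span B = UNIV"
    "\<And>i. i \<in> B \<Longrightarrow> continuous_comb B (fst c) (E i)"
    "\<And>x. x \<in> fst c \<Longrightarrow> orthonormal_family (chart_form c x) B (\<lambda>i. E i x)"
    "\<And>x. x \<in> fst c \<Longrightarrow> span ((\<lambda>i. E i x) ` B) = UNIV"
    using orthonormal_frame[OF c(1)] by blast
  define W where "W = {p \<in> snd c ` fst c \<times> UNIV. bundle_rep \<A> c R p \<in> fst c}"
  define z0 where "z0 = snd c x0"
  define x_of where "x_of p = chart_inv c (fst p)" for p :: "'e \<times> 'e"
  define D where "D p h = fibre_derivative c c p h" for p h
  have W_cases: "\<exists>x e. x \<in> fst c \<and> p = (snd c x, e) \<and> bundle_rep \<A> c R (snd c x, e) \<in> fst c"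
    if "p \<in> W" for p using that unfolding W_def by (cases p) auto
  have "open (snd c ` fst c \<times> (UNIV :: 'e set))"
    using open_chart_image[OF c(1) open_UNIV] by (auto intro: open_Times)
  moreover have "continuous_on (snd c ` fst c \<times> UNIV) (bundle_rep \<A> c R)"
    using retraction c(1) unfolding manifold_retraction_def Ck_bundle_map_def by blast
  ultimately have "open (bundle_rep \<A> c R -` fst c \<inter> snd c ` fst c \<times> UNIV)"
    using open_chart[OF c(1)] continuous_on_open_vimage by blast
  moreover have "bundle_rep \<A> c R -` fst c \<inter> snd c ` fst c \<times> UNIV = W" by (auto simp: W_def)
  ultimately have W_open: "open W" by simp
  have zero: "bundle_rep \<A> c R (snd c x, 0) = x" if "x \<in> fst c" for x
    using that linear_0[OF linear_tangent_of[OF c(1) that]]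
    by (simp only: bundle_rep_eq[OF c(1) that] retraction_zero)
  have p0: "(z0, 0) \<in> W" using zero[OF c(2)] c(2) by (simp add: W_def z0_def)
  have x_of_cont: "continuous_on W x_of"
    unfolding x_of_def
    by (rule continuous_on_compose2[OF homeomorphism_cont2[OF chart_homeomorphism[OF c(1)]]])
       (auto simp: W_def intro: continuous_intros)
  have x_of_W: "x_of ` W \<subseteq> fst c"
    using W_cases chart_inv_left[OF c(1)] by (fastforce simp: x_of_def)
  have E_comb: "continuous_comb B W (\<lambda>p. E i (x_of p))" if "i \<in> B" for i
    by (rule continuous_comb_compose[OF B(3)[OF that] x_of_cont x_of_W])
  have D_lin: "linear (D p)" if "p \<in> W" for p
    using W_cases[OF that] linear_fibre_derivative[OF c(1) _ c(1)] unfolding D_def by blast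
  have D_cont: "continuous_on W (\<lambda>p. D p h)" for h
    unfolding D_def fibre_derivative_def W_def
    by (rule Ck_on_Suc_continuous_derivative[OF bundle_rep_C1[OF c(1) c(1)]])
  have DE_cont: "continuous_on W (\<lambda>p. D p (E i (x_of p)))" if "i \<in> B" for i
    by (rule continuous_comb_linear[where l = D, OF E_comb[OF that] D_lin D_cont])
  \<comment> \<open>\<open>M\<close> bounds the frame vectors and their images under the fibre derivative; a vector of Riemannian
    norm \<open>n\<close> has coefficients at most \<open>n\<close> in the frame, so \<open>n * M\<close> bounds both its length in the
    chart and the speed of its image.\<close>
  define M where "M p = (\<Sum>i\<in>B. norm (D p (E i (x_of p)))) + (\<Sum>i\<in>B. norm (E i (x_of p)))" for p
  have M_cont: "continuous_on W M"
    unfolding M_def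
    by (intro continuous_intros DE_cont continuous_comb_continuous[OF E_comb])
  define M0 where "M0 = M (z0, 0) + 1"
  have M_pos: "0 \<le> M p" for p unfolding M_def by (intro add_nonneg_nonneg sum_nonneg) auto
  have M0: "M0 > 0" using M_pos[of "(z0, 0)"] unfolding M0_def by linarith
  have "open (M -` {..<M0} \<inter> W)"
    using M_cont unfolding continuous_on_open_vimage[OF W_open] by simp
  moreover have "(z0, 0) \<in> M -` {..<M0} \<inter> W" using p0 by (simp add: M0_def)
  ultimately obtain V1 V2 where V: "open V1" "z0 \<in> V1" "open V2" "0 \<in> V2"
    "V1 \<times> V2 \<subseteq> M -` {..<M0} \<inter> W"
    by (auto elim!: open_prod_elim)
  obtain \<delta> where \<delta>: "\<delta> > 0" "ball 0 \<delta> \<subseteq> V2" using V(3,4) open_contains_ball by blast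
  have "open (V1 \<inter> snd c ` (fst c \<inter> U))" using V(1) open_chart_image[OF c(1) U(1)] by blast
  moreover have "z0 \<in> V1 \<inter> snd c ` (fst c \<inter> U)" using V(2) c(2) U(2) by (auto simp: z0_def)
  ultimately obtain \<rho> where \<rho>: "\<rho> > 0" "ball z0 \<rho> \<subseteq> V1 \<inter> snd c ` (fst c \<inter> U)"
    using open_contains_ball by blast
  \<comment> \<open>The value \<open>1\<close> outside the chart keeps such points out of the set where \<open>\<psi>\<close> is less than \<open>1\<close>.\<close>
  define \<psi> where "\<psi> x = (if x \<in> fst c then norm (snd c x - z0) / \<rho> else 1)" for x
  have \<psi>_less: "x \<in> fst c" "snd c x \<in> ball z0 \<rho>" if "\<psi> x < 1" for x
    using that \<rho>(1) by (auto simp: \<psi>_def dist_norm norm_minus_commute split: if_splits)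
  show ?thesis
  proof (rule that[of \<psi> "M0 / \<rho>" "\<delta> / (2 * M0)"])
    have "continuous_on (fst c) (\<lambda>x. norm (snd c x - z0) / \<rho>)"
      using \<rho>(1) by (intro continuous_intros continuous_chart[OF c(1)]) auto
    then have "continuous_on (fst c) \<psi>" by (rule continuous_on_eq) (simp add: \<psi>_def)
    then show "isCont \<psi> x0"
      using open_chart[OF c(1)] c(2) by (simp add: continuous_on_eq_continuous_at)
  next
    show "\<psi> x0 = 0" using c(2) by (simp add: \<psi>_def z0_def)
  next
    fix x assume "\<psi> x < 1"
    note x = \<psi>_less[OF this]
    then obtain y where "y \<in> fst c" "y \<in> U" "snd c x = snd c y" using \<rho>(2) by blast
    then show "x \<in> U" using chart_inv_left[OF c(1)] x(1) by metis
  next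
    show "M0 / \<rho> > 0" "\<delta> / (2 * M0) > 0" using M0 \<rho>(1) \<delta>(1) by simp_all
  next
    fix x u assume "\<psi> x < 1" and u: "u \<in> tangent_space \<A> x"
      and small: "riem_norm g x u \<le> \<delta> / (2 * M0)"
    note x = \<psi>_less[OF this(1)]
    define n where "n = riem_norm g x u"
    have n0: "n \<ge> 0" unfolding n_def by (rule riem_norm_nonneg[OF u])
    define e where "e = u c"
    define a where "a i = chart_form c x e (E i x)" for i
    have u_eq: "tangent_of \<A> c x e = u" unfolding e_def by (rule tangent_of_eq[OF c(1) x(1) u])
    note Q = inner_form_chart_form[OF c(1) x(1)]
    have e_sum: "e = (\<Sum>i\<in>B. a i *\<^sub>R E i x)"
      unfolding a_def by (rule orthonormal_expansion[OF Q B(4)[OF x(1)] B(1)]) (simp add: B(5)[OF x(1)])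
    have "n\<^sup>2 = (\<Sum>i\<in>B. (a i)\<^sup>2)"
    proof -
      have "n\<^sup>2 = chart_form c x e e"
        unfolding n_def riem_norm_square[OF u] chart_form_def u_eq ..
      also have "\<dots> = (\<Sum>i\<in>B. (a i)\<^sup>2)"
        unfolding a_def by (rule orthonormal_Parseval[OF Q B(4)[OF x(1)] B(1)]) (simp add: B(5)[OF x(1)])
      finally show ?thesis .
    qed
    then have "(a i)\<^sup>2 \<le> n\<^sup>2" if "i \<in> B" for i
      using member_le_sum[of i B "\<lambda>i. (a i)\<^sup>2"] that B(1) by simp
    then have a_le: "\<bar>a i\<bar> \<le> n" if "i \<in> B" for i using that n0 abs_le_square_iff[of "a i" n] by simp
    have comb_le: "norm (\<Sum>i\<in>B. a i *\<^sub>R h i) \<le> n * (\<Sum>i\<in>B. norm (h i))" for h :: "'e \<Rightarrow> 'e"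
    proof -
      have "norm (\<Sum>i\<in>B. a i *\<^sub>R h i) \<le> (\<Sum>i\<in>B. norm (a i *\<^sub>R h i))" by (rule norm_sum)
      also have "\<dots> \<le> (\<Sum>i\<in>B. n * norm (h i))"
        using a_le by (intro sum_mono) (simp add: mult_right_mono)
      finally show ?thesis by (simp add: sum_distrib_left)
    qed
    have x_of: "x_of (snd c x, h) = x" for h by (simp add: x_of_def chart_inv_left[OF c(1) x(1)])
    have V1: "snd c x \<in> V1" using x(2) \<rho>(2) by blast
    have M_less: "M (snd c x, h) < M0" "(snd c x, h) \<in> W" if "norm h < \<delta>" for h
    proof -
      have "h \<in> V2" using that \<delta>(2) by auto
      then show "M (snd c x, h) < M0" "(snd c x, h) \<in> W" using V(5) V1 by auto
    qed
    \<comment> \<open>The segment from \<open>0\<close> to \<open>e\<close> stays where the bound on \<open>M\<close> holds.\<close>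
    have "norm e \<le> n * (\<Sum>i\<in>B. norm (E i x))" unfolding e_sum by (rule comb_le)
    also have "\<dots> \<le> n * M0"
    proof (rule mult_left_mono[OF _ n0])
      have "(\<Sum>i\<in>B. norm (E i x)) \<le> M (snd c x, 0)"
        unfolding M_def by (simp add: x_of sum_nonneg)
      then show "(\<Sum>i\<in>B. norm (E i x)) \<le> M0" using M_less(1)[of 0] \<delta>(1) by simp
    qed
    also have "\<dots> \<le> \<delta> / 2" using small M0 by (simp add: n_def field_simps)
    finally have e_small: "norm e < \<delta>" using \<delta>(1) by simp
    have se: "norm (s *\<^sub>R e) < \<delta>" if "0 \<le> s" "s \<le> 1" for s
      using that e_small mult_left_le_one_le[of "norm e" s] by simp
    define f where "f s = snd c (bundle_rep \<A> c R (snd c x, s *\<^sub>R e))" for s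
    have f_deriv: "(f has_derivative (\<lambda>t. D (snd c x, s *\<^sub>R e) (t *\<^sub>R e))) (at s within {0..1})"
      if s: "s \<in> {0..1}" for s
    proof -
      have "bundle_rep \<A> c R (snd c x, s *\<^sub>R e) \<in> fst c"
        using M_less(2)[OF se] s by (auto simp: W_def)
      then have "((\<lambda>t. snd c (bundle_rep \<A> c R (snd c x, s *\<^sub>R e + t *\<^sub>R e))) has_derivative
          (\<lambda>t. D (snd c x, s *\<^sub>R e) (t *\<^sub>R e))) (at (s - s))"
        unfolding D_def diff_self by (rule bundle_rep_line_derivative[OF c(1) x(1) c(1)])
      moreover have "((\<lambda>t. t - s) has_derivative (\<lambda>t. t)) (at s within {0..1})"
        by (auto intro!: derivative_eq_intros)
      ultimately have "((\<lambda>t. snd c (bundle_rep \<A> c R (snd c x, s *\<^sub>R e + (t - s) *\<^sub>R e))) has_derivative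
          (\<lambda>t. D (snd c x, s *\<^sub>R e) (t *\<^sub>R e))) (at s within {0..1})"
        using has_derivative_compose[of "\<lambda>t. t - s" "\<lambda>t. t" s "{0..1}"] by blast
      then show ?thesis by (simp add: f_def[abs_def] scaleR_diff_left)
    qed
    have "norm (f 1 - f 0) \<le> (n * M0) * norm (1 - 0 :: real)"
    proof (rule differentiable_bound[OF _ f_deriv])
      fix s :: real assume s: "s \<in> {0..1}"
      let ?p = "(snd c x, s *\<^sub>R e)"
      have W: "?p \<in> W" and Mp: "M ?p < M0" using M_less[OF se] s by auto
      note L = D_lin[OF W]
      have "D ?p e = (\<Sum>i\<in>B. a i *\<^sub>R D ?p (E i x))"
        by (subst e_sum) (simp add: linear_sum[OF L] linear_scale[OF L])
      then have "norm (D ?p e) \<le> n * (\<Sum>i\<in>B. norm (D ?p (E i x)))" using comb_le by simp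
      also have "\<dots> \<le> n * M0"
      proof (rule mult_left_mono[OF _ n0])
        have "(\<Sum>i\<in>B. norm (D ?p (E i x))) \<le> M ?p" unfolding M_def by (simp add: x_of sum_nonneg)
        then show "(\<Sum>i\<in>B. norm (D ?p (E i x))) \<le> M0" using Mp by simp
      qed
      finally show "onorm (\<lambda>t. D ?p (t *\<^sub>R e)) \<le> n * M0"
        by (intro onorm_le) (simp add: linear_scale[OF L] mult_left_mono mult.commute)
    qed auto
    moreover have "f 0 = snd c x" by (simp add: f_def zero[OF x(1)])
    moreover have "f 1 = snd c (R x u)"
      by (simp add: f_def bundle_rep_eq[OF c(1) x(1)] u_eq)
    ultimately have step: "norm (snd c (R x u) - snd c x) \<le> n * M0" by simp
    have "R x u \<in> fst c"
      using M_less(2)[OF e_small] by (simp add: W_def bundle_rep_eq[OF c(1) x(1)] u_eq)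
    then have "\<psi> (R x u) = norm ((snd c (R x u) - snd c x) + (snd c x - z0)) / \<rho>"
      by (simp add: \<psi>_def)
    also have "\<dots> \<le> (n * M0 + norm (snd c x - z0)) / \<rho>"
      using step \<rho>(1) by (intro divide_right_mono order_trans[OF norm_triangle_ineq] add_mono) auto
    also have "\<dots> = \<psi> x + M0 / \<rho> * riem_norm g x u"
      using x(1) by (simp add: \<psi>_def n_def add_divide_distrib)
    finally show "\<psi> (R x u) \<le> \<psi> x + M0 / \<rho> * riem_norm g x u" .
  qed
qed

end

section \<open>Martingale differences over finitely valued independent draws\<close>

locale independent_draws = prob_space M
  for M :: "'w measure" +
  fixes S :: "nat \<Rightarrow> 'a set" and Y :: "nat \<Rightarrow> 'w \<Rightarrow> 'a"
  assumes finite_S: "finite (S t)"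
    and indep: "indep_vars (\<lambda>t. count_space (S t)) Y UNIV"
begin

text \<open>Measurability with respect to the first \<open>t\<close> draws. As the draws take finitely many values, it is
  a purely combinatorial property: such a \<open>Z\<close> is constant on each of the finitely many events that
  fix these draws. It entails integrability, and it makes sense for values in any type, such as
  points of a manifold.\<close>

definition determined :: "nat \<Rightarrow> ('w \<Rightarrow> 'z) \<Rightarrow> bool" where
  "determined t Z \<longleftrightarrow>
     (\<forall>\<omega>\<in>space M. \<forall>\<omega>'\<in>space M. (\<forall>k<t. Y k \<omega> = Y k \<omega>') \<longrightarrow> Z \<omega> = Z \<omega>')"

lemma determined_const: "determined t (\<lambda>_. z)"
  by (simp add: determined_def)

lemma determined_comp: "determined t Z \<Longrightarrow> determined t (\<lambda>\<omega>. f (Z \<omega>))"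
  unfolding determined_def by (intro ballI impI arg_cong[of _ _ f]) blast

lemma determined_comp2:
  "determined t Z \<Longrightarrow> determined t Z' \<Longrightarrow> determined t (\<lambda>\<omega>. f (Z \<omega>) (Z' \<omega>))"
  unfolding determined_def by (intro ballI impI arg_cong2[of _ _ _ _ f]) blast+

lemma determined_mono: "determined s Z \<Longrightarrow> s \<le> t \<Longrightarrow> determined t Z"
  unfolding determined_def by (meson order_less_le_trans)

lemma determined_draw: "k < t \<Longrightarrow> determined t (Y k)"
  by (simp add: determined_def)

lemma determined_sum:
  assumes "\<And>k. k \<in> I \<Longrightarrow> determined t (f k)"
  shows "determined t (\<lambda>\<omega>. \<Sum>k\<in>I. f k \<omega>)"
  using assms unfolding determined_def by (intro ballI impI sum.cong) blast+

lemma determined_cong: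
  assumes "\<And>\<omega>. \<omega> \<in> space M \<Longrightarrow> Z \<omega> = Z' \<omega>"
  shows "determined t Z \<longleftrightarrow> determined t Z'"
  using assms by (simp add: determined_def)

lemma draw_measurable: "Y t \<in> measurable M (count_space (S t))"
  using indep unfolding indep_vars_def by blast

lemma draw_in: "\<omega> \<in> space M \<Longrightarrow> Y t \<omega> \<in> S t"
  using measurable_space[OF draw_measurable] by simp

lemma draw_event: "{\<omega> \<in> space M. Y t \<omega> = y} \<in> events"
proof -
  have "{\<omega> \<in> space M. Y t \<omega> = y} = Y t -` ({y} \<inter> S t) \<inter> space M" using draw_in by auto
  then show ?thesis using measurable_sets[OF draw_measurable, of "{y} \<inter> S t"] by simp
qed

definition atom :: "nat \<Rightarrow> (nat \<Rightarrow> 'a) \<Rightarrow> 'w set" where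
  "atom t h = {\<omega> \<in> space M. \<forall>k<t. Y k \<omega> = h k}"

lemma atom_Suc: "atom (Suc t) (h(t := y)) = atom t h \<inter> {\<omega> \<in> space M. Y t \<omega> = y}"
  by (auto simp: atom_def less_Suc_eq)

lemma atom_event: "atom t h \<in> events"
proof (induction t)
  case (Suc t)
  have "atom (Suc t) h = atom t h \<inter> {\<omega> \<in> space M. Y t \<omega> = h t}"
    using atom_Suc[of t h "h t"] by simp
  then show ?case using Suc draw_event by auto
qed (simp add: atom_def)

lemma prob_atom:
  assumes "\<And>k. k < t \<Longrightarrow> h k \<in> S k"
  shows "prob (atom t h) = (\<Prod>k<t. prob {\<omega> \<in> space M. Y k \<omega> = h k})"
proof (cases "t = 0")
  case True
  then show ?thesis by (simp add: atom_def prob_space)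
next
  case False
  have "prob (\<Inter>k\<in>{..<t}. Y k -` {h k} \<inter> space M) = (\<Prod>k\<in>{..<t}. prob (Y k -` {h k} \<inter> space M))"
    by (rule indep_varsD[OF indep]) (use False assms in auto)
  moreover have "(\<Inter>k\<in>{..<t}. Y k -` {h k} \<inter> space M) = atom t h"
    using False by (auto simp: atom_def)
  moreover have "Y k -` {h k} \<inter> space M = {\<omega> \<in> space M. Y k \<omega> = h k}" for k by auto
  ultimately show ?thesis by simp
qed

lemma prob_atom_draw:
  assumes "h \<in> PiE {..<t} S" "y \<in> S t"
  shows "prob (atom t h \<inter> {\<omega> \<in> space M. Y t \<omega> = y}) =
    prob (atom t h) * prob {\<omega> \<in> space M. Y t \<omega> = y}"
proof -
  have "prob (atom (Suc t) (h(t := y))) = (\<Prod>k<Suc t. prob {\<omega> \<in> space M. Y k \<omega> = (h(t := y)) k})"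
    by (rule prob_atom) (use assms in \<open>auto simp: less_Suc_eq PiE_def Pi_def\<close>)
  also have "\<dots> = (\<Prod>k<t. prob {\<omega> \<in> space M. Y k \<omega> = h k}) * prob {\<omega> \<in> space M. Y t \<omega> = y}"
    by (subst prod.lessThan_Suc, intro arg_cong2[of _ _ _ _ "(*)"] prod.cong) auto
  also have "(\<Prod>k<t. prob {\<omega> \<in> space M. Y k \<omega> = h k}) = prob (atom t h)"
    by (rule prob_atom[symmetric]) (use assms in \<open>auto simp: PiE_def Pi_def\<close>)
  finally show ?thesis by (simp only: atom_Suc)
qed

lemma determined_atom_sum:
  fixes W :: "'w \<Rightarrow> real"
  assumes W: "determined t W" and \<omega>: "\<omega> \<in> space M"
  shows "W \<omega> = (\<Sum>h\<in>PiE {..<t} S. W (SOME \<omega>'. \<omega>' \<in> atom t h) * indicator (atom t h) \<omega>)"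
proof -
  define h0 where "h0 = restrict (\<lambda>k. Y k \<omega>) {..<t}"
  have h0: "h0 \<in> PiE {..<t} S" using draw_in[OF \<omega>] by (auto simp: h0_def)
  have fin: "finite (PiE {..<t} S)" by (intro finite_PiE finite_S) auto
  have mem: "\<omega> \<in> atom t h \<longleftrightarrow> h = h0" if "h \<in> PiE {..<t} S" for h
  proof
    assume "\<omega> \<in> atom t h"
    then have "h k = h0 k" if "k \<in> {..<t}" for k using that by (auto simp: atom_def h0_def)
    then show "h = h0" using PiE_ext[OF \<open>h \<in> PiE {..<t} S\<close> h0] by blast
  qed (use \<omega> in \<open>auto simp: atom_def h0_def\<close>)
  define \<omega>0 where "\<omega>0 = (SOME \<omega>'. \<omega>' \<in> atom t h0)"
  have "\<omega>0 \<in> atom t h0" unfolding \<omega>0_def 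
    by (rule someI[of "\<lambda>\<omega>'. \<omega>' \<in> atom t h0" \<omega>]) (simp add: mem[OF h0])
  then have "\<omega>0 \<in> space M" "\<forall>k<t. Y k \<omega>0 = Y k \<omega>"
    by (simp_all add: atom_def h0_def)
  then have "W \<omega>0 = W \<omega>" using W \<omega> unfolding determined_def by blast
  moreover have "(\<Sum>h\<in>PiE {..<t} S. W (SOME \<omega>'. \<omega>' \<in> atom t h) * indicator (atom t h) \<omega>) =
      (\<Sum>h\<in>PiE {..<t} S. if h = h0 then W \<omega>0 else 0)"
    by (rule sum.cong) (simp_all add: mem indicator_def \<omega>0_def)
  ultimately show ?thesis using h0 fin by simp
qed

lemma determined_integrable:
  fixes W :: "'w \<Rightarrow> real"
  assumes W: "determined t W"
  shows "integrable M W"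
proof -
  have "integrable M (\<lambda>\<omega>. \<Sum>h\<in>PiE {..<t} S. W (SOME \<omega>'. \<omega>' \<in> atom t h) * indicator (atom t h) \<omega>)"
    using atom_event by (intro Bochner_Integration.integrable_sum integrable_mult_right
        integrable_real_indicator) (auto simp: emeasure_eq_measure)
  then show ?thesis
    by (subst Bochner_Integration.integrable_cong[OF refl determined_atom_sum[OF W]])
qed

lemma expectation_indicator_draw:
  fixes W :: "'w \<Rightarrow> real"
  assumes W: "determined t W" and y: "y \<in> S t"
  shows "expectation (\<lambda>\<omega>. W \<omega> * indicator {\<omega> \<in> space M. Y t \<omega> = y} \<omega>) =
    prob {\<omega> \<in> space M. Y t \<omega> = y} * expectation W"
proof -
  let ?D = "{\<omega> \<in> space M. Y t \<omega> = y}"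
  let ?w = "\<lambda>h. W (SOME \<omega>'. \<omega>' \<in> atom t h)"
  have int: "integrable M (\<lambda>\<omega>. c * indicator A \<omega> :: real)" if "A \<in> events" for A c
    using that by (intro integrable_mult_right integrable_real_indicator) (auto simp: emeasure_eq_measure)
  have E_sum: "expectation (\<lambda>\<omega>. \<Sum>h\<in>I. c h * indicator (A h) \<omega>) = (\<Sum>h\<in>I. c h * prob (A h))"
    if "\<And>h. A h \<in> events" for A :: "(nat \<Rightarrow> 'a) \<Rightarrow> 'w set" and c I
  proof -
    have "expectation (\<lambda>\<omega>. \<Sum>h\<in>I. c h * indicator (A h) \<omega>) =
        (\<Sum>h\<in>I. expectation (\<lambda>\<omega>. c h * indicator (A h) \<omega>))"
      by (rule Bochner_Integration.integral_sum) (rule int[OF that])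
    then show ?thesis using that by simp
  qed
  have "expectation (\<lambda>\<omega>. W \<omega> * indicator ?D \<omega>) =
      expectation (\<lambda>\<omega>. \<Sum>h\<in>PiE {..<t} S. ?w h * indicator (atom t h \<inter> ?D) \<omega>)"
    by (rule Bochner_Integration.integral_cong[OF refl], subst determined_atom_sum[OF W])
       (auto simp: sum_distrib_right indicator_def intro!: sum.cong)
  also have "\<dots> = (\<Sum>h\<in>PiE {..<t} S. ?w h * prob (atom t h \<inter> ?D))"
    by (rule E_sum) (use atom_event draw_event in blast)
  also have "\<dots> = (\<Sum>h\<in>PiE {..<t} S. ?w h * prob (atom t h)) * prob ?D"
    using prob_atom_draw[OF _ y] by (simp add: sum_distrib_right mult.assoc)
  also have "(\<Sum>h\<in>PiE {..<t} S. ?w h * prob (atom t h)) =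
      expectation (\<lambda>\<omega>. \<Sum>h\<in>PiE {..<t} S. ?w h * indicator (atom t h) \<omega>)"
    by (rule E_sum[symmetric]) (rule atom_event)
  also have "\<dots> = expectation W"
    by (rule Bochner_Integration.integral_cong[OF refl determined_atom_sum[OF W, symmetric]])
  finally show ?thesis by (simp add: mult.commute)
qed

text \<open>Conditionally on the first \<open>t\<close> draws, \<open>Z\<close> is constant and the next draw has its original
  distribution; taking the expectation of the conditional expectation gives the formula.\<close>

lemma expectation_next_draw:
  fixes \<phi> :: "'z \<Rightarrow> 'a \<Rightarrow> real"
  assumes Z: "determined t Z"
  shows "expectation (\<lambda>\<omega>. \<phi> (Z \<omega>) (Y t \<omega>)) =
    expectation (\<lambda>\<omega>. \<Sum>y\<in>S t. prob {\<omega> \<in> space M. Y t \<omega> = y} * \<phi> (Z \<omega>) y)"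
proof -
  have W: "determined t (\<lambda>\<omega>. \<phi> (Z \<omega>) y)" for y by (rule determined_comp[OF Z])
  have "expectation (\<lambda>\<omega>. \<phi> (Z \<omega>) (Y t \<omega>)) =
      expectation (\<lambda>\<omega>. \<Sum>y\<in>S t. \<phi> (Z \<omega>) y * indicator {\<omega> \<in> space M. Y t \<omega> = y} \<omega>)"
  proof (rule Bochner_Integration.integral_cong[OF refl])
    fix \<omega> assume \<omega>: "\<omega> \<in> space M"
    have "(\<Sum>y\<in>S t. \<phi> (Z \<omega>) y * indicator {\<omega> \<in> space M. Y t \<omega> = y} \<omega>) =
        (\<Sum>y\<in>S t. if Y t \<omega> = y then \<phi> (Z \<omega>) y else 0)"
      using \<omega> by (intro sum.cong) auto
    then show "\<phi> (Z \<omega>) (Y t \<omega>) =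
        (\<Sum>y\<in>S t. \<phi> (Z \<omega>) y * indicator {\<omega> \<in> space M. Y t \<omega> = y} \<omega>)"
      using draw_in[OF \<omega>] finite_S by simp
  qed
  also have "\<dots> = (\<Sum>y\<in>S t. prob {\<omega> \<in> space M. Y t \<omega> = y} * expectation (\<lambda>\<omega>. \<phi> (Z \<omega>) y))"
  proof (subst Bochner_Integration.integral_sum)
    show "integrable M (\<lambda>\<omega>. \<phi> (Z \<omega>) y * indicator {\<omega> \<in> space M. Y t \<omega> = y} \<omega>)" for y
      by (rule integrable_real_mult_indicator[OF draw_event determined_integrable[OF W]])
  qed (simp add: expectation_indicator_draw[OF W])
  also have "\<dots> = expectation (\<lambda>\<omega>. \<Sum>y\<in>S t. prob {\<omega> \<in> space M. Y t \<omega> = y} * \<phi> (Z \<omega>) y)"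
    by (subst Bochner_Integration.integral_sum) (simp_all add: determined_integrable[OF W])
  finally show ?thesis .
qed

text \<open>Testing against every \<open>Z\<close> determined by the first \<open>t\<close> draws says that the conditional
  expectation of \<open>\<xi> t\<close> given these draws vanishes.\<close>

definition martingale_difference :: "(nat \<Rightarrow> 'w \<Rightarrow> real) \<Rightarrow> bool" where
  "martingale_difference \<xi> \<longleftrightarrow> (\<forall>t. determined (Suc t) (\<xi> t) \<and>
     (\<forall>Z. determined t Z \<longrightarrow> expectation (\<lambda>\<omega>. Z \<omega> * \<xi> t \<omega>) = 0))"

lemma martingale_partial_sum_determined:
  assumes "martingale_difference \<xi>"
  shows "determined n (\<lambda>\<omega>. \<Sum>k=m..<n. \<xi> k \<omega>)"
  using assms by (intro determined_sum) (auto simp: martingale_difference_def intro: determined_mono)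

lemma martingale_second_moment:
  assumes \<xi>: "martingale_difference \<xi>"
  shows "expectation (\<lambda>\<omega>. (\<Sum>k=m..<n. \<xi> k \<omega>)\<^sup>2) = (\<Sum>k=m..<n. expectation (\<lambda>\<omega>. (\<xi> k \<omega>)\<^sup>2))"
proof (induction n)
  case (Suc n)
  show ?case
  proof (cases "m \<le> n")
    case True
    let ?S = "\<lambda>\<omega>. \<Sum>k=m..<n. \<xi> k \<omega>"
    note S = martingale_partial_sum_determined[OF \<xi>, of n m]
    have \<xi>n: "determined (Suc n) (\<xi> n)" using \<xi> by (simp add: martingale_difference_def)
    have S': "determined (Suc n) ?S" by (rule determined_mono[OF S]) simp
    note int = determined_integrable
    have "expectation (\<lambda>\<omega>. (\<Sum>k=m..<Suc n. \<xi> k \<omega>)\<^sup>2) =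
        expectation (\<lambda>\<omega>. (?S \<omega>)\<^sup>2 + 2 * (?S \<omega> * \<xi> n \<omega>) + (\<xi> n \<omega>)\<^sup>2)"
      using True by (simp add: power2_sum algebra_simps)
    also have "\<dots> = expectation (\<lambda>\<omega>. (?S \<omega>)\<^sup>2) + 2 * expectation (\<lambda>\<omega>. ?S \<omega> * \<xi> n \<omega>)
        + expectation (\<lambda>\<omega>. (\<xi> n \<omega>)\<^sup>2)"
      using int[OF determined_comp[OF S, of "\<lambda>x. x\<^sup>2"]] int[OF determined_comp[OF \<xi>n, of "\<lambda>x. x\<^sup>2"]]
        int[OF determined_comp2[OF S' \<xi>n, of "(*)"]]
      by simp
    also have "expectation (\<lambda>\<omega>. ?S \<omega> * \<xi> n \<omega>) = 0"
      using \<xi> S unfolding martingale_difference_def by blast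
    finally show ?thesis using Suc True by simp
  qed simp
qed simp

lemma martingale_difference_stopped:
  assumes \<xi>: "martingale_difference \<xi>" and P: "\<And>t. determined t (P t)"
  shows "martingale_difference (\<lambda>t \<omega>. if P t \<omega> then \<xi> t \<omega> else 0)"
  unfolding martingale_difference_def
proof (intro allI conjI impI)
  fix t
  have "determined (Suc t) (\<xi> t)" "determined (Suc t) (P t)"
    using \<xi> determined_mono[OF P, of t "Suc t"] by (auto simp: martingale_difference_def)
  from determined_comp2[OF this, of "\<lambda>x b. if b then x else 0"]
  show "determined (Suc t) (\<lambda>\<omega>. if P t \<omega> then \<xi> t \<omega> else 0)" .
next
  fix t and Z :: "'w \<Rightarrow> real" assume "determined t Z"
  from determined_comp2[OF this P, of "\<lambda>x b. if b then x else 0"]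
  have "expectation (\<lambda>\<omega>. (if P t \<omega> then Z \<omega> else 0) * \<xi> t \<omega>) = 0"
    using \<xi> unfolding martingale_difference_def by blast
  then show "expectation (\<lambda>\<omega>. Z \<omega> * (if P t \<omega> then \<xi> t \<omega> else 0)) = 0"
    by (simp add: if_distrib if_distribR cong: if_cong)
qed

text \<open>Kolmogorov's inequality. Freezing the martingale when its absolute value first reaches \<open>\<epsilon>\<close> gives
  another martingale, whose increments are either unchanged or zero. If the level is reached at
  all, then the frozen martingale is still there at time \<open>N\<close>, so Chebyshev's inequality for the
  single time \<open>N\<close> bounds the probability.\<close>

lemma martingale_maximal_inequality:
  assumes \<xi>: "martingale_difference \<xi>" and \<epsilon>: "\<epsilon> > 0"
  shows "prob {\<omega> \<in> space M. \<exists>n\<le>N. \<bar>\<Sum>k=m..<n. \<xi> k \<omega>\<bar> \<ge> \<epsilon>} \<le>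
    (\<Sum>k=m..<N. expectation (\<lambda>\<omega>. (\<xi> k \<omega>)\<^sup>2)) / \<epsilon>\<^sup>2"
proof -
  define S where "S n \<omega> = (\<Sum>k=m..<n. \<xi> k \<omega>)" for n \<omega>
  define P where "P t \<omega> \<longleftrightarrow> (\<forall>n\<le>t. \<bar>S n \<omega>\<bar> < \<epsilon>)" for t \<omega>
  define \<zeta> where "\<zeta> t \<omega> = (if P t \<omega> then \<xi> t \<omega> else 0)" for t \<omega>
  have S: "determined n (S n)" for n
    unfolding S_def by (rule martingale_partial_sum_determined[OF \<xi>])
  have P: "determined t (P t)" for t
    unfolding determined_def
  proof (intro ballI impI)
    fix \<omega> \<omega>' assume *: "\<omega> \<in> space M" "\<omega>' \<in> space M" "\<forall>k<t. Y k \<omega> = Y k \<omega>'"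
    then have "S n \<omega> = S n \<omega>'" if "n \<le> t" for n
      using determined_mono[OF S that] unfolding determined_def by blast
    then show "P t \<omega> = P t \<omega>'" by (simp add: P_def)
  qed
  have \<zeta>: "martingale_difference \<zeta>"
    unfolding \<zeta>_def by (rule martingale_difference_stopped[OF \<xi> P])
  have \<zeta>d: "determined N (\<lambda>\<omega>. \<Sum>k=m..<N. \<zeta> k \<omega>)"
    by (rule martingale_partial_sum_determined[OF \<zeta>])
  have stopped: "\<epsilon> \<le> \<bar>\<Sum>k=m..<N. \<zeta> k \<omega>\<bar>" if ex: "\<exists>n\<le>N. \<bar>S n \<omega>\<bar> \<ge> \<epsilon>" for \<omega>
  proof -
    define n where "n = (LEAST n. \<bar>S n \<omega>\<bar> \<ge> \<epsilon>)"
    from ex obtain n' where n': "n' \<le> N" "\<bar>S n' \<omega>\<bar> \<ge> \<epsilon>" by blast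
    have n: "\<bar>S n \<omega>\<bar> \<ge> \<epsilon>" unfolding n_def by (rule LeastI[of _ n']) (rule n'(2))
    have nN: "n \<le> N" using Least_le[of "\<lambda>n. \<bar>S n \<omega>\<bar> \<ge> \<epsilon>" n'] n' unfolding n_def by simp
    have small: "\<bar>S k \<omega>\<bar> < \<epsilon>" if "k < n" for k
      using not_less_Least[of k "\<lambda>n. \<bar>S n \<omega>\<bar> \<ge> \<epsilon>"] that unfolding n_def by simp
    have "m \<le> n"
    proof (rule ccontr)
      assume "\<not> m \<le> n"
      then have "S n \<omega> = 0" by (simp add: S_def)
      then show False using n \<epsilon> by simp
    qed
    then have "(\<Sum>k=m..<N. \<zeta> k \<omega>) = (\<Sum>k=m..<n. \<zeta> k \<omega>) + (\<Sum>k=n..<N. \<zeta> k \<omega>)"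
      using nN by (simp add: sum.atLeastLessThan_concat)
    also have "(\<Sum>k=m..<n. \<zeta> k \<omega>) = S n \<omega>"
      unfolding S_def by (rule sum.cong) (use small in \<open>auto simp: \<zeta>_def P_def\<close>)
    also have "(\<Sum>k=n..<N. \<zeta> k \<omega>) = 0"
      by (rule sum.neutral) (use n in \<open>auto simp: \<zeta>_def P_def not_less[symmetric]\<close>)
    finally show ?thesis using n by simp
  qed
  have [measurable]: "(\<lambda>\<omega>. \<Sum>k=m..<N. \<zeta> k \<omega>) \<in> borel_measurable M"
    using determined_integrable[OF \<zeta>d] by (rule borel_measurable_integrable)
  have "prob {\<omega> \<in> space M. \<exists>n\<le>N. \<bar>S n \<omega>\<bar> \<ge> \<epsilon>} \<le> prob {\<omega> \<in> space M. \<bar>\<Sum>k=m..<N. \<zeta> k \<omega>\<bar> \<ge> \<epsilon>}"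
    by (rule finite_measure_mono) (use stopped in auto)
  also have "\<dots> \<le> expectation (\<lambda>\<omega>. (\<Sum>k=m..<N. \<zeta> k \<omega>)\<^sup>2) / \<epsilon>\<^sup>2"
    by (rule second_moment_method[OF _ determined_integrable[OF determined_comp[OF \<zeta>d]] \<epsilon>]) measurable
  also have "\<dots> = (\<Sum>k=m..<N. expectation (\<lambda>\<omega>. (\<zeta> k \<omega>)\<^sup>2)) / \<epsilon>\<^sup>2"
    by (simp only: martingale_second_moment[OF \<zeta>])
  also have "\<dots> \<le> (\<Sum>k=m..<N. expectation (\<lambda>\<omega>. (\<xi> k \<omega>)\<^sup>2)) / \<epsilon>\<^sup>2"
  proof (intro divide_right_mono sum_mono integral_mono)
    fix k
    have "determined (Suc k) (\<zeta> k)" "determined (Suc k) (\<xi> k)"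
      using \<zeta> \<xi> by (simp_all add: martingale_difference_def)
    then show "integrable M (\<lambda>\<omega>. (\<zeta> k \<omega>)\<^sup>2)" "integrable M (\<lambda>\<omega>. (\<xi> k \<omega>)\<^sup>2)"
      by (auto intro!: determined_integrable dest: determined_comp[where f = "\<lambda>x. x\<^sup>2"])
    show "(\<zeta> k \<omega>)\<^sup>2 \<le> (\<xi> k \<omega>)\<^sup>2" for \<omega> by (simp add: \<zeta>_def)
  qed simp
  finally show ?thesis by (simp only: S_def)
qed

lemma martingale_exceedance_event:
  assumes \<xi>: "martingale_difference \<xi>"
  shows "{\<omega> \<in> space M. \<exists>n\<le>N. \<bar>\<Sum>k=m..<n. \<xi> k \<omega>\<bar> \<ge> \<epsilon>} \<in> events"
proof -
  have [measurable]: "(\<lambda>\<omega>. \<Sum>k=m..<n. \<xi> k \<omega>) \<in> borel_measurable M" for n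
    using determined_integrable[OF martingale_partial_sum_determined[OF \<xi>]] by simp
  show ?thesis by measurable
qed

text \<open>The convergence theorem for martingales bounded in mean square. By the maximal inequality, the
  probability that the sums after time \<open>m\<close> ever deviate by \<open>\<epsilon>\<close> from the sum at time \<open>m\<close> is at most
  a tail of a convergent series divided by \<open>\<epsilon>\<^sup>2\<close>. Almost surely the partial sums are therefore Cauchy.\<close>

lemma martingale_convergence:
  assumes \<xi>: "martingale_difference \<xi>"
    and bound: "\<And>n. (\<Sum>k<n. expectation (\<lambda>\<omega>. (\<xi> k \<omega>)\<^sup>2)) \<le> V"
  shows "AE \<omega> in M. convergent (\<lambda>n. \<Sum>k<n. \<xi> k \<omega>)"
proof -
  define v where "v k = expectation (\<lambda>\<omega>. (\<xi> k \<omega>)\<^sup>2)" for k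
  have v0: "v k \<ge> 0" for k by (simp add: v_def)
  have v_sum: "summable v"
  proof (rule bounded_imp_summable[OF v0])
    show "(\<Sum>k\<le>n. v k) \<le> V" for n using bound[of "Suc n"] by (simp add: v_def lessThan_Suc_atMost)
  qed
  define tail where "tail m = suminf v - (\<Sum>k<m. v k)" for m
  have tail: "(\<Sum>k=m..<n. v k) \<le> tail m" for m n
  proof (cases "m \<le> n")
    case True
    have "(\<Sum>k<m. v k) + (\<Sum>k=m..<n. v k) = (\<Sum>k<n. v k)"
      using True sum.atLeastLessThan_concat[of 0 m n v] by (simp add: atLeast0LessThan)
    moreover have "(\<Sum>k<n. v k) \<le> suminf v" by (rule sum_le_suminf[OF v_sum]) (use v0 in auto)
    ultimately show ?thesis by (simp add: tail_def)
  next
    case False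
    then show ?thesis using sum_le_suminf[OF v_sum, of "{..<m}"] v0 by (simp add: tail_def)
  qed
  have tail_lim: "tail \<longlonglongrightarrow> 0"
    unfolding tail_def using tendsto_diff[OF tendsto_const summable_LIMSEQ[OF v_sum], of "suminf v"] by simp
  \<comment> \<open>For \<open>n \<le> m\<close> the sum is empty, so only times after \<open>m\<close> matter.\<close>
  define Bad where "Bad \<epsilon> m = {\<omega> \<in> space M. \<exists>n. \<bar>\<Sum>k=m..<n. \<xi> k \<omega>\<bar> \<ge> \<epsilon>}" for \<epsilon> :: real and m
  have Bad_event: "Bad \<epsilon> m \<in> events" and Bad_prob: "\<epsilon> > 0 \<Longrightarrow> prob (Bad \<epsilon> m) \<le> tail m / \<epsilon>\<^sup>2" for \<epsilon> m
  proof -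
    let ?B = "\<lambda>N. {\<omega> \<in> space M. \<exists>n\<le>N. \<bar>\<Sum>k=m..<n. \<xi> k \<omega>\<bar> \<ge> \<epsilon>}"
    have un: "(\<Union>N. ?B N) = Bad \<epsilon> m" by (auto simp: Bad_def)
    have ev: "range ?B \<subseteq> events" using martingale_exceedance_event[OF \<xi>] by blast
    then show "Bad \<epsilon> m \<in> events" unfolding un[symmetric] by (rule sets.countable_UN)
    assume \<epsilon>: "\<epsilon> > 0"
    have "incseq ?B" by (auto simp: incseq_def intro: order_trans)
    from finite_Lim_measure_incseq[OF ev this] have "(\<lambda>N. prob (?B N)) \<longlonglongrightarrow> prob (Bad \<epsilon> m)"
      by (simp only: un)
    moreover have "prob (?B N) \<le> tail m / \<epsilon>\<^sup>2" for N
      by (rule order_trans[OF martingale_maximal_inequality[OF \<xi> \<epsilon>]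
            divide_right_mono[OF tail[unfolded v_def]]]) simp
    ultimately show "prob (Bad \<epsilon> m) \<le> tail m / \<epsilon>\<^sup>2" by (blast intro: LIMSEQ_le_const2)
  qed
  have null: "AE \<omega> in M. \<exists>m. \<omega> \<notin> Bad \<epsilon> m" if \<epsilon>: "\<epsilon> > 0" for \<epsilon>
  proof -
    have ev: "(\<Inter>m. Bad \<epsilon> m) \<in> events" using Bad_event by (intro sets.countable_INT) auto
    have "prob (\<Inter>m. Bad \<epsilon> m) \<le> tail m / \<epsilon>\<^sup>2" for m
      using finite_measure_mono[OF _ Bad_event, of "\<Inter>m. Bad \<epsilon> m" \<epsilon> m] Bad_prob[OF \<epsilon>, of m]
      by (auto intro: order_trans)
    moreover have "(\<lambda>m. tail m / \<epsilon>\<^sup>2) \<longlonglongrightarrow> 0" using tendsto_divide[OF tail_lim tendsto_const, of "\<epsilon>\<^sup>2"] \<epsilon> by simp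
    ultimately have "prob (\<Inter>m. Bad \<epsilon> m) \<le> 0"
      by (intro LIMSEQ_le_const[of "\<lambda>m. tail m / \<epsilon>\<^sup>2"]) auto
    then have "prob (\<Inter>m. Bad \<epsilon> m) = 0" using measure_nonneg[of M] by (metis order_antisym)
    then have "AE \<omega> in M. \<omega> \<notin> (\<Inter>m. Bad \<epsilon> m)"
      using ev prob_eq_0 by blast
    then show ?thesis by simp
  qed
  have "AE \<omega> in M. \<forall>j. \<exists>m. \<omega> \<notin> Bad (1 / real (Suc j)) m"
    by (subst AE_all_countable) (use null in auto)
  then show ?thesis
  proof (rule AE_mp, intro AE_I2 impI)
    fix \<omega> assume \<omega>: "\<omega> \<in> space M" and good: "\<forall>j. \<exists>m. \<omega> \<notin> Bad (1 / real (Suc j)) m"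
    have "Cauchy (\<lambda>n. \<Sum>k<n. \<xi> k \<omega>)"
    proof (rule metric_CauchyI)
      fix e :: real assume "e > 0"
      then obtain j where j: "1 / real (Suc j) < e / 2" using nat_approx_posE[of "e / 2"] by auto
      obtain m where m: "\<omega> \<notin> Bad (1 / real (Suc j)) m" using good by blast
      have near: "dist (\<Sum>k<n. \<xi> k \<omega>) (\<Sum>k<m. \<xi> k \<omega>) < e / 2" if "n \<ge> m" for n
      proof -
        have "(\<Sum>k<n. \<xi> k \<omega>) - (\<Sum>k<m. \<xi> k \<omega>) = (\<Sum>k=m..<n. \<xi> k \<omega>)"
          using that sum.atLeastLessThan_concat[of 0 m n "\<lambda>k. \<xi> k \<omega>"] by (simp add: atLeast0LessThan)
        moreover have "\<bar>\<Sum>k=m..<n. \<xi> k \<omega>\<bar> < 1 / real (Suc j)"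
          using m \<omega> by (force simp: Bad_def not_le)
        ultimately show ?thesis using j by (simp add: dist_real_def)
      qed
      have "dist (\<Sum>k<n. \<xi> k \<omega>) (\<Sum>k<n'. \<xi> k \<omega>) < e" if "n \<ge> m" "n' \<ge> m" for n n'
        using dist_triangle_half_l[OF near[OF that(1)] near[OF that(2)]] .
      then show "\<exists>M. \<forall>n\<ge>M. \<forall>n'\<ge>M. dist (\<Sum>k<n. \<xi> k \<omega>) (\<Sum>k<n'. \<xi> k \<omega>) < e" by blast
    qed
    then show "convergent (\<lambda>n. \<Sum>k<n. \<xi> k \<omega>)" by (rule Cauchy_convergent)
  qed
qed

end

section \<open>Summability along slowly moving sequences\<close>

text \<open>Summability of \<open>\<eta> t * p (x t)\<close> with divergent \<open>\<eta>\<close> only gives a subsequence along which \<open>p\<close> tends to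
  zero. Suppose that \<open>p (x t) \<ge> \<epsilon>\<close> infinitely often. By compactness these points have a limit \<open>l\<close>,
  and \<open>p > \<epsilon> / 2\<close> on a neighbourhood \<open>U\<close> of \<open>l\<close>. Each visit close to \<open>l\<close> must end, because \<open>\<eta>\<close> is not
  summable; but a sequence that moves by at most a multiple of \<open>\<eta> t\<close> in one step leaves \<open>U\<close> only after
  the step sizes have added up to a fixed \<open>\<delta>\<close>. A late visit then contributes at least \<open>\<epsilon> / 2 * \<delta>\<close>
  to a tail of the convergent series.\<close>

lemma slow_sequence_tendsto_zero:
  fixes x :: "nat \<Rightarrow> 'm::{first_countable_topology, t2_space}" and p :: "'m \<Rightarrow> real"
  assumes K: "compact K" "\<And>t. x t \<in> K"
    and p: "continuous_on UNIV p" "\<And>y. p y \<ge> 0"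
    and \<eta>: "\<And>t. \<eta> t > 0" "filterlim (\<lambda>n. \<Sum>t<n. \<eta> t) at_top sequentially"
    and sum: "summable (\<lambda>t. \<eta> t * p (x t))"
    and a: "a \<longlonglongrightarrow> 0" "\<And>t. a t \<le> A * \<eta> t" and A: "A > 0"
    and escape: "\<And>x0 U. x0 \<in> K \<Longrightarrow> open U \<Longrightarrow> x0 \<in> U \<Longrightarrow> \<exists>\<psi> L \<theta>. isCont \<psi> x0 \<and> \<psi> x0 = 0 \<and>
      (\<forall>y. \<psi> y < 1 \<longrightarrow> y \<in> U) \<and> L > 0 \<and> \<theta> > 0 \<and>
      (\<forall>t. \<psi> (x t) < (1::real) \<longrightarrow> a t \<le> \<theta> \<longrightarrow> \<psi> (x (Suc t)) \<le> \<psi> (x t) + L * a t)"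
  shows "(\<lambda>t. p (x t)) \<longlonglongrightarrow> 0"
proof (rule ccontr)
  assume "\<not> (\<lambda>t. p (x t)) \<longlonglongrightarrow> 0"
  then obtain \<epsilon> where \<epsilon>: "\<epsilon> > 0" and "\<forall>N. \<exists>t\<ge>N. \<epsilon> \<le> p (x t)"
    using p(2) by (auto simp: LIMSEQ_iff not_less)
  then have "infinite {t. \<epsilon> \<le> p (x t)}" unfolding infinite_nat_iff_unbounded_le by auto
  then obtain r :: "nat \<Rightarrow> nat" where r: "strict_mono r" "\<And>n. \<epsilon> \<le> p (x (r n))"
    using infinite_enumerate by (metis (mono_tags, lifting) mem_Collect_eq)
  have "seq_compact K" using K(1) by (rule compact_imp_seq_compact)
  then obtain l s where l: "l \<in> K" "strict_mono s" "((x \<circ> r) \<circ> s) \<longlonglongrightarrow> l"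
    using K(2) by (auto elim!: seq_compactE[of K "x \<circ> r"])
  define q where "q = r \<circ> s"
  have q: "strict_mono q" unfolding q_def using r(1) l(2) by (rule strict_mono_o)
  have xq: "(\<lambda>n. x (q n)) \<longlonglongrightarrow> l" using l(3) by (simp add: q_def o_def)
  have "isCont p l" using p(1) by (simp add: continuous_on_eq_continuous_at)
  then have "(\<lambda>n. p (x (q n))) \<longlonglongrightarrow> p l" using xq by (rule isCont_tendsto_compose)
  then have pl: "\<epsilon> \<le> p l" by (rule LIMSEQ_le_const) (use r(2) in \<open>auto simp: q_def\<close>)
  define U where "U = {y. \<epsilon> / 2 < p y}"
  have "open U" unfolding U_def by (intro open_Collect_less continuous_on_const p(1))
  moreover have "l \<in> U" using pl \<epsilon> by (simp add: U_def)
  ultimately obtain \<psi> L \<theta> where \<psi>: "isCont \<psi> l" "\<psi> l = 0" "\<And>y. \<psi> y < 1 \<Longrightarrow> y \<in> U"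
    and L: "L > 0" "\<theta> > 0"
    and \<psi>_step: "\<And>t. \<psi> (x t) < (1::real) \<Longrightarrow> a t \<le> \<theta> \<Longrightarrow> \<psi> (x (Suc t)) \<le> \<psi> (x t) + L * a t"
    using escape[OF l(1)] by blast
  \<comment> \<open>The visit starts at \<open>\<psi> < 1 / 2\<close>, and \<open>\<psi>\<close> grows by at most \<open>L * A * \<eta> t\<close> per step, so this much
    total step size fits in before \<open>\<psi>\<close> reaches \<open>1\<close>.\<close>
  define \<delta> where "\<delta> = 1 / (2 * L * A)"
  have \<delta>: "\<delta> > 0" "L * A * \<delta> = 1 / 2" using L A by (simp_all add: \<delta>_def)
  have "(\<lambda>n. \<psi> (x (q n))) \<longlonglongrightarrow> \<psi> l" using \<psi>(1) xq by (rule isCont_tendsto_compose)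
  then have "eventually (\<lambda>n. \<psi> (x (q n)) < 1 / 2) sequentially" by (rule order_tendstoD(2)) (simp add: \<psi>(2))
  moreover have "eventually (\<lambda>t. a t < \<theta>) sequentially" by (rule order_tendstoD(2)[OF a(1) L(2)])
  then obtain T1 where T1: "\<And>t. t \<ge> T1 \<Longrightarrow> a t \<le> \<theta>"
    unfolding eventually_sequentially by (metis less_imp_le)
  moreover obtain T2 where T2: "\<And>m n. m \<ge> T2 \<Longrightarrow> norm (\<Sum>t=m..<n. \<eta> t * p (x t)) < \<epsilon> / 2 * \<delta>"
    using sum \<epsilon> \<delta>(1) unfolding summable_Cauchy by (metis half_gt_zero mult_pos_pos)
  moreover have "eventually (\<lambda>n. q n \<ge> max T1 T2) sequentially"
    using filterlim_subseq[OF q] unfolding filterlim_at_top by blast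
  ultimately obtain n0 where n0: "\<psi> (x (q n0)) < 1 / 2" "q n0 \<ge> max T1 T2"
    using eventually_happens[OF eventually_conj] by (metis (mono_tags, lifting) trivial_limit_sequentially)
  define m where "m = q n0"
  have m: "m \<ge> T1" "m \<ge> T2" "\<psi> (x m) < 1 / 2" using n0 by (simp_all add: m_def)
  have "eventually (\<lambda>n. (\<Sum>t<n. \<eta> t) \<ge> (\<Sum>t<m. \<eta> t) + \<delta>) sequentially"
    using \<eta>(2) unfolding filterlim_at_top by blast
  then obtain n1 where "\<And>n. n \<ge> n1 \<Longrightarrow> (\<Sum>t<n. \<eta> t) \<ge> (\<Sum>t<m. \<eta> t) + \<delta>"
    unfolding eventually_sequentially by blast
  from this[of "max n1 m"] have "\<delta> \<le> (\<Sum>t=m..<max n1 m. \<eta> t)"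
    using sum.atLeastLessThan_concat[of 0 m "max n1 m" \<eta>] by (simp add: atLeast0LessThan)
  then have ex: "\<exists>n. \<delta> \<le> (\<Sum>t=m..<n. \<eta> t)" ..
  define n where "n = (LEAST n. \<delta> \<le> (\<Sum>t=m..<n. \<eta> t))"
  have n: "\<delta> \<le> (\<Sum>t=m..<n. \<eta> t)" unfolding n_def using ex by (rule LeastI_ex)
  have before: "(\<Sum>t=m..<k. \<eta> t) < \<delta>" if "k < n" for k
    using not_less_Least that unfolding n_def by (metis not_le)
  have slow: "\<psi> (x k) < 1 / 2 + L * A * (\<Sum>t=m..<k. \<eta> t)" if "m \<le> k" "k < n" for k
    using that
  proof (induction k rule: dec_induct)
    case base
    then show ?case using m(3) by simp
  next
    case (step k)
    have "L * A * (\<Sum>t=m..<k. \<eta> t) < L * A * \<delta>"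
      using before[of k] step.prems L A by simp
    then have "\<psi> (x k) < 1" using step.IH step.prems \<delta>(2) by simp
    then have "\<psi> (x (Suc k)) \<le> \<psi> (x k) + L * a k"
      using T1[of k] m(1) step.hyps by (intro \<psi>_step) auto
    also have "L * a k \<le> L * (A * \<eta> k)" using a(2) L(1) by (intro mult_left_mono) auto
    finally show ?case using step.IH step.prems step.hyps by (simp add: algebra_simps)
  qed
  have big: "\<epsilon> / 2 * \<eta> k \<le> \<eta> k * p (x k)" if "m \<le> k" "k < n" for k
  proof -
    have "L * A * (\<Sum>t=m..<k. \<eta> t) < L * A * \<delta>" using before[OF that(2)] L A by simp
    then have "x k \<in> U" using slow[OF that] \<delta>(2) by (intro \<psi>(3)) simp
    then show ?thesis using \<eta>(1)[of k] by (simp add: U_def)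
  qed
  have "\<epsilon> / 2 * \<delta> \<le> \<epsilon> / 2 * (\<Sum>t=m..<n. \<eta> t)" using n \<epsilon> by simp
  also have "\<dots> \<le> (\<Sum>t=m..<n. \<eta> t * p (x t))"
    unfolding sum_distrib_left by (rule sum_mono) (use big in auto)
  finally show False using T2[OF m(2), of n] by simp
qed

section \<open>Adaptive step sizes\<close>

text \<open>With \<open>s t = \<beta> + (\<Sum>k<t. a k)\<close> the sum is a Riemann sum for the integral of \<open>y powr (- 1 - r)\<close> from \<open>\<beta>\<close>
  to infinity, evaluated at the left end points. As \<open>s (Suc t) \<le> (1 + c / \<beta>) * s t\<close>, the left end point
  may be replaced by any point of the interval at the cost of a constant factor, and the mean value
  theorem turns the sum into a telescoping one.\<close>

lemma adaptive_step_squares_bounded: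
  fixes a :: "nat \<Rightarrow> real"
  assumes \<beta>: "\<beta> > 0" and r: "r > 0" and a: "\<And>t. 0 \<le> a t" "\<And>t. a t \<le> c"
  shows "(\<Sum>t<n. a t / (\<beta> + (\<Sum>k<t. a k)) powr (1 + r)) \<le>
    (1 + c / \<beta>) powr (1 + r) / r * \<beta> powr (- r)"
proof -
  define s where "s t = \<beta> + (\<Sum>k<t. a k)" for t
  define \<kappa> where "\<kappa> = 1 + c / \<beta>"
  have c: "c \<ge> 0" using a order_trans by blast
  have s_ge: "\<beta> \<le> s t" for t unfolding s_def using a(1) by (simp add: sum_nonneg)
  have s_pos: "s t > 0" for t using s_ge[of t] \<beta> by linarith
  have s_Suc: "s (Suc t) = s t + a t" for t by (simp add: s_def)
  have \<kappa>: "\<kappa> \<ge> 1" using c \<beta> by (simp add: \<kappa>_def)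
  have s_\<kappa>: "s (Suc t) \<le> \<kappa> * s t" for t
  proof -
    have "a t \<le> c / \<beta> * \<beta>" using a(2) \<beta> by simp
    also have "\<dots> \<le> c / \<beta> * s t" using s_ge c \<beta> by (intro mult_left_mono) auto
    finally show ?thesis by (simp add: s_Suc \<kappa>_def algebra_simps)
  qed
  have bound: "a t / s t powr (1 + r) \<le> \<kappa> powr (1 + r) / r * (s t powr (- r) - s (Suc t) powr (- r))" for t
  proof (cases "a t = 0")
    case False
    then have lt: "s t < s (Suc t)" using a(1)[of t] by (simp add: s_Suc)
    have der: "((\<lambda>y. y powr (- r)) has_real_derivative (- r) * y powr (- r - 1)) (at y)"
      if "s t \<le> y" for y
      using that s_pos[of t] by (intro has_real_derivative_powr) auto
    obtain z where z: "s t < z" "z < s (Suc t)"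
      "s (Suc t) powr (- r) - s t powr (- r) = (s (Suc t) - s t) * ((- r) * z powr (- r - 1))"
      using MVT2[OF lt, of "\<lambda>y. y powr (- r)" "\<lambda>y. (- r) * y powr (- r - 1)"] der by auto
    have z0: "z > 0" using z(1) s_pos[of t] by linarith
    have "z \<le> \<kappa> * s t" using z(2) s_\<kappa>[of t] by linarith
    then have "z powr (1 + r) \<le> (\<kappa> * s t) powr (1 + r)" using z0 r by (intro powr_mono2) auto
    also have "\<dots> = \<kappa> powr (1 + r) * s t powr (1 + r)"
      using \<kappa> s_pos[of t] by (simp add: powr_mult)
    finally have "1 / s t powr (1 + r) \<le> \<kappa> powr (1 + r) * (1 / z powr (1 + r))"
      using s_pos[of t] z0 by (simp add: field_simps)
    also have "1 / z powr (1 + r) = z powr (- r - 1)"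
    proof -
      have eq: "- r - 1 = - (1 + r)" by simp
      show ?thesis unfolding eq by (rule powr_minus_divide[symmetric])
    qed
    finally have "a t * (1 / s t powr (1 + r)) \<le> a t * (\<kappa> powr (1 + r) * z powr (- r - 1))"
      using a(1) by (rule mult_left_mono)
    also have "\<dots> = \<kappa> powr (1 + r) / r * (a t * (r * z powr (- r - 1)))" using r by simp
    also have "a t * (r * z powr (- r - 1)) = s t powr (- r) - s (Suc t) powr (- r)"
      using z(3) by (simp add: s_Suc)
    finally show ?thesis by simp
  qed (simp add: s_Suc)
  have "(\<Sum>t<n. a t / s t powr (1 + r)) \<le>
      (\<Sum>t<n. \<kappa> powr (1 + r) / r * (s t powr (- r) - s (Suc t) powr (- r)))"
    by (rule sum_mono) (rule bound)
  also have "\<dots> = \<kappa> powr (1 + r) / r * (s 0 powr (- r) - s n powr (- r))"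
    using sum_lessThan_telescope'[of "\<lambda>t. s t powr (- r)" n]
    by (simp only: sum_distrib_left[symmetric])
  also have "\<dots> \<le> \<kappa> powr (1 + r) / r * \<beta> powr (- r)"
    using r by (intro mult_left_mono) (auto simp: s_def)
  finally show ?thesis by (simp add: s_def \<kappa>_def)
qed

text \<open>The denominators grow at most linearly in \<open>t\<close>, so the harmonic series is a minorant.\<close>

lemma adaptive_steps_diverge:
  fixes a :: "nat \<Rightarrow> real"
  assumes \<alpha>: "\<alpha> > 0" and \<beta>: "\<beta> > 0" and q: "0 \<le> q" "q \<le> 1" and a: "\<And>t. 0 \<le> a t" "\<And>t. a t \<le> c"
  shows "filterlim (\<lambda>n. \<Sum>t<n. \<alpha> / (\<beta> + (\<Sum>k<t. a k)) powr q) at_top sequentially"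
proof -
  define C where "C = 1 + \<beta> + c"
  have c: "c \<ge> 0" using a order_trans by blast
  have C: "C > 0" using c \<beta> by (simp add: C_def)
  have bound: "\<alpha> / C * inverse (real (Suc t)) \<le> \<alpha> / (\<beta> + (\<Sum>k<t. a k)) powr q" for t
  proof -
    define s where "s = \<beta> + (\<Sum>k<t. a k)"
    have sum: "0 \<le> (\<Sum>k<t. a k)" "(\<Sum>k<t. a k) \<le> real t * c"
      using a sum_bounded_above[of "{..<t}" a c] by (auto simp: sum_nonneg)
    have s: "s > 0" using sum \<beta> by (simp add: s_def)
    have "s powr q \<le> (1 + s) powr q" using s q by (intro powr_mono2) auto
    also have "\<dots> \<le> (1 + s) powr 1" using s q by (intro powr_mono) auto
    also have "\<dots> = 1 + s" using s by simp
    also have "\<dots> \<le> C * real (Suc t)"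
    proof -
      have "C * real (Suc t) = 1 + \<beta> + c + real t + \<beta> * real t + real t * c"
        by (simp add: C_def algebra_simps)
      moreover have "0 \<le> \<beta> * real t" using \<beta> by simp
      ultimately show ?thesis using sum(2) c unfolding s_def by linarith
    qed
    finally have "\<alpha> / (C * real (Suc t)) \<le> \<alpha> / s powr q"
      using \<alpha> s C by (intro divide_left_mono) auto
    then show ?thesis by (simp add: s_def field_simps)
  qed
  have "filterlim (\<lambda>n. \<alpha> / C * harm n) at_top sequentially"
    using \<alpha> C harm_at_top by (intro filterlim_tendsto_pos_mult_at_top[OF tendsto_const]) auto
  moreover have "\<alpha> / C * harm n \<le> (\<Sum>t<n. \<alpha> / (\<beta> + (\<Sum>k<t. a k)) powr q)" for n
  proof -
    have "harm n = (\<Sum>t<n. inverse (real (Suc t)))"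
      unfolding harm_def by (simp add: sum.atLeast1_atMost_eq)
    then show ?thesis using sum_mono[OF bound] by (simp add: sum_distrib_left)
  qed
  ultimately show ?thesis by (auto intro: filterlim_at_top_mono)
qed

section \<open>Minibatches\<close>

lemma finite_minibatches: "finite (minibatches N b)"
  unfolding minibatches_def by (rule finite_subset[of _ "Pow {1..N}"]) auto

lemma card_minibatches: "card (minibatches N b) = N choose b"
  unfolding minibatches_def using n_subsets[of "{1..N}" b] by simp

text \<open>Removing \<open>l\<close> is a bijection onto the subsets with one element less of the remaining indices.\<close>

lemma card_minibatches_containing:
  assumes l: "l \<in> {1..N}" and b: "1 \<le> b"
  shows "card {Y \<in> minibatches N b. l \<in> Y} = (N - 1) choose (b - 1)"
proof -
  have "bij_betw (\<lambda>Y. Y - {l}) {Y \<in> minibatches N b. l \<in> Y} {Z. Z \<subseteq> {1..N} - {l} \<and> card Z = b - 1}"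
  proof (rule bij_betw_byWitness[where f' = "insert l"])
    show "(\<lambda>Y. Y - {l}) ` {Y \<in> minibatches N b. l \<in> Y} \<subseteq> {Z. Z \<subseteq> {1..N} - {l} \<and> card Z = b - 1}"
      by (auto simp: minibatches_def)
    show "insert l ` {Z. Z \<subseteq> {1..N} - {l} \<and> card Z = b - 1} \<subseteq> {Y \<in> minibatches N b. l \<in> Y}"
    proof
      fix Y assume "Y \<in> insert l ` {Z. Z \<subseteq> {1..N} - {l} \<and> card Z = b - 1}"
      then obtain Z where Z: "Z \<subseteq> {1..N} - {l}" "card Z = b - 1" "Y = insert l Z" by blast
      then have "finite Z" "l \<notin> Z" using finite_subset[of Z "{1..N} - {l}"] by auto
      then show "Y \<in> {Y \<in> minibatches N b. l \<in> Y}" using Z l b by (auto simp: minibatches_def)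
    qed
  qed auto
  from bij_betw_same_card[OF this] show ?thesis
    using n_subsets[of "{1..N} - {l}" "b - 1"] l by simp
qed

text \<open>Every index lies in the same number of minibatches, so the average over minibatches weights all
  indices equally.\<close>

lemma minibatch_average:
  fixes h :: "nat \<Rightarrow> real"
  assumes b: "1 \<le> b" "b \<le> N"
  shows "(\<Sum>Y\<in>minibatches N b. (1 / real b) * (\<Sum>l\<in>Y. h l)) / real (card (minibatches N b)) =
    (1 / real N) * (\<Sum>l=1..N. h l)"
proof -
  have "(\<Sum>Y\<in>minibatches N b. \<Sum>l\<in>Y. h l) =
      (\<Sum>Y\<in>minibatches N b. \<Sum>l\<in>{l\<in>{1..N}. l \<in> Y}. h l)"
    by (intro sum.cong refl) (auto simp: minibatches_def)
  also have "\<dots> = (\<Sum>l=1..N. \<Sum>Y\<in>{Y \<in> minibatches N b. l \<in> Y}. h l)"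
    by (rule sum.swap_restrict) (auto simp: finite_minibatches)
  also have "\<dots> = (\<Sum>l=1..N. real ((N - 1) choose (b - 1)) * h l)"
    by (rule sum.cong) (use card_minibatches_containing b in auto)
  also have "\<dots> = real ((N - 1) choose (b - 1)) * (\<Sum>l=1..N. h l)"
    by (simp only: sum_distrib_left)
  finally have sums: "(\<Sum>Y\<in>minibatches N b. (1 / real b) * (\<Sum>l\<in>Y. h l)) =
      (1 / real b) * (real ((N - 1) choose (b - 1)) * (\<Sum>l=1..N. h l))"
    by (simp only: sum_distrib_left[symmetric])
  have "real b * real (N choose b) = real N * real ((N - 1) choose (b - 1))"
    using times_binomial_minus1_eq[of b N] b unfolding of_nat_mult[symmetric] by simp
  moreover have "real (N choose b) > 0" "real N > 0" "real b > 0" using b by simp_all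
  ultimately show ?thesis
    unfolding sums card_minibatches by (simp add: field_simps)
qed

section \<open>Convergence of stochastic gradient descent\<close>

text \<open>Uniformity of the draws is assumed through the probabilities of single minibatches, which is the
  form in which \<open>expectation_next_draw\<close> consumes it.\<close>

locale minibatch_gradient_descent =
  riemannian_retraction \<A> g R +
  draws: independent_draws P "\<lambda>t. minibatches N (b t)" Y
  for \<A> :: "('m::{t2_space, second_countable_topology}, 'e::real_normed_vector) chart set"
    and g :: "('m, 'e) metric"
    and R :: "'m \<Rightarrow> ('m, 'e) tvec \<Rightarrow> 'm"
    and P :: "'w measure"
    and N :: nat
    and b :: "nat \<Rightarrow> nat"
    and Y :: "nat \<Rightarrow> 'w \<Rightarrow> nat set" +
  fixes F :: "'m \<Rightarrow> real"
    and K :: "'m set"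
    and A :: real
    and H :: "'m \<Rightarrow> nat \<Rightarrow> ('m, 'e) tvec"
  assumes F_C1: "Ck_function \<A> 1 F"
    and K_compact: "compact K"
    and A_pos: "A > 0"
    and lipschitz: "R_lipschitz \<A> g R K A (gradient \<A> g F)"
    and H_field: "\<And>l. l \<in> {1..N} \<Longrightarrow> vector_field \<A> (\<lambda>x. H x l)"
    and H_mean: "\<And>x. (1 / real N) *\<^sub>R (\<Sum>l=1..N. H x l) = gradient \<A> g F x"
    and H_bound: "\<And>x l. x \<in> K \<Longrightarrow> l \<in> {1..N} \<Longrightarrow> riem_norm g x (H x l) \<le> A"
    and b_range: "\<And>t. 1 \<le> b t \<and> b t \<le> N"
    and Y_uniform: "\<And>t y. y \<in> minibatches N (b t) \<Longrightarrow>
      draws.prob {\<omega> \<in> space P. Y t \<omega> = y} = 1 / real (card (minibatches N (b t)))"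
begin

definition batch_mean :: "nat \<Rightarrow> 'm \<Rightarrow> nat set \<Rightarrow> ('m, 'e) tvec" where
  "batch_mean t x y = (1 / real (b t)) *\<^sub>R (\<Sum>l\<in>y. H x l)"

definition grad_sq :: "'m \<Rightarrow> real" where
  "grad_sq x = (riem_norm g x (gradient \<A> g F x))\<^sup>2"

lemmas gradient_tangent = gradient_in_tangent_space[OF F_C1]

lemma grad_sq_eq: "grad_sq x = g x (gradient \<A> g F x) (gradient \<A> g F x)"
  unfolding grad_sq_def by (rule riem_norm_square[OF gradient_tangent])

lemma H_tangent: "l \<in> {1..N} \<Longrightarrow> H x l \<in> tangent_space \<A> x"
  using H_field unfolding vector_field_def by blast

lemma minibatch_props:
  assumes "y \<in> minibatches N (b t)"
  shows "finite y" "y \<subseteq> {1..N}" "card y = b t" "y \<noteq> {}"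
  using assms b_range[of t] finite_subset[of y "{1..N}"] by (auto simp: minibatches_def)

lemma batch_mean_tangent:
  assumes "y \<in> minibatches N (b t)"
  shows "batch_mean t x y \<in> tangent_space \<A> x"
  unfolding batch_mean_def
  by (intro tangent_scale tangent_sum H_tangent) (use minibatch_props[OF assms] in blast)

lemma batch_mean_le:
  assumes "y \<in> minibatches N (b t)" "x \<in> K"
  shows "riem_norm g x (batch_mean t x y) \<le> A"
  unfolding batch_mean_def minibatch_props(3)[OF assms(1), symmetric]
  by (rule riem_norm_average_le[OF minibatch_props(1,4)[OF assms(1)]])
     (use minibatch_props[OF assms(1)] H_tangent H_bound[OF assms(2)] in blast)+

text \<open>Unbiasedness of the minibatch mean, tested against the gradient: in the first order expansion of
  \<open>F\<close> the minibatch mean enters exactly through this inner product.\<close>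

lemma batch_mean_unbiased:
  "(\<Sum>y\<in>minibatches N (b t). g x (gradient \<A> g F x) (batch_mean t x y))
     / real (card (minibatches N (b t))) = grad_sq x"
proof -
  let ?G = "gradient \<A> g F x"
  have "g x ?G (batch_mean t x y) = (1 / real (b t)) * (\<Sum>l\<in>y. g x ?G (H x l))"
    if y: "y \<in> minibatches N (b t)" for y
  proof -
    note p = minibatch_props[OF y]
    have HT: "H x l \<in> tangent_space \<A> x" if "l \<in> y" for l using that p(2) H_tangent by blast
    show ?thesis unfolding batch_mean_def
      by (simp only: metric_scale_right[OF tangent_sum[OF HT] gradient_tangent]
          metric_sum_right[OF p(1) gradient_tangent HT])
  qed
  then have "(\<Sum>y\<in>minibatches N (b t). g x ?G (batch_mean t x y))
      / real (card (minibatches N (b t))) = (1 / real N) * (\<Sum>l=1..N. g x ?G (H x l))"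
    using minibatch_average[of "b t" N "\<lambda>l. g x ?G (H x l)"] b_range[of t] by simp
  also have "\<dots> = g x ?G ((1 / real N) *\<^sub>R (\<Sum>l=1..N. H x l))"
    by (simp only: metric_scale_right[OF tangent_sum[OF H_tangent] gradient_tangent]
        metric_sum_right[OF finite_atLeastAtMost gradient_tangent H_tangent])
  finally show ?thesis by (simp only: H_mean grad_sq_eq)
qed

lemma continuous_grad_sq: "continuous_on UNIV grad_sq"
  unfolding grad_sq_def[abs_def] by (rule continuous_gradient_square[OF F_C1])

text \<open>The common core of both step size rules. The step size may depend on the past; it has to keep the
  steps within the radius of the Lipschitz condition, to have divergent sum, and to make the squared
  step lengths summable with a deterministic bound \<open>V\<close>.

  With \<open>p t\<close> the squared gradient norm, \<open>s t\<close> the inner product of the gradient with the minibatch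
  mean and \<open>a t\<close> the length of the step, the first order bound reads
  \<open>F (x (Suc t)) = F (x t) - \<eta> t * p t + \<xi> t + e t\<close>, where \<open>\<xi> t = \<eta> t * (p t - s t)\<close> is a martingale
  difference and \<open>e t\<close> is bounded by a multiple of \<open>(a t)\<^sup>2\<close>. Both error series converge almost surely,
  and \<open>F\<close> is bounded on \<open>K\<close>; so the series of the \<open>\<eta> t * p t\<close> converges, and with it \<open>F (x t)\<close>. The
  gradient then tends to zero by \<open>slow_sequence_tendsto_zero\<close>, and in mean square by dominated
  convergence.\<close>

lemma descent_convergence:
  fixes \<eta> :: "nat \<Rightarrow> 'w \<Rightarrow> real" and x :: "nat \<Rightarrow> 'w \<Rightarrow> 'm" and V :: real
  assumes x_0: "\<And>\<omega>. \<omega> \<in> space P \<Longrightarrow> x 0 \<omega> = start"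
    and x_Suc: "\<And>t \<omega>. \<omega> \<in> space P \<Longrightarrow>
      x (Suc t) \<omega> = R (x t \<omega>) (- \<eta> t \<omega> *\<^sub>R batch_mean t (x t \<omega>) (Y t \<omega>))"
    and x_K: "\<And>t \<omega>. \<omega> \<in> space P \<Longrightarrow> x t \<omega> \<in> K"
    and \<eta>_determined: "\<And>t. draws.determined t (\<eta> t)"
    and \<eta>_pos: "\<And>t \<omega>. \<omega> \<in> space P \<Longrightarrow> \<eta> t \<omega> > 0"
    and \<eta>_diverges: "\<And>\<omega>. \<omega> \<in> space P \<Longrightarrow> filterlim (\<lambda>n. \<Sum>t<n. \<eta> t \<omega>) at_top sequentially"
    and short: "\<And>t \<omega>. \<omega> \<in> space P \<Longrightarrow>
      \<eta> t \<omega> * riem_norm g (x t \<omega>) (batch_mean t (x t \<omega>) (Y t \<omega>)) \<le> A"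
    and squares: "\<And>n \<omega>. \<omega> \<in> space P \<Longrightarrow>
      (\<Sum>t<n. (\<eta> t \<omega> * riem_norm g (x t \<omega>) (batch_mean t (x t \<omega>) (Y t \<omega>)))\<^sup>2) \<le> V"
  shows "AE \<omega> in P. convergent (\<lambda>t. F (x t \<omega>))"
    and "AE \<omega> in P. (\<lambda>t. riem_norm g (x t \<omega>) (gradient \<A> g F (x t \<omega>))) \<longlonglongrightarrow> 0"
    and "\<And>t. integrable P (\<lambda>\<omega>. (riem_norm g (x t \<omega>) (gradient \<A> g F (x t \<omega>)))\<^sup>2)"
    and "(\<lambda>t. \<integral>\<omega>. (riem_norm g (x t \<omega>) (gradient \<A> g F (x t \<omega>)))\<^sup>2 \<partial>P) \<longlonglongrightarrow> 0"
proof -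
  have x_determined: "draws.determined t (x t)" for t
  proof (induction t)
    case 0
    then show ?case using x_0 by (simp add: draws.determined_def)
  next
    case (Suc t)
    have 1: "draws.determined (Suc t) (x t)" "draws.determined (Suc t) (\<eta> t)"
      using Suc \<eta>_determined draws.determined_mono by (blast intro: le_SucI)+
    have 2: "draws.determined (Suc t) (Y t)" by (rule draws.determined_draw) simp
    from draws.determined_comp2[OF draws.determined_comp2[OF 1, of Pair] 2,
        of "\<lambda>(z, e) y. R z (- e *\<^sub>R batch_mean t z y)"]
    show ?case
      by (subst draws.determined_cong[where Z' =
            "\<lambda>\<omega>. R (x t \<omega>) (- \<eta> t \<omega> *\<^sub>R batch_mean t (x t \<omega>) (Y t \<omega>))"]) (simp_all add: x_Suc)
  qed
  define G where "G t \<omega> = batch_mean t (x t \<omega>) (Y t \<omega>)" for t \<omega>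
  define p where "p t \<omega> = grad_sq (x t \<omega>)" for t \<omega>
  define s where "s t \<omega> = g (x t \<omega>) (gradient \<A> g F (x t \<omega>)) (G t \<omega>)" for t \<omega>
  define a where "a t \<omega> = \<eta> t \<omega> * riem_norm g (x t \<omega>) (G t \<omega>)" for t \<omega>
  define \<xi> where "\<xi> t \<omega> = \<eta> t \<omega> * (p t \<omega> - s t \<omega>)" for t \<omega>
  have G_tangent: "G t \<omega> \<in> tangent_space \<A> (x t \<omega>)" if "\<omega> \<in> space P" for t \<omega>
    unfolding G_def by (rule batch_mean_tangent[OF draws.draw_in[OF that]])
  have G_le: "riem_norm g (x t \<omega>) (G t \<omega>) \<le> A" if "\<omega> \<in> space P" for t \<omega>
    unfolding G_def by (rule batch_mean_le[OF draws.draw_in[OF that] x_K[OF that]])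
  have p0: "p t \<omega> \<ge> 0" for t \<omega> by (simp add: p_def grad_sq_def)
  have p_determined: "draws.determined t (p t)" for t
    unfolding p_def by (rule draws.determined_comp[OF x_determined])
  have a0: "a t \<omega> \<ge> 0" if "\<omega> \<in> space P" for t \<omega>
    unfolding a_def using \<eta>_pos[OF that] riem_norm_nonneg[OF G_tangent[OF that]] by (simp add: less_imp_le)

  have "compact (grad_sq ` K)"
    using compact_continuous_image[OF continuous_on_subset[OF continuous_grad_sq] K_compact] by blast
  then obtain C0 where C0: "\<And>y. y \<in> K \<Longrightarrow> grad_sq y \<le> C0"
    using compact_imp_bounded[of "grad_sq ` K"] by (auto simp: bounded_iff abs_le_iff)
  have p_le: "p t \<omega> \<le> C0" if "\<omega> \<in> space P" for t \<omega>
    unfolding p_def by (rule C0[OF x_K[OF that]])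
  have "compact (F ` K)"
    using compact_continuous_image[OF continuous_on_subset[OF C1_continuous[OF F_C1]] K_compact] by blast
  then obtain C1 where C1: "\<And>y. y \<in> K \<Longrightarrow> \<bar>F y\<bar> \<le> C1"
    using compact_imp_bounded[of "F ` K"] by (auto simp: bounded_iff)

  have joint: "draws.determined (Suc t) (\<lambda>\<omega>. f (\<eta> t \<omega>) (x t \<omega>) (Y t \<omega>))"
    for t and f :: "real \<Rightarrow> 'm \<Rightarrow> nat set \<Rightarrow> real"
  proof -
    have 1: "draws.determined (Suc t) (\<eta> t)" "draws.determined (Suc t) (x t)"
      using x_determined \<eta>_determined draws.determined_mono by (blast intro: le_SucI)+
    have 2: "draws.determined (Suc t) (Y t)" by (rule draws.determined_draw) simp
    from draws.determined_comp2[OF draws.determined_comp2[OF 1, of Pair] 2,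
        of "\<lambda>(e, z) y. f e z y"]
    show ?thesis by simp
  qed
  have \<xi>: "draws.martingale_difference \<xi>"
    unfolding draws.martingale_difference_def
  proof (intro allI conjI impI)
    fix t
    show "draws.determined (Suc t) (\<xi> t)"
      using joint[of t "\<lambda>e z y. e * (grad_sq z - g z (gradient \<A> g F z) (batch_mean t z y))"]
      by (simp only: \<xi>_def[abs_def] p_def s_def G_def)
    fix Z :: "'w \<Rightarrow> real" assume Z: "draws.determined t Z"
    let ?M = "minibatches N (b t)"
    \<comment> \<open>Past and future are separated: \<open>\<phi>\<close> takes the determined data first and the new draw second.\<close>
    define \<phi> where "\<phi> = (\<lambda>(c, z) y. c * (grad_sq z - g z (gradient \<A> g F z) (batch_mean t z y)))"
    have "draws.determined t (\<lambda>\<omega>. (Z \<omega> * \<eta> t \<omega>, x t \<omega>))"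
      by (rule draws.determined_comp2[OF draws.determined_comp2[OF Z \<eta>_determined, of "(*)"] x_determined])
    from draws.expectation_next_draw[OF this, of \<phi>]
    have "draws.expectation (\<lambda>\<omega>. \<phi> (Z \<omega> * \<eta> t \<omega>, x t \<omega>) (Y t \<omega>)) =
        draws.expectation (\<lambda>\<omega>. \<Sum>y\<in>?M. draws.prob {\<omega> \<in> space P. Y t \<omega> = y} * \<phi> (Z \<omega> * \<eta> t \<omega>, x t \<omega>) y)" .
    moreover have "(\<Sum>y\<in>?M. draws.prob {\<omega> \<in> space P. Y t \<omega> = y} * \<phi> (c, z) y) = 0" for c z
    proof -
      have card: "real (card ?M) > 0"
        unfolding card_minibatches using b_range[of t] by simp
      have "(\<Sum>y\<in>?M. draws.prob {\<omega> \<in> space P. Y t \<omega> = y} * \<phi> (c, z) y) =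
          (\<Sum>y\<in>?M. c / real (card ?M) * (grad_sq z - g z (gradient \<A> g F z) (batch_mean t z y)))"
        by (rule sum.cong) (simp_all add: Y_uniform \<phi>_def)
      also have "\<dots> = c / real (card ?M) *
          (real (card ?M) * grad_sq z - (\<Sum>y\<in>?M. g z (gradient \<A> g F z) (batch_mean t z y)))"
        by (simp only: sum_distrib_left[symmetric] sum_subtractf sum_constant)
      also have "(\<Sum>y\<in>?M. g z (gradient \<A> g F z) (batch_mean t z y)) = grad_sq z * real (card ?M)"
        using batch_mean_unbiased[of z t] card by (simp add: divide_eq_eq)
      finally show ?thesis by simp
    qed
    ultimately have "draws.expectation (\<lambda>\<omega>. \<phi> (Z \<omega> * \<eta> t \<omega>, x t \<omega>) (Y t \<omega>)) = 0" by simp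
    moreover have "\<phi> (Z \<omega> * \<eta> t \<omega>, x t \<omega>) (Y t \<omega>) = Z \<omega> * \<xi> t \<omega>" for \<omega>
      by (simp add: \<phi>_def \<xi>_def p_def s_def G_def)
    ultimately show "draws.expectation (\<lambda>\<omega>. Z \<omega> * \<xi> t \<omega>) = 0" by simp
  qed
  \<comment> \<open>The second moment of \<open>\<xi> t\<close> is at most that of \<open>\<eta> t * s t\<close>: the difference of the squares is
    \<open>2 * (\<eta> t * p t) * \<xi> t - (\<eta> t * p t)\<^sup>2\<close>, and the first term has expectation zero. This matters for
    adaptive step sizes, where \<open>(a t)\<^sup>2\<close> is summable while \<open>(\<eta> t * p t)\<^sup>2\<close> is not obviously so.\<close>
  have second_moment: "draws.expectation (\<lambda>\<omega>. (\<xi> t \<omega>)\<^sup>2) \<le> draws.expectation (\<lambda>\<omega>. C0 * (a t \<omega>)\<^sup>2)" for t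
  proof -
    have Z: "draws.determined t (\<lambda>\<omega>. 2 * (\<eta> t \<omega> * p t \<omega>))"
      by (rule draws.determined_comp[OF draws.determined_comp2[OF \<eta>_determined p_determined]])
    have zero: "draws.expectation (\<lambda>\<omega>. 2 * (\<eta> t \<omega> * p t \<omega>) * \<xi> t \<omega>) = 0"
      using \<xi> Z unfolding draws.martingale_difference_def by blast
    have int: "integrable P (\<lambda>\<omega>. f (\<eta> t \<omega>) (x t \<omega>) (Y t \<omega>))"
      for f :: "real \<Rightarrow> 'm \<Rightarrow> nat set \<Rightarrow> real"
      by (rule draws.determined_integrable[OF joint])
    have int1: "integrable P (\<lambda>\<omega>. 2 * (\<eta> t \<omega> * p t \<omega>) * \<xi> t \<omega>)"
      using int[of "\<lambda>e z y. 2 * (e * grad_sq z) * (e * (grad_sq z - g z (gradient \<A> g F z) (batch_mean t z y)))"]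
      by (simp only: \<xi>_def p_def s_def G_def)
    have int2: "integrable P (\<lambda>\<omega>. (\<xi> t \<omega>)\<^sup>2)"
      using int[of "\<lambda>e z y. (e * (grad_sq z - g z (gradient \<A> g F z) (batch_mean t z y)))\<^sup>2"]
      by (simp only: \<xi>_def p_def s_def G_def)
    have int3: "integrable P (\<lambda>\<omega>. C0 * (a t \<omega>)\<^sup>2)"
      using int[of "\<lambda>e z y. C0 * (e * riem_norm g z (batch_mean t z y))\<^sup>2"]
      by (simp only: a_def G_def)
    have "draws.expectation (\<lambda>\<omega>. (\<xi> t \<omega>)\<^sup>2) = draws.expectation (\<lambda>\<omega>. (\<xi> t \<omega>)\<^sup>2 - 2 * (\<eta> t \<omega> * p t \<omega>) * \<xi> t \<omega>)"
      using int1 int2 zero by simp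
    also have "\<dots> \<le> draws.expectation (\<lambda>\<omega>. C0 * (a t \<omega>)\<^sup>2)"
    proof (rule integral_mono)
      fix \<omega> assume \<omega>: "\<omega> \<in> space P"
      have "\<bar>s t \<omega>\<bar> \<le> riem_norm g (x t \<omega>) (gradient \<A> g F (x t \<omega>)) * riem_norm g (x t \<omega>) (G t \<omega>)"
        unfolding s_def by (rule riemannian_Cauchy_Schwarz[OF gradient_tangent G_tangent[OF \<omega>]])
      from power_mono[OF this, of 2]
      have "(s t \<omega>)\<^sup>2 \<le> p t \<omega> * (riem_norm g (x t \<omega>) (G t \<omega>))\<^sup>2"
        by (simp add: power_mult_distrib p_def grad_sq_def)
      also have "\<dots> \<le> C0 * (riem_norm g (x t \<omega>) (G t \<omega>))\<^sup>2"
        by (intro mult_right_mono p_le[OF \<omega>]) simp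
      finally have "(\<eta> t \<omega>)\<^sup>2 * (s t \<omega>)\<^sup>2 \<le> (\<eta> t \<omega>)\<^sup>2 * (C0 * (riem_norm g (x t \<omega>) (G t \<omega>))\<^sup>2)"
        by (rule mult_left_mono) simp
      also have "\<dots> = C0 * (a t \<omega>)\<^sup>2" by (simp add: a_def power_mult_distrib)
      finally have "(\<eta> t \<omega>)\<^sup>2 * (s t \<omega>)\<^sup>2 \<le> C0 * (a t \<omega>)\<^sup>2" .
      moreover have "(\<xi> t \<omega>)\<^sup>2 - 2 * (\<eta> t \<omega> * p t \<omega>) * \<xi> t \<omega> = (\<eta> t \<omega>)\<^sup>2 * (s t \<omega>)\<^sup>2 - (\<eta> t \<omega> * p t \<omega>)\<^sup>2"
        by (simp add: \<xi>_def power2_eq_square algebra_simps)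
      ultimately show "(\<xi> t \<omega>)\<^sup>2 - 2 * (\<eta> t \<omega> * p t \<omega>) * \<xi> t \<omega> \<le> C0 * (a t \<omega>)\<^sup>2"
        using zero_le_power2[of "\<eta> t \<omega> * p t \<omega>"] by linarith
    qed (use int1 int2 int3 in simp_all)
    finally show ?thesis .
  qed
  have noise: "AE \<omega> in P. convergent (\<lambda>n. \<Sum>t<n. \<xi> t \<omega>)"
  proof (rule draws.martingale_convergence[OF \<xi>])
    fix n
    have C0_nonneg: "C0 \<ge> 0"
      using draws.not_empty p0 p_le by (metis all_not_in_conv order_trans)
    have a_int: "integrable P (\<lambda>\<omega>. C0 * (a t \<omega>)\<^sup>2)" for t
      using draws.determined_integrable[OF joint[of t "\<lambda>e z y. C0 * (e * riem_norm g z (batch_mean t z y))\<^sup>2"]]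
      by (simp only: a_def G_def)
    have "(\<Sum>t<n. draws.expectation (\<lambda>\<omega>. (\<xi> t \<omega>)\<^sup>2)) \<le> (\<Sum>t<n. draws.expectation (\<lambda>\<omega>. C0 * (a t \<omega>)\<^sup>2))"
      by (rule sum_mono) (rule second_moment)
    also have "\<dots> = draws.expectation (\<lambda>\<omega>. \<Sum>t<n. C0 * (a t \<omega>)\<^sup>2)"
      by (rule Bochner_Integration.integral_sum[symmetric]) (rule a_int)
    also have "\<dots> \<le> draws.expectation (\<lambda>\<omega>. C0 * V)"
    proof (rule integral_mono)
      fix \<omega> assume "\<omega> \<in> space P"
      from squares[OF this, of n] have "C0 * (\<Sum>t<n. (a t \<omega>)\<^sup>2) \<le> C0 * V"
        unfolding a_def G_def by (rule mult_left_mono[OF _ C0_nonneg])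
      then show "(\<Sum>t<n. C0 * (a t \<omega>)\<^sup>2) \<le> C0 * V" by (simp add: sum_distrib_left)
    qed (use a_int in simp_all)
    also have "\<dots> = C0 * V" by (simp add: draws.prob_space)
    finally show "(\<Sum>t<n. draws.expectation (\<lambda>\<omega>. (\<xi> t \<omega>)\<^sup>2)) \<le> C0 * V" .
  qed

  obtain C where C: "C > 0"
    "\<And>y u. y \<in> K \<Longrightarrow> u \<in> tangent_space \<A> y \<Longrightarrow> riem_norm g y u \<le> A \<Longrightarrow>
       \<bar>F (R y u) - F y - g y (gradient \<A> g F y) u\<bar> \<le> C * (riem_norm g y u)\<^sup>2"
    using retraction_first_order_bound[OF F_C1 lipschitz] by blast
  have step_norm: "riem_norm g (x t \<omega>) (- \<eta> t \<omega> *\<^sub>R G t \<omega>) = a t \<omega>" if "\<omega> \<in> space P" for t \<omega>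
    using riem_norm_scale[OF G_tangent[OF that, of t], of "- \<eta> t \<omega>"] \<eta>_pos[OF that, of t]
    by (simp add: a_def)
  have path: "convergent (\<lambda>t. F (x t \<omega>)) \<and> (\<lambda>t. p t \<omega>) \<longlonglongrightarrow> 0"
    if \<omega>: "\<omega> \<in> space P" and noise: "convergent (\<lambda>n. \<Sum>t<n. \<xi> t \<omega>)" for \<omega>
  proof -
    have a_sq: "summable (\<lambda>t. (a t \<omega>)\<^sup>2)"
    proof (rule bounded_imp_summable)
      show "(\<Sum>t\<le>n. (a t \<omega>)\<^sup>2) \<le> V" for n
        using squares[OF \<omega>, of "Suc n"] by (simp only: a_def G_def lessThan_Suc_atMost)
    qed simp
    define e where "e t = F (x (Suc t) \<omega>) - F (x t \<omega>) + \<eta> t \<omega> * s t \<omega>" for t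
    have "\<bar>e t\<bar> \<le> C * (a t \<omega>)\<^sup>2" for t
    proof -
      have u: "- \<eta> t \<omega> *\<^sub>R G t \<omega> \<in> tangent_space \<A> (x t \<omega>)"
        by (rule tangent_scale[OF G_tangent[OF \<omega>]])
      have "g (x t \<omega>) (gradient \<A> g F (x t \<omega>)) (- \<eta> t \<omega> *\<^sub>R G t \<omega>) = - \<eta> t \<omega> * s t \<omega>"
        unfolding s_def by (rule metric_scale_right[OF G_tangent[OF \<omega>] gradient_tangent])
      moreover have "x (Suc t) \<omega> = R (x t \<omega>) (- \<eta> t \<omega> *\<^sub>R G t \<omega>)"
        unfolding G_def by (rule x_Suc[OF \<omega>])
      moreover have "a t \<omega> \<le> A" unfolding a_def G_def by (rule short[OF \<omega>])
      ultimately show ?thesis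
        using C(2)[OF x_K[OF \<omega>] u] step_norm[OF \<omega>, of t] by (simp only: e_def) simp
    qed
    then have e_sum: "summable e"
      using summable_comparison_test'[OF summable_mult[OF a_sq, of C], of 0 e] by simp
    have telescoped: "F (x n \<omega>) = F (x 0 \<omega>) - (\<Sum>t<n. \<eta> t \<omega> * p t \<omega>) + (\<Sum>t<n. \<xi> t \<omega>) + (\<Sum>t<n. e t)" for n
      by (induction n) (simp_all add: e_def \<xi>_def algebra_simps)
    have drop: "\<eta> t \<omega> * p t \<omega> \<ge> 0" for t using p0 \<eta>_pos[OF \<omega>] by (simp add: less_imp_le)
    have "Bseq (\<lambda>n. (\<Sum>t<n. \<xi> t \<omega>) + (\<Sum>t<n. e t))"
      using convergent_add[OF noise summable_iff_convergent[THEN iffD1, OF e_sum]]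
      by (rule convergent_imp_Bseq)
    then obtain B where B: "\<And>n. \<bar>(\<Sum>t<n. \<xi> t \<omega>) + (\<Sum>t<n. e t)\<bar> \<le> B"
      unfolding Bseq_def by auto
    have drop_sum: "summable (\<lambda>t. \<eta> t \<omega> * p t \<omega>)"
    proof (rule bounded_imp_summable[OF drop])
      fix n
      have "(\<Sum>t<Suc n. \<eta> t \<omega> * p t \<omega>) = F (x 0 \<omega>) - F (x (Suc n) \<omega>) + ((\<Sum>t<Suc n. \<xi> t \<omega>) + (\<Sum>t<Suc n. e t))"
        using telescoped[of "Suc n"] by linarith
      also have "\<dots> \<le> C1 + C1 + B"
        using C1[OF x_K[OF \<omega>], of 0] C1[OF x_K[OF \<omega>], of "Suc n"] B[of "Suc n"] by linarith
      finally show "(\<Sum>t\<le>n. \<eta> t \<omega> * p t \<omega>) \<le> C1 + C1 + B" by (simp only: lessThan_Suc_atMost)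
    qed
    have "convergent (\<lambda>n. F (x 0 \<omega>) - (\<Sum>t<n. \<eta> t \<omega> * p t \<omega>) + (\<Sum>t<n. \<xi> t \<omega>) + (\<Sum>t<n. e t))"
      by (intro convergent_add convergent_diff convergent_const noise
          summable_iff_convergent[THEN iffD1] drop_sum e_sum)
    then have conv: "convergent (\<lambda>n. F (x n \<omega>))" by (simp only: telescoped[symmetric])
    have "(\<lambda>t. grad_sq (x t \<omega>)) \<longlonglongrightarrow> 0"
    proof (rule slow_sequence_tendsto_zero[where K = K and \<eta> = "\<lambda>t. \<eta> t \<omega>" and a = "\<lambda>t. a t \<omega>" and A = A])
      show "summable (\<lambda>t. \<eta> t \<omega> * grad_sq (x t \<omega>))" using drop_sum by (simp only: p_def)
      show "(\<lambda>t. a t \<omega>) \<longlonglongrightarrow> 0"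
        using tendsto_real_sqrt[OF summable_LIMSEQ_zero[OF a_sq]] a0[OF \<omega>] by simp
      show "a t \<omega> \<le> A * \<eta> t \<omega>" for t
        unfolding a_def using mult_left_mono[OF G_le[OF \<omega>, of t], of "\<eta> t \<omega>"] \<eta>_pos[OF \<omega>, of t]
        by (simp add: mult.commute)
    next
      fix y U assume "y \<in> K" "open U" "y \<in> U"
      then obtain \<psi> L \<theta> where \<psi>: "isCont \<psi> y" "\<psi> y = 0" "\<And>z. \<psi> z < 1 \<Longrightarrow> z \<in> U" "L > 0" "\<theta> > 0"
        and step: "\<And>z u. \<psi> z < (1::real) \<Longrightarrow> u \<in> tangent_space \<A> z \<Longrightarrow> riem_norm g z u \<le> \<theta> \<Longrightarrow>
          \<psi> (R z u) \<le> \<psi> z + L * riem_norm g z u"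
        using retraction_escape_function by metis
      have "\<psi> (x (Suc t) \<omega>) \<le> \<psi> (x t \<omega>) + L * a t \<omega>" if "\<psi> (x t \<omega>) < 1" "a t \<omega> \<le> \<theta>" for t
        using step[OF that(1) tangent_scale[OF G_tangent[OF \<omega>, of t]], of "- \<eta> t \<omega>"] that(2)
        by (simp only: step_norm[OF \<omega>] x_Suc[OF \<omega>] G_def[symmetric])
      then show "\<exists>\<psi> L \<theta>. isCont \<psi> y \<and> \<psi> y = 0 \<and> (\<forall>z. \<psi> z < 1 \<longrightarrow> z \<in> U) \<and> L > 0 \<and> \<theta> > 0 \<and>
          (\<forall>t. \<psi> (x t \<omega>) < (1::real) \<longrightarrow> a t \<omega> \<le> \<theta> \<longrightarrow> \<psi> (x (Suc t) \<omega>) \<le> \<psi> (x t \<omega>) + L * a t \<omega>)"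
        using \<psi> by blast
    qed (use K_compact x_K[OF \<omega>] continuous_grad_sq \<eta>_pos[OF \<omega>] \<eta>_diverges[OF \<omega>] A_pos
        in \<open>auto simp: grad_sq_def\<close>)
    with conv show ?thesis by (simp only: p_def)
  qed
  have both: "AE \<omega> in P. convergent (\<lambda>t. F (x t \<omega>)) \<and> (\<lambda>t. p t \<omega>) \<longlonglongrightarrow> 0"
    using noise by (rule AE_mp) (intro AE_I2 impI path)
  then show "AE \<omega> in P. convergent (\<lambda>t. F (x t \<omega>))" by (rule AE_mp) simp
  have p_lim: "AE \<omega> in P. (\<lambda>t. p t \<omega>) \<longlonglongrightarrow> 0" using both by (rule AE_mp) simp
  have norm_eq: "riem_norm g (x t \<omega>) (gradient \<A> g F (x t \<omega>)) = sqrt (p t \<omega>)" for t \<omega>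
    using riem_norm_nonneg[OF gradient_tangent] by (simp add: p_def grad_sq_def)
  show "AE \<omega> in P. (\<lambda>t. riem_norm g (x t \<omega>) (gradient \<A> g F (x t \<omega>))) \<longlonglongrightarrow> 0"
    using p_lim by (rule AE_mp) (auto simp: norm_eq intro!: AE_I2 dest: tendsto_real_sqrt)
  have p_int: "integrable P (p t)" for t by (rule draws.determined_integrable[OF p_determined])
  then show "integrable P (\<lambda>\<omega>. (riem_norm g (x t \<omega>) (gradient \<A> g F (x t \<omega>)))\<^sup>2)" for t
    unfolding p_def[abs_def] grad_sq_def .
  have "(\<lambda>t. draws.expectation (p t)) \<longlonglongrightarrow> draws.expectation (\<lambda>\<omega>. 0)"
  proof (rule integral_dominated_convergence[where w = "\<lambda>_. C0"])
    show "AE \<omega> in P. norm (p t \<omega>) \<le> C0" for t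
      by (rule AE_I2) (use p0 p_le in auto)
  qed (use p_lim p_int in auto)
  then show "(\<lambda>t. \<integral>\<omega>. (riem_norm g (x t \<omega>) (gradient \<A> g F (x t \<omega>)))\<^sup>2 \<partial>P) \<longlonglongrightarrow> 0"
    by (simp add: p_def[abs_def] grad_sq_def)
qed

end

theorem corollary2p9:
  fixes \<A> :: "('m::{t2_space, second_countable_topology}, 'e::real_normed_vector) chart set"
    and g :: "('m, 'e) metric"
    and R :: "'m \<Rightarrow> ('m, 'e) tvec \<Rightarrow> 'm"
    and F :: "'m \<Rightarrow> real"
    and K :: "'m set"
    and A :: real
    and N :: nat
    and H :: "'m \<Rightarrow> nat \<Rightarrow> ('m, 'e) tvec"
    and b :: "nat \<Rightarrow> nat"
    and P :: "'w measure"
    and Y :: "nat \<Rightarrow> 'w \<Rightarrow> nat set"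
  assumes manifold: "riemannian_manifold \<A> g" "connected (UNIV :: 'm set)"
    and retraction: "manifold_retraction \<A> R"
    and F_C1: "Ck_function \<A> 1 F"
    and K_compact: "compact K"
    and A_pos: "A > 0"
    and lipschitz: "R_lipschitz \<A> g R K A (gradient \<A> g F)"
    and H_field: "\<And>l. l \<in> {1..N} \<Longrightarrow> vector_field \<A> (\<lambda>x. H x l)"
    and H_mean: "\<And>x. (1 / real N) *\<^sub>R (\<Sum>l=1..N. H x l) = gradient \<A> g F x"
    and H_bound: "\<And>x l. x \<in> K \<Longrightarrow> l \<in> {1..N} \<Longrightarrow> riem_norm g x (H x l) \<le> A"
    and b_range: "\<And>t. 1 \<le> b t \<and> b t \<le> N"
    and prob: "prob_space P"
    and Y_indep: "prob_space.indep_vars P (\<lambda>t. count_space (minibatches N (b t))) Y UNIV"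
    and Y_distr: "\<And>t. distr P (count_space (minibatches N (b t))) (Y t)
                        = uniform_count_measure (minibatches N (b t))"
  shows
    "(\<forall>(\<gamma>::nat \<Rightarrow> real) x0 (x::nat \<Rightarrow> 'w \<Rightarrow> 'm).
        (\<forall>t. 0 < \<gamma> t \<and> \<gamma> t \<le> 1) \<and>
        summable (\<lambda>t. (\<gamma> t)\<^sup>2) \<and>
        filterlim (\<lambda>n. \<Sum>t<n. \<gamma> t) at_top sequentially \<and>
        x0 \<in> K \<and>
        (\<forall>\<omega>\<in>space P. x 0 \<omega> = x0) \<and>
        (\<forall>t. \<forall>\<omega>\<in>space P. x (Suc t) \<omega> =
           R (x t \<omega>) (- (\<gamma> t / real (b t)) *\<^sub>R (\<Sum>y\<in>Y t \<omega>. H (x t \<omega>) y))) \<and>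
        (\<forall>t. \<forall>\<omega>\<in>space P. x t \<omega> \<in> K)
        \<longrightarrow>
        (AE \<omega> in P. convergent (\<lambda>t. F (x t \<omega>))) \<and>
        (AE \<omega> in P. (\<lambda>t. riem_norm g (x t \<omega>) (gradient \<A> g F (x t \<omega>))) \<longlonglongrightarrow> 0) \<and>
        (\<forall>t. integrable P (\<lambda>\<omega>. (riem_norm g (x t \<omega>) (gradient \<A> g F (x t \<omega>)))\<^sup>2)) \<and>
        (\<lambda>t. \<integral>\<omega>. (riem_norm g (x t \<omega>) (gradient \<A> g F (x t \<omega>)))\<^sup>2 \<partial>P) \<longlonglongrightarrow> 0)
     \<and>
     (\<forall>(\<alpha>::real) (\<beta>::real) (\<epsilon>::real) x0 (x::nat \<Rightarrow> 'w \<Rightarrow> 'm) (\<eta>::nat \<Rightarrow> 'w \<Rightarrow> real).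
        0 < \<alpha> \<and> 0 < \<beta> \<and> 0 < \<epsilon> \<and> \<epsilon> \<le> 1/2 \<and> \<alpha> \<le> \<beta> powr (1/2 + \<epsilon>) \<and>
        x0 \<in> K \<and>
        (\<forall>\<omega>\<in>space P. x 0 \<omega> = x0) \<and>
        (\<forall>t. \<forall>\<omega>\<in>space P. x (Suc t) \<omega> =
           R (x t \<omega>) (- (\<eta> t \<omega> / real (b t)) *\<^sub>R (\<Sum>y\<in>Y t \<omega>. H (x t \<omega>) y))) \<and>
        (\<forall>t. \<forall>\<omega>\<in>space P. \<eta> t \<omega> =
           \<alpha> / (\<beta> + (\<Sum>k<t. (riem_norm g (x k \<omega>)
                    ((1 / real (b k)) *\<^sub>R (\<Sum>y\<in>Y k \<omega>. H (x k \<omega>) y)))\<^sup>2)) powr (1/2 + \<epsilon>)) \<and>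
        (\<forall>t. \<forall>\<omega>\<in>space P. x t \<omega> \<in> K)
        \<longrightarrow>
        (AE \<omega> in P. convergent (\<lambda>t. F (x t \<omega>))) \<and>
        (AE \<omega> in P. (\<lambda>t. riem_norm g (x t \<omega>) (gradient \<A> g F (x t \<omega>))) \<longlonglongrightarrow> 0))"
proof -
  interpret prob_space P by (rule prob)
  \<comment> \<open>Both parts instantiate \<open>descent_convergence\<close>; the step size is a constant random variable in the
    first part and a function of the past in the second.\<close>
  have prob_draw: "prob {\<omega> \<in> space P. Y t \<omega> = y} = 1 / real (card (minibatches N (b t)))"
    if y: "y \<in> minibatches N (b t)" for t y
  proof -
    have meas: "Y t \<in> measurable P (count_space (minibatches N (b t)))"
      using Y_indep unfolding indep_vars_def by blast
    have "measure (distr P (count_space (minibatches N (b t))) (Y t)) {y} =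
        measure (uniform_count_measure (minibatches N (b t))) {y}"
      by (simp only: Y_distr)
    moreover have "measure (distr P (count_space (minibatches N (b t))) (Y t)) {y} =
        prob (Y t -` {y} \<inter> space P)"
      by (rule measure_distr[OF meas]) (use y in simp)
    moreover have "Y t -` {y} \<inter> space P = {\<omega> \<in> space P. Y t \<omega> = y}" by auto
    ultimately show ?thesis
      using measure_uniform_count_measure[OF finite_minibatches, of "{y}" N "b t"] y by simp
  qed
  interpret draws: independent_draws P "\<lambda>t. minibatches N (b t)" Y
    by unfold_locales (simp_all add: finite_minibatches Y_indep)
  interpret minibatch_gradient_descent \<A> g R P N b Y F K A H
    using manifold(1) retraction F_C1 K_compact A_pos lipschitz H_field H_mean H_bound b_range prob_draw
    by unfold_locales (simp_all only: riemannian_manifold_def)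
  have rewrite_step: "- (e / real (b t)) *\<^sub>R (\<Sum>l\<in>y. H z l) = - e *\<^sub>R batch_mean t z y" for e t z y
    unfolding batch_mean_def by (simp only: scaleR_scaleR) simp
  show ?thesis
  proof (intro conjI allI impI; elim conjE)
    fix \<gamma> :: "nat \<Rightarrow> real" and x0 and x :: "nat \<Rightarrow> 'w \<Rightarrow> 'm"
    assume \<gamma>: "\<forall>t. 0 < \<gamma> t \<and> \<gamma> t \<le> 1" "summable (\<lambda>t. (\<gamma> t)\<^sup>2)"
        "filterlim (\<lambda>n. \<Sum>t<n. \<gamma> t) at_top sequentially"
      and x_0: "\<forall>\<omega>\<in>space P. x 0 \<omega> = x0"
      and x_Suc: "\<forall>t. \<forall>\<omega>\<in>space P. x (Suc t) \<omega> =
           R (x t \<omega>) (- (\<gamma> t / real (b t)) *\<^sub>R (\<Sum>y\<in>Y t \<omega>. H (x t \<omega>) y))"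
      and x_K: "\<forall>t. \<forall>\<omega>\<in>space P. x t \<omega> \<in> K"
    have \<gamma>_pos: "\<gamma> t > 0" if "\<omega> \<in> space P" for t \<omega> using \<gamma>(1) by blast
    have x_0': "x 0 \<omega> = x0" and x_K': "x t \<omega> \<in> K"
      and x_Suc': "x (Suc t) \<omega> = R (x t \<omega>) (- \<gamma> t *\<^sub>R batch_mean t (x t \<omega>) (Y t \<omega>))"
      if "\<omega> \<in> space P" for t \<omega>
      using x_0 x_K x_Suc that by (simp_all only: rewrite_step)
    let ?n = "\<lambda>t \<omega>. riem_norm g (x t \<omega>) (batch_mean t (x t \<omega>) (Y t \<omega>))"
    have n_le: "0 \<le> ?n t \<omega>" "?n t \<omega> \<le> A" if "\<omega> \<in> space P" for t \<omega>
      using draws.draw_in[OF that] x_K that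
      by (auto intro: riem_norm_nonneg batch_mean_tangent batch_mean_le)
    have short: "\<gamma> t * ?n t \<omega> \<le> A" if "\<omega> \<in> space P" for t \<omega>
      using mult_mono[of "\<gamma> t" 1 "?n t \<omega>" A] \<gamma>(1) n_le[OF that, of t] by (simp add: less_imp_le)
    have squares: "(\<Sum>t<n. (\<gamma> t * ?n t \<omega>)\<^sup>2) \<le> A\<^sup>2 * (\<Sum>t. (\<gamma> t)\<^sup>2)" if "\<omega> \<in> space P" for n \<omega>
    proof -
      have "(\<Sum>t<n. (\<gamma> t * ?n t \<omega>)\<^sup>2) \<le> (\<Sum>t<n. A\<^sup>2 * (\<gamma> t)\<^sup>2)"
        using n_le[OF that]
        by (intro sum_mono) (simp add: power_mult_distrib mult.commute[of "A\<^sup>2"] mult_left_mono power_mono)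
      also have "\<dots> \<le> A\<^sup>2 * (\<Sum>t. (\<gamma> t)\<^sup>2)"
        unfolding sum_distrib_left[symmetric]
        by (intro mult_left_mono sum_le_suminf[OF \<gamma>(2)]) auto
      finally show ?thesis .
    qed
    note conclusions = descent_convergence[where \<eta> = "\<lambda>t _. \<gamma> t" and x = x and start = x0,
        OF x_0' x_Suc' x_K' draws.determined_const \<gamma>_pos \<gamma>(3) short squares]
    show "AE \<omega> in P. convergent (\<lambda>t. F (x t \<omega>))"
      by (rule conclusions(1))
    show "AE \<omega> in P. (\<lambda>t. riem_norm g (x t \<omega>) (gradient \<A> g F (x t \<omega>))) \<longlonglongrightarrow> 0"
      by (rule conclusions(2))
    show "integrable P (\<lambda>\<omega>. (riem_norm g (x t \<omega>) (gradient \<A> g F (x t \<omega>)))\<^sup>2)" for t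
      by (rule conclusions(3))
    show "(\<lambda>t. \<integral>\<omega>. (riem_norm g (x t \<omega>) (gradient \<A> g F (x t \<omega>)))\<^sup>2 \<partial>P) \<longlonglongrightarrow> 0"
      by (rule conclusions(4))
  next
    fix \<alpha> \<beta> \<epsilon> :: real and x0 and x :: "nat \<Rightarrow> 'w \<Rightarrow> 'm" and \<eta> :: "nat \<Rightarrow> 'w \<Rightarrow> real"
    assume par: "0 < \<alpha>" "0 < \<beta>" "0 < \<epsilon>" "\<epsilon> \<le> 1/2" "\<alpha> \<le> \<beta> powr (1/2 + \<epsilon>)"
      and x_0: "\<forall>\<omega>\<in>space P. x 0 \<omega> = x0"
      and x_Suc: "\<forall>t. \<forall>\<omega>\<in>space P. x (Suc t) \<omega> =
           R (x t \<omega>) (- (\<eta> t \<omega> / real (b t)) *\<^sub>R (\<Sum>y\<in>Y t \<omega>. H (x t \<omega>) y))"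
      and \<eta>: "\<forall>t. \<forall>\<omega>\<in>space P. \<eta> t \<omega> =
           \<alpha> / (\<beta> + (\<Sum>k<t. (riem_norm g (x k \<omega>)
                    ((1 / real (b k)) *\<^sub>R (\<Sum>y\<in>Y k \<omega>. H (x k \<omega>) y)))\<^sup>2)) powr (1/2 + \<epsilon>)"
      and x_K: "\<forall>t. \<forall>\<omega>\<in>space P. x t \<omega> \<in> K"
    have x_0': "x 0 \<omega> = x0" and x_K': "x t \<omega> \<in> K"
      and x_Suc': "x (Suc t) \<omega> = R (x t \<omega>) (- \<eta> t \<omega> *\<^sub>R batch_mean t (x t \<omega>) (Y t \<omega>))"
      if "\<omega> \<in> space P" for t \<omega>
      using x_0 x_K x_Suc that by (simp_all only: rewrite_step)
    define n where "n t \<omega> = riem_norm g (x t \<omega>) (batch_mean t (x t \<omega>) (Y t \<omega>))" for t \<omega>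
    define S where "S t \<omega> = \<beta> + (\<Sum>k<t. (n k \<omega>)\<^sup>2)" for t \<omega>
    have \<eta>_eq: "\<eta> t \<omega> = \<alpha> / S t \<omega> powr (1/2 + \<epsilon>)" if "\<omega> \<in> space P" for t \<omega>
      using \<eta> that by (simp only: S_def n_def batch_mean_def)
    have n_le: "0 \<le> n t \<omega>" "n t \<omega> \<le> A" if "\<omega> \<in> space P" for t \<omega>
      using draws.draw_in[OF that] x_K that unfolding n_def
      by (auto intro: riem_norm_nonneg batch_mean_tangent batch_mean_le)
    have n_sq: "(n t \<omega>)\<^sup>2 \<le> A\<^sup>2" if "\<omega> \<in> space P" for t \<omega>
      using n_le[OF that] by (rule power_mono[rotated])
    have S_ge: "\<beta> \<le> S t \<omega>" for t \<omega> by (simp add: S_def sum_nonneg)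
    have S_pos: "S t \<omega> > 0" for t \<omega> using S_ge[of t \<omega>] par(2) by linarith
    have \<eta>_pos: "\<eta> t \<omega> > 0" if "\<omega> \<in> space P" for t \<omega>
      using S_pos[of t \<omega>] par(1) by (simp add: \<eta>_eq[OF that])
    have \<eta>_le: "\<eta> t \<omega> \<le> 1" if "\<omega> \<in> space P" for t \<omega>
    proof -
      have "\<alpha> \<le> S t \<omega> powr (1/2 + \<epsilon>)"
        using par S_ge[of t \<omega>] powr_mono2[of "1/2 + \<epsilon>" \<beta> "S t \<omega>"] by simp
      then show ?thesis using S_pos[of t \<omega>] by (simp add: \<eta>_eq[OF that])
    qed
    have short: "\<eta> t \<omega> * n t \<omega> \<le> A" if "\<omega> \<in> space P" for t \<omega>
      using mult_mono[of "\<eta> t \<omega>" 1 "n t \<omega>" A] \<eta>_pos[OF that, of t] \<eta>_le[OF that, of t] n_le[OF that, of t]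
      by simp
    have squares: "(\<Sum>t<m. (\<eta> t \<omega> * n t \<omega>)\<^sup>2) \<le>
        \<alpha>\<^sup>2 * ((1 + A\<^sup>2 / \<beta>) powr (1 + 2 * \<epsilon>) / (2 * \<epsilon>) * \<beta> powr (- (2 * \<epsilon>)))" if \<omega>: "\<omega> \<in> space P" for m \<omega>
    proof -
      have sq: "(S t \<omega> powr (1/2 + \<epsilon>))\<^sup>2 = S t \<omega> powr (1 + 2 * \<epsilon>)" for t
        by (simp add: power2_eq_square flip: powr_add)
      have "(\<Sum>t<m. (\<eta> t \<omega> * n t \<omega>)\<^sup>2) = \<alpha>\<^sup>2 * (\<Sum>t<m. (n t \<omega>)\<^sup>2 / S t \<omega> powr (1 + 2 * \<epsilon>))"
        unfolding sum_distrib_left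
        by (rule sum.cong) (simp_all add: \<eta>_eq[OF \<omega>] power_mult_distrib power_divide sq)
      also have "\<dots> \<le> \<alpha>\<^sup>2 * ((1 + A\<^sup>2 / \<beta>) powr (1 + 2 * \<epsilon>) / (2 * \<epsilon>) * \<beta> powr (- (2 * \<epsilon>)))"
        unfolding S_def
        by (intro mult_left_mono adaptive_step_squares_bounded) (use par n_sq[OF \<omega>] in auto)
      finally show ?thesis .
    qed
    have diverges: "filterlim (\<lambda>m. \<Sum>t<m. \<eta> t \<omega>) at_top sequentially" if \<omega>: "\<omega> \<in> space P" for \<omega>
      unfolding \<eta>_eq[OF \<omega>] S_def
      by (rule adaptive_steps_diverge[where c = "A\<^sup>2"]) (use par n_sq[OF \<omega>] in auto)
    \<comment> \<open>The iterate and the step size refer to each other, so they are treated in one induction.\<close>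
    have both: "draws.determined t (x t) \<and> draws.determined t (\<eta> t)" for t
    proof (induction t rule: less_induct)
      case (less t)
      have x_t: "draws.determined t (x t)"
      proof (cases t)
        case 0
        then show ?thesis using x_0 by (simp add: draws.determined_def)
      next
        case (Suc k)
        have 1: "draws.determined t (x k)" "draws.determined t (\<eta> k)"
          using less[of k] Suc by (auto intro: draws.determined_mono[of k])
        have 2: "draws.determined t (Y k)" by (rule draws.determined_draw) (simp add: Suc)
        from draws.determined_comp2[OF draws.determined_comp2[OF 1, of Pair] 2,
            of "\<lambda>(z, e) y. R z (- e *\<^sub>R batch_mean k z y)"]
        show ?thesis unfolding Suc
          by (subst draws.determined_cong[where Z' =
                "\<lambda>\<omega>. R (x k \<omega>) (- \<eta> k \<omega> *\<^sub>R batch_mean k (x k \<omega>) (Y k \<omega>))"])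
             (simp_all add: x_Suc')
      qed
      have "draws.determined t (n k)" if "k < t" for k
      proof -
        have "draws.determined t (x k)" "draws.determined t (Y k)"
          using less[OF that] that by (auto intro: draws.determined_mono[of k] draws.determined_draw)
        then show ?thesis unfolding n_def by (rule draws.determined_comp2)
      qed
      then have "draws.determined t (\<lambda>\<omega>. \<Sum>k<t. (n k \<omega>)\<^sup>2)"
        by (intro draws.determined_sum) (simp add: draws.determined_comp[where f = "\<lambda>z. z\<^sup>2"])
      from draws.determined_comp[OF this, of "\<lambda>z. \<alpha> / (\<beta> + z) powr (1/2 + \<epsilon>)"]
      have "draws.determined t (\<eta> t)"
        by (subst draws.determined_cong[OF \<eta>_eq]) (simp_all add: S_def)
      with x_t show ?case ..
    qed
    note conclusions = descent_convergence[where \<eta> = \<eta> and x = x and start = x0,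
        OF x_0' x_Suc' x_K' both[THEN conjunct2] \<eta>_pos diverges short[unfolded n_def] squares[unfolded n_def]]
    show "AE \<omega> in P. convergent (\<lambda>t. F (x t \<omega>))"
      by (rule conclusions(1))
    show "AE \<omega> in P. (\<lambda>t. riem_norm g (x t \<omega>) (gradient \<A> g F (x t \<omega>))) \<longlonglongrightarrow> 0"
      by (rule conclusions(2))
  qed
qed

end
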